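(* Let $p\ge1$ be an integer, $Q>0$, $\alpha>1/2$ and $\sigma^2>0$. For each $n\ge1$ let $\pi_n$ be the Gaussian prior restricted to $E_p(Q)$ defined in the context (independent coordinates, $\theta_0\equiv 0$, $\theta_j\sim N(0,\sigma^2v_j^{-(2p+1)})$ for $1\le j\le N_n$ and $\theta_j\sim N(0,\sigma^2v_j^{-2(2p+\alpha)})$ for $j\ge N_n+1$, conditioned on $E_p(Q)$), and let $\Pi_n$ be the prior it induces on $\mathscr F=\{f_{\boldsymbol\theta}:\boldsymbol\theta\in E_p(Q)\}$. If $\boldsymbol\theta_0\in E_p(Q)$ and $P_0=P_{\boldsymbol\theta_0}$, then for a sufficiently large constant $M>0$, $$\Pi_n\big(\{P_{\boldsymbol\theta}:\ d_{\mathrm H}(P_0,P_{\boldsymbol\theta})>Mn^{-p/(2p+1)}\}\,\big|\,X_1,\dots,X_n\big)\to0\quad\text{as }n\to\infty,$$ $P_0^\infty$-almost surely.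
   Context: Trigonometric system on $[0,1]$: $\phi_0\equiv1$ and, for $k\ge1$, $\phi_{2k-1}(x)=\sqrt2\sin(2\pi kx)$, $\phi_{2k}(x)=\sqrt2\cos(2\pi kx)$. Put $v_0=0$ and, for $j\ge1$, $v_j=j+1$ if $j$ is odd, $v_j=j$ if $j$ is even. The Sobolev ellipsoid is $E_p(Q)=\{\boldsymbol\theta\in\ell_2:\sum_{j=0}^\infty v_j^{2p}\theta_j^2<Q\}$. For $\boldsymbol\theta\in E_p(Q)$, $P_{\boldsymbol\theta}$ is the probability measure on $[0,1]$ with Lebesgue density $$f_{\boldsymbol\theta}(x)=\frac{\exp\{\sum_{j=1}^\infty\theta_j\phi_j(x)\}}{\int_0^1\exp\{\sum_{j=1}^\infty\theta_j\phi_j(t)\}\,dt},\qquad x\in[0,1].$$ The Hellinger distance is $d_{\mathrm H}(P_{\boldsymbol\theta'},P_{\boldsymbol\theta})=\{\int_0^1(\sqrt{f_{\boldsymbol\theta'}}-\sqrt{f_{\boldsymbol\theta}})^2\,dx\}^{1/2}$. The prior: let $A=\sum_{j=1}^\infty v_j^{-2p}$, $B=\sqrt{2QA}$, $B_1^2=e^{-8B}$, $\varepsilon_n=n^{-p/(2p+1)}$ and $N_n=\lceil(8Q/(B_1^2\varepsilon_n^2))^{1/(2p)}\rceil$. Let $\mu_n$ be the product probability measure on $\mathbb R^\infty$ (sequences $(\theta_0,\theta_1,\dots)$) under which the coordinates are independent, $\theta_0$ is a point mass at $0$, $\theta_j\sim N(0,\sigma^2v_j^{-(2p+1)})$ for $j=1,\dots,N_n$,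 and $\theta_j\sim N(0,\sigma^2v_j^{-2(2p+\alpha)})$ for $j\ge N_n+1$. Then $\pi_n(\cdot)=\mu_n(\cdot\cap E_p(Q))/\mu_n(E_p(Q))$. The observations $X_1,X_2,\dots$ are i.i.d. from $P_0$; $P_0^\infty$ is the infinite product measure of $P_0$; the posterior is given by Bayes' formula: $\Pi_n(C\mid X_1,\dots,X_n)=\int_{\{\boldsymbol\theta:P_{\boldsymbol\theta}\in C\}}\prod_{i=1}^nf_{\boldsymbol\theta}(X_i)\,\pi_n(d\boldsymbol\theta)\big/\int\prod_{i=1}^nf_{\boldsymbol\theta}(X_i)\,\pi_n(d\boldsymbol\theta)$. *)

theory Defs
  imports "HOL-Probability.Probability"
begin

definition trig_basis :: "nat \<Rightarrow> real \<Rightarrow> real" where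
  "trig_basis j x =
     (if j = 0 then 1
      else if odd j then sqrt 2 * sin (2 * pi * real ((j + 1) div 2) * x)
      else sqrt 2 * cos (2 * pi * real (j div 2) * x))"

lemma trig_basis_odd:
  "k \<ge> 1 \<Longrightarrow> trig_basis (2 * k - 1) x = sqrt 2 * sin (2 * pi * real k * x)"
  by (cases k) (simp_all add: trig_basis_def)

lemma trig_basis_even:
  "k \<ge> 1 \<Longrightarrow> trig_basis (2 * k) x = sqrt 2 * cos (2 * pi * real k * x)"
  by (simp add: trig_basis_def)

definition freq :: "nat \<Rightarrow> nat" where
  "freq j = (if odd j then j + 1 else j)"

text \<open>The strict bound on the series includes its convergence: a divergent series of
  nonnegative terms has value infinity, whereas \<^term>\<open>suminf\<close> would return an unspecified real.\<close>

definition sobolev_ellipsoid :: "nat \<Rightarrow> real \<Rightarrow> (nat \<Rightarrow> real) set" where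
  "sobolev_ellipsoid p Q =
     {\<theta>. summable (\<lambda>j. (\<theta> j)\<^sup>2) \<and>
          summable (\<lambda>j. real (freq j) ^ (2 * p) * (\<theta> j)\<^sup>2) \<and>
          (\<Sum>j. real (freq j) ^ (2 * p) * (\<theta> j)\<^sup>2) < Q}"

text \<open>Series over \<open>j \<ge> 1\<close> are written with the index shifted by \<^const>\<open>Suc\<close>.
  In particular the coordinate \<open>\<theta> 0\<close> does not enter the density.\<close>

definition exp_series :: "(nat \<Rightarrow> real) \<Rightarrow> real \<Rightarrow> real" where
  "exp_series \<theta> x = exp (\<Sum>j. \<theta> (Suc j) * trig_basis (Suc j) x)"

definition dens :: "(nat \<Rightarrow> real) \<Rightarrow> real \<Rightarrow> real" where
  "dens \<theta> x = exp_series \<theta> x / (LBINT t:{0..1}. exp_series \<theta> t)"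

definition model_measure :: "(nat \<Rightarrow> real) \<Rightarrow> real measure" where
  "model_measure \<theta> = density (restrict_space lborel {0..1}) (\<lambda>x. ennreal (dens \<theta> x))"

text \<open>The Hellinger distance between \<^term>\<open>model_measure \<theta>'\<close> and \<^term>\<open>model_measure \<theta>\<close>.\<close>

definition hellinger :: "(nat \<Rightarrow> real) \<Rightarrow> (nat \<Rightarrow> real) \<Rightarrow> real" where
  "hellinger \<theta>' \<theta> = sqrt (LBINT x:{0..1}. (sqrt (dens \<theta>' x) - sqrt (dens \<theta> x))\<^sup>2)"

definition rate :: "nat \<Rightarrow> nat \<Rightarrow> real" where
  "rate p n = real n powr (- (real p / (2 * real p + 1)))"

definition const_A :: "nat \<Rightarrow> real" where
  "const_A p = (\<Sum>j. 1 / real (freq (Suc j)) ^ (2 * p))"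

definition const_B :: "nat \<Rightarrow> real \<Rightarrow> real" where
  "const_B p Q = sqrt (2 * Q * const_A p)"

definition const_B1_sq :: "nat \<Rightarrow> real \<Rightarrow> real" where
  "const_B1_sq p Q = exp (- 8 * const_B p Q)"

definition cutoff :: "nat \<Rightarrow> real \<Rightarrow> nat \<Rightarrow> nat" where
  "cutoff p Q n =
     nat \<lceil>(8 * Q / (const_B1_sq p Q * (rate p n)\<^sup>2)) powr (1 / (2 * real p))\<rceil>"

definition centered_gaussian :: "real \<Rightarrow> real measure" where
  "centered_gaussian var = density lborel (\<lambda>x. ennreal (normal_density 0 (sqrt var) x))"

definition coord_law :: "nat \<Rightarrow> real \<Rightarrow> real \<Rightarrow> real \<Rightarrow> nat \<Rightarrow> nat \<Rightarrow> real measure" where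
  "coord_law p Q \<alpha> \<sigma> n j =
     (if j = 0 then return borel 0
      else if j \<le> cutoff p Q n then
        centered_gaussian (\<sigma>\<^sup>2 * real (freq j) powr (- (2 * real p + 1)))
      else
        centered_gaussian (\<sigma>\<^sup>2 * real (freq j) powr (- 2 * (2 * real p + \<alpha>))))"

definition gauss_product ::
    "nat \<Rightarrow> real \<Rightarrow> real \<Rightarrow> real \<Rightarrow> nat \<Rightarrow> (nat \<Rightarrow> real) measure" where
  "gauss_product p Q \<alpha> \<sigma> n = PiM UNIV (coord_law p Q \<alpha> \<sigma> n)"

text \<open>\<^const>\<open>uniform_measure\<close> is conditioning on a set:
  \<open>emeasure (uniform_measure M A) B = emeasure M (A \<inter> B) / emeasure M A\<close>.\<close>

definition prior ::
    "nat \<Rightarrow> real \<Rightarrow> real \<Rightarrow> real \<Rightarrow> nat \<Rightarrow> (nat \<Rightarrow> real) measure" where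
  "prior p Q \<alpha> \<sigma> n = uniform_measure (gauss_product p Q \<alpha> \<sigma> n) (sobolev_ellipsoid p Q)"

text \<open>The observations are indexed from \<open>0\<close>, so that the first \<open>n\<close> of them are
  \<open>X 0, \<dots>, X (n - 1)\<close>.\<close>

definition likelihood :: "nat \<Rightarrow> (nat \<Rightarrow> real) \<Rightarrow> (nat \<Rightarrow> real) \<Rightarrow> real" where
  "likelihood n X \<theta> = (\<Prod>i<n. dens \<theta> (X i))"

definition posterior ::
    "nat \<Rightarrow> real \<Rightarrow> real \<Rightarrow> real \<Rightarrow> nat \<Rightarrow> (nat \<Rightarrow> real) \<Rightarrow> real measure set \<Rightarrow> real" where
  "posterior p Q \<alpha> \<sigma> n X C =
     (LINT \<theta>:{\<theta> \<in> sobolev_ellipsoid p Q. model_measure \<theta> \<in> C}|prior p Q \<alpha> \<sigma> n. likelihood n X \<theta>)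
     / (LINT \<theta>|prior p Q \<alpha> \<sigma> n. likelihood n X \<theta>)"

end

theory Submission
  imports Defs
begin

text \<open>
  Put \<open>\<tau> = n powr (1 / (2 * p + 1))\<close>, so that the rate is \<open>\<epsilon> = 1 / \<tau> ^ p\<close> and \<open>n * \<epsilon>\<^sup>2 = \<tau>\<close>; the
  cutoff of the prior is of exact order \<open>\<tau>\<close>.  The posterior mass of a set is a quotient of two
  integrals of the likelihood ratio against the true density, and it is enough to show that, outside
  an event of probability of order \<open>exp (- \<tau>)\<close>, the denominator is at least \<open>exp (- c * \<tau>)\<close> with a
  constant \<open>c\<close> independent of \<open>M\<close>, while the numerator over the set where the Hellinger distance
  exceeds \<open>M * \<epsilon>\<close> is at most \<open>exp (- C * \<tau>)\<close> with \<open>C\<close> as large as desired once \<open>M\<close> is large.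
  Since \<open>exp (- \<tau>)\<close> is summable in \<open>n\<close>, the Borel-Cantelli lemma then gives almost sure convergence.

  All distances reduce to the Euclidean distance of coefficients.  On the ellipsoid the log-densities
  are uniformly bounded, so every density lies between two positive constants; by Parseval's identity
  the \<open>L\<^sup>2\<close> distance and the chi-square divergence of two densities are then controlled by the squared
  distance \<open>sqdist\<close> of their coefficients (\<open>dens_L2_le\<close>, \<open>chi_square_le\<close>).

  Denominator.  Let \<open>S\<close> be a set of parameters whose chi-square divergence from the truth is of order
  \<open>\<epsilon>\<^sup>2\<close>.  The expected average over \<open>S\<close> of the inverse likelihood ratio is then at most
  \<open>exp (c * n * \<epsilon>\<^sup>2)\<close>, and Markov's inequality bounds the integral of the likelihood ratio over \<open>S\<close> from
  below by the prior mass of \<open>S\<close> times \<open>exp (- c * \<tau>)\<close> (\<open>evidence_lower_bound\<close>).  The prior gives such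
  an \<open>S\<close> mass \<open>exp (- c * \<tau>)\<close> (\<open>prior_mass_ge\<close>).  The reason is that the standard deviation of coordinate
  \<open>j\<close> is of order \<open>j powr (- p - 1 / 2)\<close>, so a box of side \<open>\<epsilon> / sqrt N\<close> in the first \<open>N\<close> coordinates has
  Gaussian mass \<open>(\<Prod>j. (j / N) powr (p + 1 / 2))\<close> up to a factor exponential in \<open>N\<close>, and this product is
  itself only exponentially small in \<open>N\<close>.  The remaining coordinates have such a small variance that
  they almost do not contribute to the Sobolev norm.

  Numerator.  The ellipsoid is covered by \<open>exp (c * \<tau>)\<close> cells of radius \<open>\<epsilon>\<close>
  (\<open>sobolev_ellipsoid_cover\<close>).  In a cell whose representative \<open>\<eta>\<close> is at Hellinger distance at least
  \<open>M * \<epsilon>\<close>, the likelihood ratio is divided by the square root of the likelihood ratio of \<open>\<eta>\<close>.  That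
  square root is below \<open>1\<close> outside an event of probability \<open>exp (- M\<^sup>2 * \<tau> / 2)\<close> (\<open>affinity_le\<close>), and the
  quotient has expectation at most \<open>exp (c * \<tau> - M\<^sup>2 * \<tau> / 4)\<close> for every parameter of the cell
  (\<open>neighbour_affinity_le\<close>).  A large \<open>M\<close> beats the number of cells and the denominator
  (\<open>posterior_ratio_bound\<close>, \<open>posterior_contraction_step\<close>).
\<close>

section \<open>The trigonometric system on the unit interval\<close>

abbreviation unit_lebesgue :: "real measure" where
  "unit_lebesgue \<equiv> restrict_space lborel {0..1}"

lemma prob_space_unit_lebesgue: "prob_space unit_lebesgue"
  by (intro prob_spaceI) (simp add: space_restrict_space emeasure_restrict_space)

interpretation U: prob_space unit_lebesgue
  by (rule prob_space_unit_lebesgue)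

lemma integrable_unit_bounded:
  fixes f :: "real \<Rightarrow> real"
  assumes "f \<in> borel_measurable borel" "\<And>x. \<bar>f x\<bar> \<le> c"
  shows "integrable unit_lebesgue f"
  using assms by (intro U.integrable_const_bound[where B = c]) (auto intro!: measurable_restrict_space1)

lemma set_integral_unit:
  fixes f :: "real \<Rightarrow> real"
  shows "(LBINT x:{0..1}. f x) = (LINT x|unit_lebesgue. f x)"
  by (simp add: set_lebesgue_integral_def integral_restrict_space)

lemma integral_cos_period:
  "(LINT x|unit_lebesgue. cos (2 * pi * of_int k * x)) = (if k = 0 then 1 else 0)"
proof (cases "k = 0")
  case True
  then show ?thesis using U.prob_space by simp
next
  case False
  have "(LINT x|lborel. cos (2 * pi * of_int k * x) * indicator {0..1} x) =
      sin (2 * pi * of_int k * 1) / (2 * pi * of_int k) - sin (2 * pi * of_int k * 0) / (2 * pi * of_int k)"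
    using False by (intro integral_FTC_Icc_real) (auto intro!: derivative_eq_intros)
  also have "\<dots> = 0"
    using sin_int_2pin by (simp add: mult.assoc)
  finally show ?thesis using False
    by (simp add: integral_restrict_space set_lebesgue_integral_def mult.commute)
qed

lemma integral_sin_period:
  "(LINT x|unit_lebesgue. sin (2 * pi * of_int k * x)) = 0"
proof (cases "k = 0")
  case False
  have "(LINT x|lborel. sin (2 * pi * of_int k * x) * indicator {0..1} x) =
      - cos (2 * pi * of_int k * 1) / (2 * pi * of_int k) - (- cos (2 * pi * of_int k * 0) / (2 * pi * of_int k))"
    using False by (intro integral_FTC_Icc_real) (auto intro!: derivative_eq_intros)
  also have "\<dots> = 0"
    using cos_int_2pin by (simp add: mult.assoc)
  finally show ?thesis using False
    by (simp add: integral_restrict_space set_lebesgue_integral_def mult.commute)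
qed simp

lemma trig_basis_measurable [measurable]: "trig_basis j \<in> borel_measurable borel"
  unfolding trig_basis_def[abs_def] by measurable

lemma abs_trig_basis_le: "\<bar>trig_basis j x\<bar> \<le> sqrt 2"
  by (auto simp: trig_basis_def abs_mult intro!: mult_left_le)

text \<open>Both parities are written with a common frequency index; the addition theorems turn each product into
  a sum of a cosine or sine of the sum and of the difference of the frequencies, and only the cosine of
  frequency \<open>0\<close> has a nonzero integral.\<close>

lemma trig_basis_orthonormal:
  assumes "0 < i" "0 < j"
  shows "(LINT x|unit_lebesgue. trig_basis i x * trig_basis j x) = (if i = j then 1 else 0)"
proof -
  define k l :: int where "k = int ((i + 1) div 2)" and "l = int ((j + 1) div 2)"
  have kl: "k > 0" "l > 0" using assms by (auto simp: k_def l_def)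
  have bi: "trig_basis i x = sqrt 2 * (if odd i then sin (2 * pi * of_int k * x) else cos (2 * pi * of_int k * x))"
    and bj: "trig_basis j x = sqrt 2 * (if odd j then sin (2 * pi * of_int l * x) else cos (2 * pi * of_int l * x))" for x
    using assms by (auto simp: trig_basis_def k_def l_def)
  have int: "integrable unit_lebesgue (\<lambda>x. cos (2 * pi * of_int m * x))"
            "integrable unit_lebesgue (\<lambda>x. sin (2 * pi * of_int m * x))" for m :: int
    by (intro integrable_unit_bounded[where c = 1]; measurable; auto)+
  have arg: "2 * pi * of_int k * x - 2 * pi * of_int l * x = 2 * pi * of_int (k - l) * x"
    "2 * pi * of_int k * x + 2 * pi * of_int l * x = 2 * pi * of_int (k + l) * x" for x :: real
    by (auto simp: algebra_simps)
  have eq: "i = j \<longleftrightarrow> k = l \<and> (odd i \<longleftrightarrow> odd j)"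
    unfolding k_def l_def by (auto elim!: oddE evenE)
  have s2: "(sqrt 2 * a) * (sqrt 2 * b) = 2 * (a * b)" for a b :: real by simp
  have "(LINT x|unit_lebesgue. trig_basis i x * trig_basis j x) =
     (if odd i then (if odd j then (LINT x|unit_lebesgue. cos (2 * pi * of_int (k - l) * x) - cos (2 * pi * of_int (k + l) * x))
        else (LINT x|unit_lebesgue. sin (2 * pi * of_int (k + l) * x) + sin (2 * pi * of_int (k - l) * x)))
      else (if odd j then (LINT x|unit_lebesgue. sin (2 * pi * of_int (k + l) * x) - sin (2 * pi * of_int (k - l) * x))
        else (LINT x|unit_lebesgue. cos (2 * pi * of_int (k - l) * x) + cos (2 * pi * of_int (k + l) * x))))"
    unfolding bi bj s2 arg[symmetric] sin_add sin_diff cos_add cos_diff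
    by (auto intro!: Bochner_Integration.integral_cong simp: algebra_simps)
  also have "\<dots> = (if i = j then 1 else 0)"
    unfolding Bochner_Integration.integral_diff[OF int(1) int(1)] Bochner_Integration.integral_add[OF int(1) int(1)]
      Bochner_Integration.integral_diff[OF int(2) int(2)] Bochner_Integration.integral_add[OF int(2) int(2)]
      integral_cos_period integral_sin_period
    using kl by (simp add: eq)
  finally show ?thesis .
qed

section \<open>Log-densities with absolutely summable coefficients\<close>

text \<open>The factor \<open>sqrt 2\<close> is the supremum of a basis function, so \<open>b\<close> bounds the log-series uniformly in
  \<open>x\<close>.  This ball is what the density estimates use: the ellipsoid is contained in one of them, and its
  elements have everywhere absolutely convergent log-series.\<close>

definition coeff_ball :: "real \<Rightarrow> (nat \<Rightarrow> real) set" where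
  "coeff_ball b = {\<theta>. summable (\<lambda>j. \<bar>\<theta> (Suc j)\<bar>) \<and> sqrt 2 * (\<Sum>j. \<bar>\<theta> (Suc j)\<bar>) \<le> b}"

definition sqdist :: "(nat \<Rightarrow> real) \<Rightarrow> (nat \<Rightarrow> real) \<Rightarrow> real" where
  "sqdist \<theta> \<theta>' = (\<Sum>j. (\<theta> (Suc j) - \<theta>' (Suc j))\<^sup>2)"

definition log_series :: "(nat \<Rightarrow> real) \<Rightarrow> real \<Rightarrow> real" where
  "log_series \<theta> x = (\<Sum>j. \<theta> (Suc j) * trig_basis (Suc j) x)"

lemma coeff_ball_nonneg: "\<theta> \<in> coeff_ball b \<Longrightarrow> 0 \<le> b"
  unfolding coeff_ball_def
  by (auto intro: order_trans[rotated] simp: suminf_nonneg)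

lemma exp_series_eq: "exp_series \<theta> x = exp (log_series \<theta> x)"
  by (simp add: exp_series_def log_series_def)

lemma log_series_measurable [measurable]: "log_series \<theta> \<in> borel_measurable borel"
  unfolding log_series_def[abs_def] by measurable

lemma
  assumes "summable (\<lambda>j. \<bar>\<theta> (Suc j)\<bar>)"
  shows summable_log_series: "summable (\<lambda>j. \<theta> (Suc j) * trig_basis (Suc j) x)"
    and abs_log_series_le: "\<bar>log_series \<theta> x\<bar> \<le> sqrt 2 * (\<Sum>j. \<bar>\<theta> (Suc j)\<bar>)"
    and abs_log_series_partial_le: "\<bar>\<Sum>j<n. \<theta> (Suc j) * trig_basis (Suc j) x\<bar> \<le> sqrt 2 * (\<Sum>j. \<bar>\<theta> (Suc j)\<bar>)"
proof -
  have le: "\<bar>\<theta> (Suc j) * trig_basis (Suc j) x\<bar> \<le> sqrt 2 * \<bar>\<theta> (Suc j)\<bar>" for j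
    unfolding abs_mult using mult_right_mono[OF abs_trig_basis_le, of "\<bar>\<theta> (Suc j)\<bar>" "Suc j" x]
    by (simp add: mult.commute)
  have s2: "summable (\<lambda>j. sqrt 2 * \<bar>\<theta> (Suc j)\<bar>)"
    using assms by (rule summable_mult)
  have sa: "summable (\<lambda>j. \<bar>\<theta> (Suc j) * trig_basis (Suc j) x\<bar>)"
    by (rule summable_comparison_test'[OF s2, of 0]) (use le in auto)
  then show "summable (\<lambda>j. \<theta> (Suc j) * trig_basis (Suc j) x)"
    by (rule summable_rabs_cancel)
  have "\<bar>log_series \<theta> x\<bar> \<le> (\<Sum>j. \<bar>\<theta> (Suc j) * trig_basis (Suc j) x\<bar>)"
    unfolding log_series_def by (rule summable_rabs[OF sa])
  also have "\<dots> \<le> (\<Sum>j. sqrt 2 * \<bar>\<theta> (Suc j)\<bar>)"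
    by (rule suminf_le[OF le sa s2])
  also have "\<dots> = sqrt 2 * (\<Sum>j. \<bar>\<theta> (Suc j)\<bar>)"
    using assms by (rule suminf_mult)
  finally show "\<bar>log_series \<theta> x\<bar> \<le> sqrt 2 * (\<Sum>j. \<bar>\<theta> (Suc j)\<bar>)" .
  have "\<bar>\<Sum>j<n. \<theta> (Suc j) * trig_basis (Suc j) x\<bar> \<le> (\<Sum>j<n. sqrt 2 * \<bar>\<theta> (Suc j)\<bar>)"
    by (rule order_trans[OF sum_abs sum_mono[OF le]])
  also have "\<dots> \<le> (\<Sum>j. sqrt 2 * \<bar>\<theta> (Suc j)\<bar>)"
    by (rule sum_le_suminf[OF s2]) auto
  also have "\<dots> = sqrt 2 * (\<Sum>j. \<bar>\<theta> (Suc j)\<bar>)"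
    using assms by (rule suminf_mult)
  finally show "\<bar>\<Sum>j<n. \<theta> (Suc j) * trig_basis (Suc j) x\<bar> \<le> sqrt 2 * (\<Sum>j. \<bar>\<theta> (Suc j)\<bar>)" .
qed

lemma abs_log_series_le_bound: "\<theta> \<in> coeff_ball b \<Longrightarrow> \<bar>log_series \<theta> x\<bar> \<le> b"
  using abs_log_series_le[of \<theta> x] by (auto simp: coeff_ball_def)

lemma summable_square_of_abs:
  fixes d :: "nat \<Rightarrow> real"
  assumes "summable (\<lambda>j. \<bar>d j\<bar>)"
  shows "summable (\<lambda>j. (d j)\<^sup>2)"
proof -
  have "(\<lambda>j. \<bar>d j\<bar>) \<longlonglongrightarrow> 0" by (rule summable_LIMSEQ_zero[OF assms])
  then have "eventually (\<lambda>j. \<bar>d j\<bar> < 1) sequentially"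
    by (rule order_tendstoD) simp
  then have "eventually (\<lambda>j. norm ((d j)\<^sup>2) \<le> \<bar>d j\<bar>) sequentially"
  proof eventually_elim
    case (elim j)
    have "\<bar>d j\<bar> * \<bar>d j\<bar> \<le> 1 * \<bar>d j\<bar>" using elim by (intro mult_right_mono) auto
    then show ?case by (simp add: power2_eq_square)
  qed
  then show ?thesis by (rule summable_comparison_test_ev[OF _ assms])
qed

text \<open>Orthonormality gives the identity for partial sums.  They are uniformly bounded because the
  coefficients are absolutely summable, so dominated convergence passes to the limit.\<close>

lemma parseval:
  assumes "summable (\<lambda>j. \<bar>d (Suc j)\<bar>)"
  shows "(LINT x|unit_lebesgue. (log_series d x)\<^sup>2) = (\<Sum>j. (d (Suc j))\<^sup>2)"
proof -
  let ?S = "\<lambda>n x. \<Sum>j<n. d (Suc j) * trig_basis (Suc j) x"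
  let ?c = "sqrt 2 * (\<Sum>j. \<bar>d (Suc j)\<bar>)"
  have fin: "(LINT x|unit_lebesgue. (?S n x)\<^sup>2) = (\<Sum>j<n. (d (Suc j))\<^sup>2)" for n
  proof -
    have int: "integrable unit_lebesgue (\<lambda>x. trig_basis i x * trig_basis j x)" for i j
      by (rule integrable_unit_bounded[where c = "sqrt 2 * sqrt 2"])
         (auto simp: abs_mult simp del: real_sqrt_mult_self intro!: mult_mono abs_trig_basis_le)
    have "(LINT x|unit_lebesgue. (?S n x)\<^sup>2) =
       (LINT x|unit_lebesgue. (\<Sum>i<n. \<Sum>j<n. (d (Suc i) * d (Suc j)) * (trig_basis (Suc i) x * trig_basis (Suc j) x)))"
      by (simp add: power2_eq_square sum_product algebra_simps)
    also have "\<dots> = (\<Sum>i<n. \<Sum>j<n. (d (Suc i) * d (Suc j)) * (if i = j then 1 else 0))"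
      using int by (simp add: Bochner_Integration.integral_sum trig_basis_orthonormal)
    also have "\<dots> = (\<Sum>j<n. (d (Suc j))\<^sup>2)"
      by (simp add: power2_eq_square if_distrib sum.delta cong: if_cong)
    finally show ?thesis .
  qed
  have "(\<lambda>n. LINT x|unit_lebesgue. (?S n x)\<^sup>2) \<longlonglongrightarrow> (LINT x|unit_lebesgue. (log_series d x)\<^sup>2)"
  proof (rule integral_dominated_convergence[where w = "\<lambda>_. ?c\<^sup>2"])
    show "AE x in unit_lebesgue. (\<lambda>n. (?S n x)\<^sup>2) \<longlonglongrightarrow> (log_series d x)\<^sup>2"
      unfolding log_series_def
      by (intro AE_I2 tendsto_power summable_LIMSEQ summable_log_series assms)
    show "AE x in unit_lebesgue. norm ((?S n x)\<^sup>2) \<le> ?c\<^sup>2" for n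
      using abs_log_series_partial_le[OF assms]
      by (intro AE_I2) (auto simp: abs_le_square_iff[symmetric] intro: order_trans[OF _ abs_ge_self])
  qed (auto intro!: measurable_restrict_space1)
  moreover have "(\<lambda>n. LINT x|unit_lebesgue. (?S n x)\<^sup>2) \<longlonglongrightarrow> (\<Sum>j. (d (Suc j))\<^sup>2)"
    unfolding fin by (intro summable_LIMSEQ summable_square_of_abs assms)
  ultimately show ?thesis by (rule LIMSEQ_unique)
qed

lemma sqdist_eq_L2:
  assumes "\<theta> \<in> coeff_ball b" "\<theta>' \<in> coeff_ball b"
  shows "(LINT x|unit_lebesgue. (log_series \<theta> x - log_series \<theta>' x)\<^sup>2) = sqdist \<theta> \<theta>'"
proof -
  have s: "summable (\<lambda>j. \<bar>\<theta> (Suc j)\<bar>)" "summable (\<lambda>j. \<bar>\<theta>' (Suc j)\<bar>)"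
    using assms by (auto simp: coeff_ball_def)
  have "summable (\<lambda>j. \<bar>\<theta> (Suc j) - \<theta>' (Suc j)\<bar>)"
    by (rule summable_comparison_test'[OF summable_add[OF s], of 0]) auto
  then have "(LINT x|unit_lebesgue. (log_series (\<lambda>j. \<theta> j - \<theta>' j) x)\<^sup>2) = sqdist \<theta> \<theta>'"
    unfolding sqdist_def by (rule parseval)
  moreover have "log_series (\<lambda>j. \<theta> j - \<theta>' j) x = log_series \<theta> x - log_series \<theta>' x" for x
    unfolding log_series_def left_diff_distrib
    by (rule suminf_diff[symmetric]) (intro summable_log_series s)+
  ultimately show ?thesis by simp
qed

section \<open>Distances between densities and between coefficients\<close>

lemma dens_eq: "dens \<theta> x = exp (log_series \<theta> x) / (LINT t|unit_lebesgue. exp (log_series \<theta> t))"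
  unfolding dens_def set_integral_unit exp_series_eq ..

lemma dens_nonneg: "0 \<le> dens \<theta> x"
  unfolding dens_eq by (intro divide_nonneg_nonneg Bochner_Integration.integral_nonneg) auto

lemma dens_measurable [measurable]: "dens \<theta> \<in> borel_measurable borel"
  unfolding dens_eq[abs_def] by measurable

lemma integrable_exp_log_series:
  "\<theta> \<in> coeff_ball b \<Longrightarrow> integrable unit_lebesgue (\<lambda>x. exp (log_series \<theta> x))"
  by (rule integrable_unit_bounded[where c = "exp b"])
     (use abs_log_series_le_bound in \<open>force simp: abs_le_iff\<close>)+

lemma
  assumes "\<theta> \<in> coeff_ball b"
  shows normalizer_ge: "exp (- b) \<le> (LINT t|unit_lebesgue. exp (log_series \<theta> t))"
    and normalizer_le: "(LINT t|unit_lebesgue. exp (log_series \<theta> t)) \<le> exp b"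
proof -
  have b: "- b \<le> log_series \<theta> t" "log_series \<theta> t \<le> b" for t
    using abs_log_series_le_bound[OF assms, of t] by auto
  show "exp (- b) \<le> (LINT t|unit_lebesgue. exp (log_series \<theta> t))"
    by (rule U.integral_ge_const) (use b integrable_exp_log_series[OF assms] in auto)
  show "(LINT t|unit_lebesgue. exp (log_series \<theta> t)) \<le> exp b"
    by (rule U.integral_le_const) (use b integrable_exp_log_series[OF assms] in auto)
qed

lemma
  assumes "\<theta> \<in> coeff_ball b"
  shows dens_ge: "exp (- 2 * b) \<le> dens \<theta> x"
    and dens_le: "dens \<theta> x \<le> exp (2 * b)"
    and dens_pos: "0 < dens \<theta> x"
proof -
  have b: "exp (- b) \<le> exp (log_series \<theta> x)" "exp (log_series \<theta> x) \<le> exp b"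
    using abs_log_series_le_bound[OF assms, of x] by auto
  have z: "0 < (LINT t|unit_lebesgue. exp (log_series \<theta> t))"
    using normalizer_ge[OF assms] by (rule less_le_trans[OF exp_gt_zero])
  have "exp (- 2 * b) = exp (- b) / exp b"
    unfolding exp_diff[symmetric] by simp
  also have "\<dots> \<le> dens \<theta> x"
    unfolding dens_eq using b(1) normalizer_le[OF assms] z by (intro frac_le) auto
  finally show ge: "exp (- 2 * b) \<le> dens \<theta> x" .
  then show "0 < dens \<theta> x" by (rule less_le_trans[OF exp_gt_zero])
  have "dens \<theta> x \<le> exp b / exp (- b)"
    unfolding dens_eq using b(2) normalizer_ge[OF assms] z by (intro frac_le) auto
  also have "\<dots> = exp (2 * b)" unfolding exp_diff[symmetric] by simp
  finally show "dens \<theta> x \<le> exp (2 * b)" .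
qed

lemma integrable_dens: "\<theta> \<in> coeff_ball b \<Longrightarrow> integrable unit_lebesgue (dens \<theta>)"
  by (rule integrable_unit_bounded[where c = "exp (2 * b)"])
     (auto simp: dens_nonneg intro: dens_le)

lemma integral_dens: "\<theta> \<in> coeff_ball b \<Longrightarrow> (LINT x|unit_lebesgue. dens \<theta> x) = 1"
  using normalizer_ge[of \<theta> b] exp_gt_zero[of "- b"]
  unfolding dens_eq by (simp del: exp_gt_zero)

lemma prob_space_model_measure:
  assumes "\<theta> \<in> coeff_ball b" shows "prob_space (model_measure \<theta>)"
proof (rule prob_spaceI)
  have "emeasure (model_measure \<theta>) (space (model_measure \<theta>)) = (\<integral>\<^sup>+x. ennreal (dens \<theta> x) \<partial>unit_lebesgue)"
    unfolding model_measure_def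
    by (subst emeasure_density)
       (auto intro!: measurable_restrict_space1 nn_integral_cong simp: indicator_def space_restrict_space sets_restrict_space_iff)
  also have "\<dots> = 1"
    by (subst nn_integral_eq_integral)
       (use integrable_dens[OF assms] integral_dens[OF assms] dens_nonneg in auto)
  finally show "emeasure (model_measure \<theta>) (space (model_measure \<theta>)) = 1" .
qed

lemma nn_integral_model_measure:
  assumes "\<theta> \<in> coeff_ball b" and [measurable]: "g \<in> borel_measurable borel" and "\<And>x. 0 \<le> g x"
  shows "(\<integral>\<^sup>+x. ennreal (g x) \<partial>model_measure \<theta>) = (\<integral>\<^sup>+x. ennreal (dens \<theta> x * g x) \<partial>unit_lebesgue)"
proof -
  have "(\<lambda>x. ennreal (g x)) \<in> borel_measurable unit_lebesgue"
       "(\<lambda>x. ennreal (dens \<theta> x)) \<in> borel_measurable unit_lebesgue"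
    by (auto intro!: measurable_restrict_space1)
  then show ?thesis
    unfolding model_measure_def
    by (subst nn_integral_density) (auto simp: ennreal_mult dens_nonneg assms)
qed

lemma abs_exp_diff_le:
  fixes s t :: real
  assumes "s \<le> b" "t \<le> b"
  shows "\<bar>exp s - exp t\<bar> \<le> exp b * \<bar>s - t\<bar>"
proof -
  have *: "exp s - exp t \<le> exp b * (s - t)" if "t \<le> s" "s \<le> b" for s t :: real
  proof -
    have "1 - exp (t - s) \<le> s - t" using exp_ge_add_one_self[of "t - s"] by linarith
    then have "exp s * (1 - exp (t - s)) \<le> exp s * (s - t)" by (rule mult_left_mono) simp
    also have "\<dots> \<le> exp b * (s - t)" using that by (intro mult_right_mono) auto
    finally show ?thesis by (simp add: right_diff_distrib exp_add[symmetric])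
  qed
  show ?thesis
    using *[of s t] *[of t s] assms by (cases "t \<le> s") (auto simp: abs_if)
qed

text \<open>The exponential is Lipschitz on bounded sets, with respect both to the log-series and to the
  normalising constant, and the normalising constants differ by at most a multiple of the \<open>L\<^sup>1\<close> distance
  of the log-series, which the \<open>L\<^sup>2\<close> distance dominates on a probability space.\<close>

lemma dens_L2_le:
  assumes \<theta>: "\<theta> \<in> coeff_ball b" and \<theta>': "\<theta>' \<in> coeff_ball b"
  shows "(LINT x|unit_lebesgue. (dens \<theta> x - dens \<theta>' x)\<^sup>2) \<le> 4 * exp (8 * b) * sqdist \<theta> \<theta>'"
proof -
  define S T where "S = log_series \<theta>" and "T = log_series \<theta>'"
  define Y Z where "Y = (LINT t|unit_lebesgue. exp (S t))" and "Z = (LINT t|unit_lebesgue. exp (T t))"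
  define D where "D = (LINT x|unit_lebesgue. \<bar>S x - T x\<bar>)"
  note b0 = coeff_ball_nonneg[OF \<theta>]
  have [measurable]: "S \<in> borel_measurable borel" "T \<in> borel_measurable borel"
    by (auto simp: S_def T_def)
  have bS: "\<bar>S x\<bar> \<le> b" and bT: "\<bar>T x\<bar> \<le> b" for x
    using abs_log_series_le_bound \<theta> \<theta>' by (auto simp: S_def T_def)
  have bD: "\<bar>S x - T x\<bar> \<le> 2 * b" for x using bS[of x] bT[of x] by auto
  have intD: "integrable unit_lebesgue (\<lambda>x. \<bar>S x - T x\<bar>)"
    by (rule integrable_unit_bounded[where c = "2 * b"]) (use bD in auto)
  have intD2: "integrable unit_lebesgue (\<lambda>x. (S x - T x)\<^sup>2)"
  proof (rule integrable_unit_bounded[where c = "(2 * b)\<^sup>2"])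
    show "\<bar>(S x - T x)\<^sup>2\<bar> \<le> (2 * b)\<^sup>2" for x
      unfolding abs_power2 by (subst abs_le_square_iff[symmetric]) (use bD[of x] b0 in auto)
  qed simp
  have Y: "exp (- b) \<le> Y" and Z: "exp (- b) \<le> Z"
    using normalizer_ge[OF \<theta>] normalizer_ge[OF \<theta>'] by (auto simp: Y_def Z_def S_def T_def)
  have Yp: "0 < Y" and Zp: "0 < Z" using Y Z by (auto intro: less_le_trans[OF exp_gt_zero])
  have iS: "integrable unit_lebesgue (\<lambda>x. exp (S x))" and iT: "integrable unit_lebesgue (\<lambda>x. exp (T x))"
    using integrable_exp_log_series \<theta> \<theta>' by (auto simp: S_def T_def)
  have ed: "\<bar>exp (S x) - exp (T x)\<bar> \<le> exp b * \<bar>S x - T x\<bar>" for x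
    by (rule abs_exp_diff_le) (use bS[of x] bT[of x] in auto)
  have "\<bar>Y - Z\<bar> = \<bar>LINT x|unit_lebesgue. exp (S x) - exp (T x)\<bar>"
    using iS iT by (simp add: Y_def Z_def)
  also have "\<dots> \<le> (LINT x|unit_lebesgue. \<bar>exp (S x) - exp (T x)\<bar>)"
    by (rule integral_abs_bound)
  also have "\<dots> \<le> (LINT x|unit_lebesgue. exp b * \<bar>S x - T x\<bar>)"
    using iS iT intD ed by (intro integral_mono) auto
  also have "\<dots> = exp b * D" by (simp add: D_def)
  finally have YZ: "\<bar>Y - Z\<bar> \<le> exp b * D" .
  have D0: "0 \<le> D" unfolding D_def by (intro Bochner_Integration.integral_nonneg) auto
  \<comment> \<open>Nonnegativity of the variance replaces the Cauchy-Schwarz inequality.\<close>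
  have "0 \<le> U.variance (\<lambda>x. \<bar>S x - T x\<bar>)" by (rule U.variance_positive)
  also have "\<dots> = (LINT x|unit_lebesgue. (S x - T x)\<^sup>2) - D\<^sup>2"
    unfolding D_def by (subst U.variance_eq) (use intD intD2 in auto)
  finally have D2: "D\<^sup>2 \<le> sqdist \<theta> \<theta>'"
    using sqdist_eq_L2[OF \<theta> \<theta>'] by (simp add: S_def T_def)
  have inv: "1 / y \<le> exp b" if "exp (- b) \<le> y" for y :: real
  proof -
    have "1 / y \<le> 1 / exp (- b)" by (rule frac_le) (use that in auto)
    then show ?thesis by (simp add: exp_minus divide_inverse)
  qed
  have pt: "\<bar>dens \<theta> x - dens \<theta>' x\<bar> \<le> exp (2 * b) * \<bar>S x - T x\<bar> + exp (4 * b) * D" for x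
  proof -
    have "dens \<theta> x - dens \<theta>' x = (exp (S x) - exp (T x)) * (1 / Y) + exp (T x) * ((Z - Y) * ((1 / Y) * (1 / Z)))"
      unfolding dens_eq S_def[symmetric] T_def[symmetric] Y_def[symmetric] Z_def[symmetric]
      using Yp Zp by (simp add: field_simps)
    also have "\<bar>\<dots>\<bar> \<le> \<bar>exp (S x) - exp (T x)\<bar> * (1 / Y) + exp (T x) * (\<bar>Y - Z\<bar> * ((1 / Y) * (1 / Z)))"
      using Yp Zp by (intro order_trans[OF abs_triangle_ineq]) (simp add: abs_mult abs_minus_commute)
    also have "\<dots> \<le> (exp b * \<bar>S x - T x\<bar>) * exp b + exp b * ((exp b * D) * (exp b * exp b))"
      using ed[of x] bT[of x] YZ Yp Zp D0 inv[OF Y] inv[OF Z]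
      by (intro add_mono mult_mono) auto
    also have "\<dots> = exp b ^ 2 * \<bar>S x - T x\<bar> + exp b ^ 4 * D"
      by (simp add: power2_eq_square power4_eq_xxxx algebra_simps)
    also have "\<dots> = exp (2 * b) * \<bar>S x - T x\<bar> + exp (4 * b) * D"
      by (simp add: exp_of_nat_mult[symmetric])
    finally show ?thesis .
  qed
  have e4: "exp (2 * b) \<le> exp (4 * b)" using b0 by simp
  have sq: "(dens \<theta> x - dens \<theta>' x)\<^sup>2 \<le> 2 * exp (8 * b) * (S x - T x)\<^sup>2 + 2 * exp (8 * b) * D\<^sup>2" for x
  proof -
    have "\<bar>dens \<theta> x - dens \<theta>' x\<bar> \<le> exp (4 * b) * (\<bar>S x - T x\<bar> + D)"
      using order_trans[OF pt[of x]] mult_right_mono[OF e4, of "\<bar>S x - T x\<bar>"]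
      by (simp add: distrib_left)
    then have "\<bar>dens \<theta> x - dens \<theta>' x\<bar>\<^sup>2 \<le> (exp (4 * b) * (\<bar>S x - T x\<bar> + D))\<^sup>2"
      by (rule power_mono) simp
    also have "\<dots> = exp (8 * b) * (\<bar>S x - T x\<bar> + D)\<^sup>2"
      by (simp add: power_mult_distrib exp_of_nat_mult[symmetric])
    also have "\<dots> \<le> exp (8 * b) * (2 * \<bar>S x - T x\<bar>\<^sup>2 + 2 * D\<^sup>2)"
      using zero_le_power2[of "\<bar>S x - T x\<bar> - D"]
      by (intro mult_left_mono) (auto simp: power2_eq_square algebra_simps)
    finally show ?thesis by (simp add: algebra_simps)
  qed
  have "(LINT x|unit_lebesgue. (dens \<theta> x - dens \<theta>' x)\<^sup>2)
      \<le> (LINT x|unit_lebesgue. 2 * exp (8 * b) * (S x - T x)\<^sup>2 + 2 * exp (8 * b) * D\<^sup>2)"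
    using sq intD2 by (intro integral_mono') auto
  also have "\<dots> = 2 * exp (8 * b) * sqdist \<theta> \<theta>' + 2 * exp (8 * b) * D\<^sup>2"
    using intD2 sqdist_eq_L2[OF \<theta> \<theta>'] U.prob_space by (simp add: S_def T_def)
  also have "\<dots> \<le> 2 * exp (8 * b) * sqdist \<theta> \<theta>' + 2 * exp (8 * b) * sqdist \<theta> \<theta>'"
    using D2 by (intro add_left_mono mult_left_mono) auto
  finally show ?thesis by (simp add: mult_ac)
qed

lemma integrable_dens_diff2:
  assumes \<theta>: "\<theta> \<in> coeff_ball b" and \<theta>': "\<theta>' \<in> coeff_ball b"
  shows "integrable unit_lebesgue (\<lambda>x. (dens \<theta> x - dens \<theta>' x)\<^sup>2)"
proof (rule integrable_unit_bounded[where c = "(exp (2 * b))\<^sup>2"])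
  fix x
  have "\<bar>dens \<theta> x - dens \<theta>' x\<bar> \<le> exp (2 * b)"
    using dens_le[OF \<theta>, of x] dens_le[OF \<theta>', of x] dens_nonneg[of \<theta> x] dens_nonneg[of \<theta>' x] by auto
  then show "\<bar>(dens \<theta> x - dens \<theta>' x)\<^sup>2\<bar> \<le> (exp (2 * b))\<^sup>2"
    by (simp add: abs_le_square_iff[symmetric])
qed simp

lemma integrable_sqrt_dens_diff2:
  assumes \<theta>: "\<theta> \<in> coeff_ball b" and \<theta>': "\<theta>' \<in> coeff_ball b"
  shows "integrable unit_lebesgue (\<lambda>x. (sqrt (dens \<theta> x) - sqrt (dens \<theta>' x))\<^sup>2)"
proof (rule integrable_unit_bounded[where c = "(sqrt (exp (2 * b)))\<^sup>2"])
  fix x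
  have "\<bar>sqrt (dens \<theta> x) - sqrt (dens \<theta>' x)\<bar> \<le> sqrt (exp (2 * b))"
    using real_sqrt_le_mono[OF dens_le[OF \<theta>, of x]] real_sqrt_le_mono[OF dens_le[OF \<theta>', of x]]
      real_sqrt_ge_zero[OF dens_nonneg[of \<theta> x]] real_sqrt_ge_zero[OF dens_nonneg[of \<theta>' x]] by linarith
  then show "\<bar>(sqrt (dens \<theta> x) - sqrt (dens \<theta>' x))\<^sup>2\<bar> \<le> (sqrt (exp (2 * b)))\<^sup>2"
    unfolding abs_power2 by (subst abs_le_square_iff[symmetric]) simp
qed simp

lemma hellinger_sq:
  "(hellinger \<theta>' \<theta>)\<^sup>2 = (LINT x|unit_lebesgue. (sqrt (dens \<theta>' x) - sqrt (dens \<theta> x))\<^sup>2)"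
  unfolding hellinger_def set_integral_unit by (rule real_sqrt_pow2) (simp add: Bochner_Integration.integral_nonneg)

text \<open>The form in which the pointwise algebraic bounds between densities are integrated.\<close>

lemma nn_integral_unit_le:
  fixes f g :: "real \<Rightarrow> real"
  assumes "integrable unit_lebesgue g" "\<And>x. f x \<le> g x" "\<And>x. 0 \<le> f x" "(LINT x|unit_lebesgue. g x) \<le> c"
  shows "(\<integral>\<^sup>+x. ennreal (f x) \<partial>unit_lebesgue) \<le> ennreal c"
proof -
  have "0 \<le> g x" for x using assms(2,3)[of x] by linarith
  have "(\<integral>\<^sup>+x. ennreal (f x) \<partial>unit_lebesgue) \<le> (\<integral>\<^sup>+x. ennreal (g x) \<partial>unit_lebesgue)"
    by (intro nn_integral_mono ennreal_leI assms)
  also have "\<dots> = ennreal (LINT x|unit_lebesgue. g x)"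
    using assms(1) \<open>\<And>x. 0 \<le> g x\<close> by (intro nn_integral_eq_integral) auto
  also have "\<dots> \<le> ennreal c" using assms(4) by (rule ennreal_leI)
  finally show ?thesis .
qed

text \<open>Pointwise, \<open>f0\<^sup>2 / f = 2 * f0 - f + (f - f0)\<^sup>2 / f\<close>: the first two terms integrate to \<open>1\<close>, and \<open>1 / f\<close>
  is bounded.  The bound is weakened to an exponential because it will be raised to the power \<open>n\<close>.\<close>

lemma chi_square_le:
  assumes \<theta>0: "\<theta>0 \<in> coeff_ball b" and \<theta>: "\<theta> \<in> coeff_ball b"
  shows "(\<integral>\<^sup>+x. ennreal (dens \<theta>0 x / dens \<theta> x) \<partial>model_measure \<theta>0)
    \<le> ennreal (exp (4 * exp (10 * b) * sqdist \<theta> \<theta>0))"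
proof -
  let ?f = "dens \<theta>" and ?r = "dens \<theta>0"
  let ?g = "\<lambda>x. 2 * ?r x - ?f x + exp (2 * b) * (?f x - ?r x)\<^sup>2"
  have "(\<integral>\<^sup>+x. ennreal (?r x / ?f x) \<partial>model_measure \<theta>0) = (\<integral>\<^sup>+x. ennreal (?r x * (?r x / ?f x)) \<partial>unit_lebesgue)"
    by (rule nn_integral_model_measure[OF \<theta>0]) (auto simp: dens_nonneg)
  also have "\<dots> \<le> ennreal (exp (4 * exp (10 * b) * sqdist \<theta> \<theta>0))"
  proof (rule nn_integral_unit_le)
    show "integrable unit_lebesgue ?g"
      using integrable_dens[OF \<theta>] integrable_dens[OF \<theta>0] integrable_dens_diff2[OF \<theta> \<theta>0] by auto
    have "(LINT x|unit_lebesgue. ?g x) = 1 + exp (2 * b) * (LINT x|unit_lebesgue. (?f x - ?r x)\<^sup>2)"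
      using integrable_dens[OF \<theta>] integrable_dens[OF \<theta>0] integrable_dens_diff2[OF \<theta> \<theta>0]
        integral_dens[OF \<theta>] integral_dens[OF \<theta>0] by simp
    also have "\<dots> \<le> 1 + exp (2 * b) * (4 * exp (8 * b) * sqdist \<theta> \<theta>0)"
      by (intro add_left_mono mult_left_mono dens_L2_le \<theta> \<theta>0) simp
    also have "\<dots> = 1 + 4 * exp (10 * b) * sqdist \<theta> \<theta>0"
      using exp_add[of "2 * b" "8 * b"] by simp
    also have "\<dots> \<le> exp (4 * exp (10 * b) * sqdist \<theta> \<theta>0)"
      by (rule exp_ge_add_one_self)
    finally show "(LINT x|unit_lebesgue. ?g x) \<le> exp (4 * exp (10 * b) * sqdist \<theta> \<theta>0)" .
    fix x
    note p = dens_pos[OF \<theta>, of x]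
    have "1 / ?f x \<le> 1 / exp (- 2 * b)"
      using dens_ge[OF \<theta>, of x] by (intro frac_le) auto
    then have "1 / ?f x \<le> exp (2 * b)" by (simp add: exp_minus divide_inverse)
    then have "1 / ?f x * (?f x - ?r x)\<^sup>2 \<le> exp (2 * b) * (?f x - ?r x)\<^sup>2"
      by (rule mult_right_mono) simp
    moreover have "?r x * (?r x / ?f x) = 2 * ?r x - ?f x + 1 / ?f x * (?f x - ?r x)\<^sup>2"
      using p by (simp add: field_simps power2_eq_square)
    ultimately show "?r x * (?r x / ?f x) \<le> ?g x" by simp
    show "0 \<le> ?r x * (?r x / ?f x)" by (simp add: dens_nonneg)
  qed
  finally show ?thesis .
qed

text \<open>The integral is \<open>1 - h\<^sup>2 / 2\<close> for the Hellinger distance \<open>h\<close>, since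
  \<open>sqrt (f0 * f) = (f0 + f) / 2 - (sqrt f0 - sqrt f)\<^sup>2 / 2\<close>.\<close>

lemma affinity_le:
  assumes \<theta>0: "\<theta>0 \<in> coeff_ball b" and \<theta>: "\<theta> \<in> coeff_ball b"
  shows "(\<integral>\<^sup>+x. ennreal (sqrt (dens \<theta> x / dens \<theta>0 x)) \<partial>model_measure \<theta>0)
    \<le> ennreal (exp (- (hellinger \<theta>0 \<theta>)\<^sup>2 / 2))"
proof -
  let ?f = "dens \<theta>" and ?r = "dens \<theta>0"
  let ?g = "\<lambda>x. (?r x + ?f x) / 2 - (sqrt (?r x) - sqrt (?f x))\<^sup>2 / 2"
  have "(\<integral>\<^sup>+x. ennreal (sqrt (?f x / ?r x)) \<partial>model_measure \<theta>0) = (\<integral>\<^sup>+x. ennreal (?r x * sqrt (?f x / ?r x)) \<partial>unit_lebesgue)"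
    by (rule nn_integral_model_measure[OF \<theta>0]) (auto simp: dens_nonneg)
  also have "\<dots> \<le> ennreal (exp (- (hellinger \<theta>0 \<theta>)\<^sup>2 / 2))"
  proof (rule nn_integral_unit_le)
    show "integrable unit_lebesgue ?g"
      using integrable_dens[OF \<theta>] integrable_dens[OF \<theta>0] integrable_sqrt_dens_diff2[OF \<theta>0 \<theta>] by auto
    have "(LINT x|unit_lebesgue. ?g x) = 1 + (- (hellinger \<theta>0 \<theta>)\<^sup>2 / 2)"
      using integrable_dens[OF \<theta>] integrable_dens[OF \<theta>0] integrable_sqrt_dens_diff2[OF \<theta>0 \<theta>]
        integral_dens[OF \<theta>] integral_dens[OF \<theta>0] by (simp add: hellinger_sq)
    also have "\<dots> \<le> exp (- (hellinger \<theta>0 \<theta>)\<^sup>2 / 2)"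
      by (rule exp_ge_add_one_self)
    finally show "(LINT x|unit_lebesgue. ?g x) \<le> exp (- (hellinger \<theta>0 \<theta>)\<^sup>2 / 2)" .
    fix x
    define s s0 where "s = sqrt (?f x)" and "s0 = sqrt (?r x)"
    have s: "s > 0" "s0 > 0" "?f x = s\<^sup>2" "?r x = s0\<^sup>2"
      using dens_pos[OF \<theta>, of x] dens_pos[OF \<theta>0, of x] by (auto simp: s_def s0_def)
    show "?r x * sqrt (?f x / ?r x) \<le> ?g x"
      unfolding s(3,4) using s(1,2) by (simp add: real_sqrt_divide field_simps power2_eq_square)
    show "0 \<le> ?r x * sqrt (?f x / ?r x)" by (simp add: dens_nonneg)
  qed
  finally show ?thesis .
qed

text \<open>If the observations came from \<open>\<theta>\<close> instead of \<open>\<theta>0\<close>, this would be the expected square root of the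
  likelihood ratio of \<open>\<theta>0\<close> against \<open>\<eta>\<close>.  For \<open>\<theta> = \<eta>\<close> it is \<open>1 - h\<^sup>2 / 2\<close>.  Moving from \<open>\<eta>\<close> to \<open>\<theta>\<close> changes
  it by \<open>\<integral> (f - k) * (sqrt f0 - sqrt k) / sqrt k\<close> for the densities \<open>f\<close> of \<open>\<theta>\<close> and \<open>k\<close> of \<open>\<eta>\<close>, a product of
  two small factors, which Young's inequality splits into a part of the order of \<open>sqdist \<theta> \<eta>\<close> and a quarter
  of \<open>h\<^sup>2\<close>.\<close>

lemma neighbour_affinity_le:
  assumes \<theta>0: "\<theta>0 \<in> coeff_ball b" and \<eta>: "\<eta> \<in> coeff_ball b" and \<theta>: "\<theta> \<in> coeff_ball b"
  shows "(\<integral>\<^sup>+x. ennreal (dens \<theta> x / dens \<theta>0 x / sqrt (dens \<eta> x / dens \<theta>0 x)) \<partial>model_measure \<theta>0)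
    \<le> ennreal (exp (4 * exp (10 * b) * sqdist \<theta> \<eta> - (hellinger \<theta>0 \<eta>)\<^sup>2 / 4))"
proof -
  let ?f = "dens \<theta>" and ?r = "dens \<theta>0" and ?k = "dens \<eta>"
  let ?g = "\<lambda>x. (?r x + ?k x) / 2 + (?f x - ?k x) - (sqrt (?r x) - sqrt (?k x))\<^sup>2 / 4
     + exp (2 * b) * (?f x - ?k x)\<^sup>2"
  note i = integrable_dens[OF \<theta>] integrable_dens[OF \<theta>0] integrable_dens[OF \<eta>]
    integrable_sqrt_dens_diff2[OF \<theta>0 \<eta>] integrable_dens_diff2[OF \<theta> \<eta>]
  have "(\<integral>\<^sup>+x. ennreal (?f x / ?r x / sqrt (?k x / ?r x)) \<partial>model_measure \<theta>0)
      = (\<integral>\<^sup>+x. ennreal (?r x * (?f x / ?r x / sqrt (?k x / ?r x))) \<partial>unit_lebesgue)"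
    by (rule nn_integral_model_measure[OF \<theta>0]) (auto simp: dens_nonneg)
  also have "\<dots> \<le> ennreal (exp (4 * exp (10 * b) * sqdist \<theta> \<eta> - (hellinger \<theta>0 \<eta>)\<^sup>2 / 4))"
  proof (rule nn_integral_unit_le)
    show "integrable unit_lebesgue ?g" using i by auto
    have "(LINT x|unit_lebesgue. ?g x) = 1 - (hellinger \<theta>0 \<eta>)\<^sup>2 / 4
        + exp (2 * b) * (LINT x|unit_lebesgue. (?f x - ?k x)\<^sup>2)"
      using i integral_dens[OF \<theta>] integral_dens[OF \<theta>0] integral_dens[OF \<eta>]
      by (simp add: hellinger_sq)
    also have "\<dots> \<le> 1 - (hellinger \<theta>0 \<eta>)\<^sup>2 / 4 + exp (2 * b) * (4 * exp (8 * b) * sqdist \<theta> \<eta>)"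
      by (intro add_left_mono mult_left_mono dens_L2_le \<theta> \<eta>) simp
    also have "\<dots> = 1 + (4 * exp (10 * b) * sqdist \<theta> \<eta> - (hellinger \<theta>0 \<eta>)\<^sup>2 / 4)"
      using exp_add[of "2 * b" "8 * b"] by simp
    also have "\<dots> \<le> exp (4 * exp (10 * b) * sqdist \<theta> \<eta> - (hellinger \<theta>0 \<eta>)\<^sup>2 / 4)"
      by (rule exp_ge_add_one_self)
    finally show "(LINT x|unit_lebesgue. ?g x)
      \<le> exp (4 * exp (10 * b) * sqdist \<theta> \<eta> - (hellinger \<theta>0 \<eta>)\<^sup>2 / 4)" .
    fix x
    define s s0 f where "s = sqrt (?k x)" and "s0 = sqrt (?r x)" and "f = ?f x"
    have s: "s > 0" "s0 > 0" "?k x = s\<^sup>2" "?r x = s0\<^sup>2"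
      using dens_pos[OF \<eta>, of x] dens_pos[OF \<theta>0, of x] by (auto simp: s_def s0_def)
    have "exp (2 * b) * s\<^sup>2 \<ge> exp (2 * b) * exp (- 2 * b)"
      using dens_ge[OF \<eta>, of x] by (intro mult_left_mono) (auto simp: s(3))
    then have es: "1 \<le> exp (2 * b) * s\<^sup>2" by (simp add: exp_add[symmetric])
    define e where "e = exp b"
    have e2: "exp (2 * b) = e\<^sup>2" "e > 0" by (auto simp: e_def exp_of_nat_mult[symmetric])
    have es1: "1 \<le> e * s"
      using es s(1) e2(2) unfolding e2(1) power_mult_distrib[symmetric]
      by (smt (verit) mult_pos_pos power2_ge_1_iff)
    \<comment> \<open>Young's inequality, weighted so that the Hellinger term receives the factor \<open>1 / 4\<close>, half of
      what the affinity of \<open>\<theta>0\<close> and \<open>\<eta>\<close> provides.\<close>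
    have "(f - s\<^sup>2) * ((s0 - s) / s) \<le> e\<^sup>2 * (f - s\<^sup>2)\<^sup>2 + (s0 - s)\<^sup>2 / 4"
    proof -
      have "0 \<le> (e * (f - s\<^sup>2) - (s0 - s) / (2 * (e * s)))\<^sup>2" by simp
      also have "\<dots> = e\<^sup>2 * (f - s\<^sup>2)\<^sup>2 - (f - s\<^sup>2) * ((s0 - s) / s) + ((s0 - s)\<^sup>2 / 4) / (e * s)\<^sup>2"
        using s e2(2) by (simp add: power2_diff power_divide power_mult_distrib)
      also have "((s0 - s)\<^sup>2 / 4) / (e * s)\<^sup>2 \<le> (s0 - s)\<^sup>2 / 4 / 1"
        using es1 by (intro divide_left_mono) (auto intro: order_trans[OF _ self_le_power])
      finally show ?thesis by simp
    qed
    moreover have "?r x * (f / ?r x / sqrt (?k x / ?r x)) = f * (s0 / s)"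
      unfolding s(3,4) using s(1,2) by (simp add: real_sqrt_divide field_simps power2_eq_square)
    moreover have "f * (s0 / s) = (s0\<^sup>2 + s\<^sup>2) / 2 + (f - s\<^sup>2) - (s0 - s)\<^sup>2 / 2 + (f - s\<^sup>2) * ((s0 - s) / s)"
      using s(1) by (simp add: field_simps power2_eq_square)
    ultimately show "?r x * (?f x / ?r x / sqrt (?k x / ?r x)) \<le> ?g x"
      unfolding f_def[symmetric] e2 s(3,4) using s(1,2) by (simp add: s_def)
    show "0 \<le> ?r x * (?f x / ?r x / sqrt (?k x / ?r x))" by (simp add: dens_nonneg)
  qed
  finally show ?thesis .
qed

text \<open>The posterior is evaluated at a set of measures, the Hellinger distance at parameters.  Equal measures
  have almost everywhere equal densities, so the passage between the two is harmless.\<close>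

lemma hellinger_cong_model_measure:
  assumes "model_measure \<theta> = model_measure \<theta>'"
  shows "hellinger \<eta> \<theta> = hellinger \<eta> \<theta>'"
proof -
  have m: "(\<lambda>x. ennreal (dens \<theta> x)) \<in> borel_measurable unit_lebesgue" for \<theta>
    by (auto intro!: measurable_restrict_space1)
  have "AE x in unit_lebesgue. ennreal (dens \<theta> x) = ennreal (dens \<theta>' x)"
    by (rule U.density_unique[OF m m]) (use assms in \<open>simp add: model_measure_def\<close>)
  then have "AE x in unit_lebesgue. dens \<theta> x = dens \<theta>' x"
    by (simp add: dens_nonneg)
  then have "(LINT x|unit_lebesgue. (sqrt (dens \<eta> x) - sqrt (dens \<theta> x))\<^sup>2)
       = (LINT x|unit_lebesgue. (sqrt (dens \<eta> x) - sqrt (dens \<theta>' x))\<^sup>2)"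
    by (intro integral_cong_AE) (auto intro!: measurable_restrict_space1)
  then show ?thesis by (simp add: hellinger_def set_integral_unit)
qed

section \<open>Averaging over product measures\<close>

lemma markov_prob_bound:
  assumes "prob_space M" and V [measurable]: "V \<in> borel_measurable M"
    and int: "(\<integral>\<^sup>+x. V x \<partial>M) \<le> ennreal K" and "0 < c" "0 \<le> K"
  shows "{x \<in> space M. ennreal c \<le> V x} \<in> sets M"
    and "measure M {x \<in> space M. ennreal c \<le> V x} \<le> K / c"
proof -
  interpret prob_space M by fact
  show "{x \<in> space M. ennreal c \<le> V x} \<in> sets M" by measurable
  have c: "ennreal (1 / c) * ennreal c = 1"
    using \<open>0 < c\<close> by (simp add: ennreal_mult[symmetric])
  have "{x \<in> space M. ennreal c \<le> V x} \<subseteq> {x \<in> space M. 1 \<le> ennreal (1 / c) * V x}"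
    using mult_left_mono[of "ennreal c" _ "ennreal (1 / c)"] by (auto simp: c)
  then have "emeasure M {x \<in> space M. ennreal c \<le> V x} \<le> emeasure M {x \<in> space M. 1 \<le> ennreal (1 / c) * V x}"
    by (rule emeasure_mono) simp
  also have "\<dots> \<le> ennreal (1 / c) * (\<integral>\<^sup>+x. V x * indicator (space M) x \<partial>M)"
    by (rule nn_integral_Markov_inequality) auto
  also have "(\<integral>\<^sup>+x. V x * indicator (space M) x \<partial>M) = (\<integral>\<^sup>+x. V x \<partial>M)"
    by (intro nn_integral_cong) auto
  also have "ennreal (1 / c) * \<dots> \<le> ennreal (1 / c) * ennreal K"
    by (intro mult_left_mono int) auto
  also have "\<dots> = ennreal (K / c)"
    using \<open>0 < c\<close> \<open>0 \<le> K\<close> by (simp add: ennreal_mult[symmetric])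
  finally show "measure M {x \<in> space M. ennreal c \<le> V x} \<le> K / c"
    using \<open>0 < c\<close> \<open>0 \<le> K\<close> by (simp add: emeasure_eq_measure)
qed

text \<open>A product over finitely many coordinates is integrated over their finite marginal.\<close>

lemma nn_integral_PiM_prod:
  fixes f :: "'i \<Rightarrow> 'a \<Rightarrow> ennreal"
  assumes M: "\<And>i. prob_space (M i)" and J: "finite J" and f: "\<And>i. i \<in> J \<Longrightarrow> f i \<in> borel_measurable (M i)"
  shows "(\<integral>\<^sup>+\<omega>. (\<Prod>i\<in>J. f i (\<omega> i)) \<partial>PiM UNIV M) = (\<Prod>i\<in>J. \<integral>\<^sup>+x. f i x \<partial>M i)"
proof -
  interpret product_prob_space M UNIV
    by (intro product_prob_spaceI M)
  have m: "(\<lambda>\<omega>. \<Prod>i\<in>J. f i (\<omega> i)) \<in> borel_measurable (PiM J M)"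
    using f by (intro borel_measurable_prod_ennreal) (auto intro: measurable_compose[OF measurable_component_singleton])
  have "(\<Prod>i\<in>J. \<integral>\<^sup>+x. f i x \<partial>M i) = (\<integral>\<^sup>+\<omega>. (\<Prod>i\<in>J. f i (\<omega> i)) \<partial>PiM J M)"
    using J f by (simp add: product_nn_integral_prod)
  also have "PiM J M = distr (PiM UNIV M) (PiM J M) (\<lambda>x. restrict x J)"
    by (rule distr_PiM_restrict_finite[symmetric]) (use J in auto)
  also have "(\<integral>\<^sup>+\<omega>. (\<Prod>i\<in>J. f i (\<omega> i)) \<partial>distr (PiM UNIV M) (PiM J M) (\<lambda>x. restrict x J))
      = (\<integral>\<^sup>+\<omega>. (\<Prod>i\<in>J. f i (\<omega> i)) \<partial>PiM UNIV M)"
    using m by (subst nn_integral_distr) (auto intro!: measurable_restrict_subset)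
  finally show ?thesis ..
qed

text \<open>By Jensen's inequality the average of \<open>u\<close> over \<open>S\<close> is at least the inverse of the average of \<open>1 / u\<close>, and
  the latter has expectation at most \<open>exp K\<close>, so Markov's inequality applies to it.  Jensen's
  inequality takes the elementary form \<open>u + c\<^sup>2 / u \<ge> 2 * c\<close> with the value \<open>c = exp (- t)\<close>, which is
  optimal when the average of \<open>1 / u\<close> equals \<open>exp t\<close>.\<close>

lemma evidence_lower_bound:
  fixes u :: "'a \<Rightarrow> 'b \<Rightarrow> real"
  assumes "prob_space \<Omega>" "prob_space \<pi>"
    and u [measurable]: "case_prod u \<in> borel_measurable (\<pi> \<Otimes>\<^sub>M \<Omega>)"
    and S [measurable]: "S \<in> sets \<pi>" and S0: "0 < measure \<pi> S"
    and pos: "\<And>\<theta> x. \<theta> \<in> S \<Longrightarrow> x \<in> space \<Omega> \<Longrightarrow> 0 < u \<theta> x"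
    and inv: "\<And>\<theta>. \<theta> \<in> S \<Longrightarrow> (\<integral>\<^sup>+x. ennreal (1 / u \<theta> x) \<partial>\<Omega>) \<le> ennreal (exp K)"
  shows "\<exists>G\<in>sets \<Omega>. measure \<Omega> G \<le> exp (K - t) \<and>
    (\<forall>x\<in>space \<Omega> - G. ennreal (measure \<pi> S * exp (- t)) \<le> (\<integral>\<^sup>+\<theta>. ennreal (u \<theta> x) * indicator S \<theta> \<partial>\<pi>))"
proof -
  interpret \<Omega>: prob_space \<Omega> by fact
  interpret \<pi>: prob_space \<pi> by fact
  interpret pair_sigma_finite \<pi> \<Omega> ..
  define s where "s = measure \<pi> S"
  have s: "0 < s" "emeasure \<pi> S = ennreal s"
    using S0 by (auto simp: s_def \<pi>.emeasure_eq_measure)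
  define W where "W x = (\<integral>\<^sup>+\<theta>. ennreal (1 / u \<theta> x) * indicator S \<theta> \<partial>\<pi>)" for x
  have [measurable]: "W \<in> borel_measurable \<Omega>"
    unfolding W_def[abs_def] by measurable
  have "(\<integral>\<^sup>+x. W x \<partial>\<Omega>) = (\<integral>\<^sup>+\<theta>. (\<integral>\<^sup>+x. ennreal (1 / u \<theta> x) * indicator S \<theta> \<partial>\<Omega>) \<partial>\<pi>)"
    unfolding W_def by (rule Fubini') measurable
  also have "\<dots> \<le> (\<integral>\<^sup>+\<theta>. ennreal (exp K) * indicator S \<theta> \<partial>\<pi>)"
    using inv by (intro nn_integral_mono) (auto simp: indicator_def)
  also have "\<dots> = ennreal (exp K * s)"
    using s by (simp add: nn_integral_cmult_indicator ennreal_mult)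
  finally have EW: "(\<integral>\<^sup>+x. W x \<partial>\<Omega>) \<le> ennreal (exp K * s)" .
  define G where "G = {x \<in> space \<Omega>. ennreal (s * exp t) \<le> W x}"
  have G: "G \<in> sets \<Omega>" "measure \<Omega> G \<le> (exp K * s) / (s * exp t)"
    unfolding G_def by (rule markov_prob_bound[OF \<open>prob_space \<Omega>\<close> _ EW]; use s in simp)+
  moreover have "(exp K * s) / (s * exp t) = exp (K - t)"
    using s by (simp add: exp_diff)
  ultimately have G: "G \<in> sets \<Omega>" "measure \<Omega> G \<le> exp (K - t)" by auto
  have lower: "ennreal (s * exp (- t)) \<le> (\<integral>\<^sup>+\<theta>. ennreal (u \<theta> x) * indicator S \<theta> \<partial>\<pi>)"
    if x: "x \<in> space \<Omega> - G" for x
  proof -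
    let ?I = "\<integral>\<^sup>+\<theta>. ennreal (u \<theta> x) * indicator S \<theta> \<partial>\<pi>"
    let ?c = "exp (- t)"
    have [measurable]: "x \<in> space \<Omega>" using x by simp
    have Wx: "W x \<le> ennreal (s * exp t)" using x by (auto simp: G_def)
    have "ennreal (2 * (s * ?c)) = ennreal (2 * ?c) * ennreal s"
      using s by (subst ennreal_mult[symmetric]) (auto simp: algebra_simps)
    also have "\<dots> = (\<integral>\<^sup>+\<theta>. ennreal (2 * ?c) * indicator S \<theta> \<partial>\<pi>)"
      by (subst nn_integral_cmult_indicator) (simp_all add: s)
    also have "\<dots> \<le> (\<integral>\<^sup>+\<theta>. ennreal (u \<theta> x) * indicator S \<theta> + ennreal (?c\<^sup>2) * (ennreal (1 / u \<theta> x) * indicator S \<theta>) \<partial>\<pi>)"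
    proof (rule nn_integral_mono)
      fix \<theta>
      have "2 * ?c \<le> u \<theta> x + ?c\<^sup>2 * (1 / u \<theta> x)" if "\<theta> \<in> S"
      proof -
        have "0 < u \<theta> x" using pos that x by simp
        then have "u \<theta> x + ?c\<^sup>2 * (1 / u \<theta> x) - 2 * ?c = (u \<theta> x - ?c)\<^sup>2 / u \<theta> x"
          by (simp add: field_simps power2_eq_square)
        also have "\<dots> \<ge> 0" using \<open>0 < u \<theta> x\<close> by simp
        finally show ?thesis by simp
      qed
      then show "ennreal (2 * ?c) * indicator S \<theta> \<le> ennreal (u \<theta> x) * indicator S \<theta>
          + ennreal (?c\<^sup>2) * (ennreal (1 / u \<theta> x) * indicator S \<theta>)"
        using pos[of \<theta> x] x by (auto simp: indicator_def ennreal_mult[symmetric] ennreal_plus[symmetric]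
          intro!: ennreal_leI simp del: ennreal_plus)
    qed
    also have "\<dots> = ?I + ennreal (?c\<^sup>2) * W x"
      unfolding W_def by (simp add: nn_integral_add nn_integral_cmult)
    also have "\<dots> \<le> ?I + ennreal (?c\<^sup>2) * ennreal (s * exp t)"
      by (intro add_left_mono mult_left_mono Wx) auto
    also have "ennreal (?c\<^sup>2) * ennreal (s * exp t) = ennreal (s * ?c)"
    proof -
      have "?c\<^sup>2 * (s * exp t) = s * ?c"
        by (simp add: power2_eq_square mult_ac exp_minus_inverse flip: exp_add)
      then show ?thesis using s by (simp add: ennreal_mult[symmetric])
    qed
    finally have "ennreal (2 * (s * ?c)) \<le> ?I + ennreal (s * ?c)" .
    then show ?thesis
      using s by (cases ?I) (auto simp: ennreal_plus[symmetric] simp del: ennreal_plus)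
  qed
  show ?thesis
    unfolding s_def[symmetric] using G lower by blast
qed

section \<open>Measurability in the parameter and in the sample\<close>

text \<open>Bounded partial sums characterise the ball by countably many measurable conditions.\<close>

lemma coeff_ball_eq_partial_sums:
  "coeff_ball b = {\<theta>. \<forall>n. sqrt 2 * (\<Sum>j<n. \<bar>\<theta> (Suc j)\<bar>) \<le> b}"
proof (intro set_eqI iffI)
  fix \<theta> assume "\<theta> \<in> coeff_ball b"
  then have "summable (\<lambda>j. \<bar>\<theta> (Suc j)\<bar>)" "sqrt 2 * (\<Sum>j. \<bar>\<theta> (Suc j)\<bar>) \<le> b"
    by (auto simp: coeff_ball_def)
  moreover have "sqrt 2 * (\<Sum>j<n. \<bar>\<theta> (Suc j)\<bar>) \<le> sqrt 2 * (\<Sum>j. \<bar>\<theta> (Suc j)\<bar>)" for n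
    by (intro mult_left_mono sum_le_suminf calculation) auto
  ultimately show "\<theta> \<in> {\<theta>. \<forall>n. sqrt 2 * (\<Sum>j<n. \<bar>\<theta> (Suc j)\<bar>) \<le> b}"
    by (intro CollectI allI) (rule order_trans)
next
  fix \<theta> :: "nat \<Rightarrow> real" assume "\<theta> \<in> {\<theta>. \<forall>n. sqrt 2 * (\<Sum>j<n. \<bar>\<theta> (Suc j)\<bar>) \<le> b}"
  then have *: "(\<Sum>j<n. \<bar>\<theta> (Suc j)\<bar>) \<le> b / sqrt 2" for n
    by (simp add: field_simps)
  have "summable (\<lambda>j. \<bar>\<theta> (Suc j)\<bar>)"
    by (rule summableI_nonneg_bounded[OF _ *]) simp
  moreover from this have "(\<Sum>j. \<bar>\<theta> (Suc j)\<bar>) \<le> b / sqrt 2"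
    by (rule suminf_le_const[OF _ *])
  ultimately show "\<theta> \<in> coeff_ball b"
    by (simp add: coeff_ball_def field_simps)
qed

abbreviation seq_space :: "(nat \<Rightarrow> real) measure" where
  "seq_space \<equiv> PiM UNIV (\<lambda>_. borel)"

lemma coord_measurable [measurable]: "(\<lambda>\<theta>. \<theta> j) \<in> borel_measurable seq_space"
  by (rule measurable_component_singleton) simp

lemma space_seq_space [simp]: "space seq_space = UNIV"
  by (simp add: space_PiM)

lemma coeff_ball_measurable [measurable]: "coeff_ball b \<in> sets seq_space"
proof -
  have "{\<theta> \<in> space seq_space. \<forall>n. sqrt 2 * (\<Sum>j<n. \<bar>\<theta> (Suc j)\<bar>) \<le> b} \<in> sets seq_space"
    by measurable
  then show ?thesis by (simp add: coeff_ball_eq_partial_sums)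
qed

lemma sqdist_measurable [measurable]: "(\<lambda>\<theta>. sqdist \<theta> \<eta>) \<in> borel_measurable seq_space"
  unfolding sqdist_def by measurable

lemma log_series_measurable_pair [measurable]:
  "(\<lambda>(\<theta>, x). log_series \<theta> x) \<in> borel_measurable (seq_space \<Otimes>\<^sub>M borel)"
  unfolding log_series_def by measurable

lemma dens_measurable_pair:
  "(\<lambda>(\<theta>, x). dens \<theta> x) \<in> borel_measurable (seq_space \<Otimes>\<^sub>M borel)"
proof -
  have "(\<lambda>\<theta>. LINT t|unit_lebesgue. exp (log_series \<theta> t)) =
      (\<lambda>\<theta>. LINT t|lborel. indicator {0..1} t *\<^sub>R exp (log_series \<theta> t))"
    by (simp add: integral_restrict_space set_lebesgue_integral_def)
  also have "\<dots> \<in> borel_measurable seq_space"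
    by (intro lborel.borel_measurable_lebesgue_integral) measurable
  finally have [measurable]: "(\<lambda>\<theta>. LINT t|unit_lebesgue. exp (log_series \<theta> t)) \<in> borel_measurable seq_space" .
  show ?thesis unfolding dens_eq by measurable
qed

abbreviation sample_space :: "(nat \<Rightarrow> real) \<Rightarrow> (nat \<Rightarrow> real) measure" where
  "sample_space \<theta>0 \<equiv> PiM UNIV (\<lambda>_. model_measure \<theta>0)"

lemma sample_measurable [measurable]: "(\<lambda>X. X i) \<in> borel_measurable (sample_space \<theta>0)"
proof (rule measurable_compose[OF measurable_component_singleton])
  show "(\<lambda>x. x) \<in> borel_measurable (model_measure \<theta>0)"
    unfolding model_measure_def by (auto intro!: measurable_restrict_space1)
qed simp

lemma nn_integral_sample_prod_le:
  assumes \<theta>0: "\<theta>0 \<in> coeff_ball b" and g [measurable]: "g \<in> borel_measurable borel" and g0: "\<And>x. 0 \<le> g x"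
    and le: "(\<integral>\<^sup>+x. ennreal (g x) \<partial>model_measure \<theta>0) \<le> ennreal (exp c)"
  shows "(\<integral>\<^sup>+X. ennreal (\<Prod>i<n. g (X i)) \<partial>sample_space \<theta>0) \<le> ennreal (exp (real n * c))"
proof -
  have "(\<integral>\<^sup>+X. ennreal (\<Prod>i<n. g (X i)) \<partial>sample_space \<theta>0)
      = (\<integral>\<^sup>+X. (\<Prod>i<n. ennreal (g (X i))) \<partial>sample_space \<theta>0)"
    using g0 by (simp add: prod_ennreal)
  also have "\<dots> = (\<Prod>i<n. \<integral>\<^sup>+x. ennreal (g x) \<partial>model_measure \<theta>0)"
    using prob_space_model_measure[OF \<theta>0]
    by (intro nn_integral_PiM_prod) (auto simp: model_measure_def intro!: measurable_restrict_space1)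
  also have "\<dots> \<le> (\<Prod>i<n. ennreal (exp c))"
    using le by (intro prod_mono_ennreal)
  also have "\<dots> = ennreal (exp (real n * c))"
    by (simp add: prod_constant ennreal_power exp_of_nat_mult)
  finally show ?thesis .
qed

text \<open>A function that is not integrable has integral \<open>0\<close>, so the bound covers integrals over arbitrary sets
  of parameters, measurable or not.\<close>

lemma ennreal_integral_le_nn_integral:
  assumes "\<And>x. 0 \<le> f x"
  shows "ennreal (LINT x|M. f x) \<le> (\<integral>\<^sup>+x. ennreal (f x) \<partial>M)"
proof (cases "integrable M f")
  case True
  then show ?thesis using assms by (subst nn_integral_eq_integral) auto
qed (simp add: not_integrable_integral_eq)

section \<open>Posterior ratios for a fixed sample size\<close>

text \<open>The common constant of \<open>chi_square_le\<close> and \<open>neighbour_affinity_le\<close>.\<close>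

definition chi_const :: "real \<Rightarrow> real" where
  "chi_const b = 4 * exp (10 * b)"

text \<open>The three terms bound three exceptional events.  On the first the integral of the likelihood ratio
  over the neighbourhood \<open>S\<close> of the truth is too small (\<open>evidence_lower_bound\<close>); on the second some
  centre \<open>\<eta>\<close> in \<open>C\<close> has a likelihood at least that of the truth; on the third the likelihood ratios,
  divided by the square roots \<open>\<phi> \<eta>\<close> of the likelihood ratios of the centres and integrated over the
  cells around them, are too large.  Outside the second event \<open>\<phi> \<eta> < 1\<close>, so the quantity controlled by
  the third event dominates the numerator of the posterior.  The cardinality of \<open>C\<close> enters through union bounds.\<close>

lemma posterior_ratio_bound:
  fixes \<pi> :: "(nat \<Rightarrow> real) measure" and C V S :: "(nat \<Rightarrow> real) set"
  assumes \<pi>: "prob_space \<pi>" and sets_\<pi>: "sets \<pi> = sets seq_space"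
    and \<theta>0: "\<theta>0 \<in> coeff_ball b"
    and S: "S \<in> sets seq_space" "S \<subseteq> coeff_ball b" "\<And>\<theta>. \<theta> \<in> S \<Longrightarrow> sqdist \<theta> \<theta>0 \<le> D"
    and m: "0 < m" "m \<le> measure \<pi> S"
    and C: "finite C" "C \<subseteq> coeff_ball b" "\<And>\<eta>. \<eta> \<in> C \<Longrightarrow> H \<le> (hellinger \<theta>0 \<eta>)\<^sup>2"
    and V: "V \<subseteq> (\<Union>\<eta>\<in>C. {\<theta> \<in> coeff_ball b. sqdist \<theta> \<eta> \<le> D})"
  shows "\<exists>G\<in>sets (sample_space \<theta>0).
    measure (sample_space \<theta>0) G \<le> exp (n * (chi_const b * D) - t) + card C * exp (- real n * H / 2)
        + card C * exp (n * (chi_const b * D - H / 4) + a) \<and>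
    (\<forall>X\<in>space (sample_space \<theta>0) - G.
      (LINT \<theta>:V|\<pi>. likelihood n X \<theta>) / (LINT \<theta>|\<pi>. likelihood n X \<theta>) \<le> exp (t - a) / m)"
proof -
  let ?\<Omega> = "sample_space \<theta>0"
  have \<Omega>: "prob_space ?\<Omega>"
    by (intro prob_space_PiM prob_space_model_measure[OF \<theta>0])
  interpret \<Omega>: prob_space ?\<Omega> by (rule \<Omega>)
  interpret \<pi>: prob_space \<pi> by (rule \<pi>)
  interpret pair_sigma_finite \<pi> ?\<Omega> ..
  note [measurable_cong] = sets_\<pi>
  have sp: "space \<pi> = UNIV" using sets_eq_imp_space_eq[OF sets_\<pi>] by simp
  have [measurable]: "(\<lambda>(\<theta>, x). dens \<theta> x) \<in> borel_measurable (\<pi> \<Otimes>\<^sub>M borel)"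
    using dens_measurable_pair by (subst measurable_cong_sets[OF sets_pair_measure_cong[OF sets_\<pi> refl] refl])
  note p0 = dens_pos[OF \<theta>0]
  \<comment> \<open>\<open>u\<close> is the likelihood ratio against the truth and \<open>L\<close> the likelihood of the truth, which cancels
    in the posterior.\<close>
  define u where "u \<theta> X = (\<Prod>i<n. dens \<theta> (X i) / dens \<theta>0 (X i))" for \<theta> X
  define \<phi> where "\<phi> \<eta> X = (\<Prod>i<n. sqrt (dens \<eta> (X i) / dens \<theta>0 (X i)))" for \<eta> X
  define A where "A \<eta> = {\<theta> \<in> coeff_ball b. sqdist \<theta> \<eta> \<le> D}" for \<eta>
  define L where "L X = (\<Prod>i<n. dens \<theta>0 (X i))" for X
  have L0: "0 < L X" for X unfolding L_def by (intro prod_pos p0 ballI)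
  have lik: "likelihood n X \<theta> = L X * u \<theta> X" for X \<theta>
    using p0 less_imp_neq[OF p0] unfolding likelihood_def L_def u_def prod.distrib[symmetric] by simp
  have u0: "0 \<le> u \<theta> X" for \<theta> X
    unfolding u_def by (intro prod_nonneg) (simp add: dens_nonneg)
  have upos: "0 < u \<theta> X" if "\<theta> \<in> coeff_ball b" for \<theta> X
    unfolding u_def by (intro prod_pos) (simp add: dens_pos[OF that] p0)
  have \<phi>pos: "0 < \<phi> \<eta> X" if "\<eta> \<in> C" for \<eta> X
    unfolding \<phi>_def using that C(2) by (intro prod_pos) (auto simp: dens_pos[of \<eta> b] p0)
  have u_meas [measurable]: "case_prod u \<in> borel_measurable (\<pi> \<Otimes>\<^sub>M ?\<Omega>)"
    unfolding u_def by measurable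
  have [measurable]: "\<phi> \<eta> \<in> borel_measurable ?\<Omega>" for \<eta>
    unfolding \<phi>_def by measurable
  have A [measurable]: "A \<eta> \<in> sets \<pi>" for \<eta>
  proof -
    have "{\<theta> \<in> space seq_space. \<theta> \<in> coeff_ball b \<and> sqdist \<theta> \<eta> \<le> D} \<in> sets seq_space"
      by measurable
    then show ?thesis by (simp add: A_def sets_\<pi>)
  qed
  have [measurable]: "S \<in> sets \<pi>" using S(1) sets_\<pi> by simp

  have inv: "(\<integral>\<^sup>+X. ennreal (1 / u \<theta> X) \<partial>?\<Omega>) \<le> ennreal (exp (n * (chi_const b * D)))" if "\<theta> \<in> S" for \<theta>
  proof -
    have \<theta>: "\<theta> \<in> coeff_ball b" using that S by auto
    have "1 / u \<theta> X = (\<Prod>i<n. dens \<theta>0 (X i) / dens \<theta> (X i))" for X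
      unfolding u_def prod_dividef by simp
    moreover have "(\<integral>\<^sup>+x. ennreal (dens \<theta>0 x / dens \<theta> x) \<partial>model_measure \<theta>0) \<le> ennreal (exp (chi_const b * D))"
      by (rule order_trans[OF chi_square_le[OF \<theta>0 \<theta>]])
         (use S(3)[OF that] in \<open>auto simp: chi_const_def intro!: ennreal_leI\<close>)
    ultimately show ?thesis
      using nn_integral_sample_prod_le[OF \<theta>0, of "\<lambda>x. dens \<theta>0 x / dens \<theta> x" "chi_const b * D" n]
      by (simp add: dens_nonneg)
  qed
  have S0: "0 < measure \<pi> S" using m by linarith
  have "\<exists>G\<in>sets ?\<Omega>. measure ?\<Omega> G \<le> exp (n * (chi_const b * D) - t) \<and>
    (\<forall>X\<in>space ?\<Omega> - G. ennreal (measure \<pi> S * exp (- t)) \<le> (\<integral>\<^sup>+\<theta>. ennreal (u \<theta> X) * indicator S \<theta> \<partial>\<pi>))"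
    using upos S(2) by (intro evidence_lower_bound[OF \<Omega> \<pi> u_meas _ S0 _ inv]) auto
  then obtain G1 where G1: "G1 \<in> sets ?\<Omega>" "measure ?\<Omega> G1 \<le> exp (n * (chi_const b * D) - t)"
    "\<forall>X\<in>space ?\<Omega> - G1. ennreal (measure \<pi> S * exp (- t)) \<le> (\<integral>\<^sup>+\<theta>. ennreal (u \<theta> X) * indicator S \<theta> \<partial>\<pi>)"
    by blast

  \<comment> \<open>The second exceptional event: some centre beats the truth.\<close>
  define G2 where "G2 = (\<Union>\<eta>\<in>C. {X \<in> space ?\<Omega>. ennreal 1 \<le> ennreal (\<phi> \<eta> X)})"
  have G2_1: "measure ?\<Omega> {X \<in> space ?\<Omega>. ennreal 1 \<le> ennreal (\<phi> \<eta> X)} \<le> exp (- real n * H / 2)" if "\<eta> \<in> C" for \<eta>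
  proof -
    have \<eta>: "\<eta> \<in> coeff_ball b" using that C by auto
    have "(\<integral>\<^sup>+X. ennreal (\<phi> \<eta> X) \<partial>?\<Omega>) \<le> ennreal (exp (n * (- H / 2)))"
      unfolding \<phi>_def
    proof (rule nn_integral_sample_prod_le[OF \<theta>0])
      show "(\<integral>\<^sup>+x. ennreal (sqrt (dens \<eta> x / dens \<theta>0 x)) \<partial>model_measure \<theta>0) \<le> ennreal (exp (- H / 2))"
        by (rule order_trans[OF affinity_le[OF \<theta>0 \<eta>]]) (use C(3)[OF that] in \<open>auto intro!: ennreal_leI\<close>)
    qed (auto simp: dens_nonneg)
    then have "measure ?\<Omega> {X \<in> space ?\<Omega>. ennreal 1 \<le> ennreal (\<phi> \<eta> X)} \<le> exp (n * (- H / 2)) / 1"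
      by (intro markov_prob_bound[OF \<Omega>]) auto
    then show ?thesis by simp
  qed
  have G2: "G2 \<in> sets ?\<Omega>" unfolding G2_def using C(1) by (intro sets.finite_UN) measurable
  have "measure ?\<Omega> G2 \<le> (\<Sum>\<eta>\<in>C. measure ?\<Omega> {X \<in> space ?\<Omega>. ennreal 1 \<le> ennreal (\<phi> \<eta> X)})"
    unfolding G2_def using C(1) by (intro \<Omega>.finite_measure_subadditive_finite) auto
  also have "\<dots> \<le> (\<Sum>\<eta>\<in>C. exp (- real n * H / 2))" by (intro sum_mono G2_1)
  finally have G2_le: "measure ?\<Omega> G2 \<le> card C * exp (- real n * H / 2)" by simp

  \<comment> \<open>The third exceptional event: the weighted numerator is large.\<close>
  define T where "T X = (\<Sum>\<eta>\<in>C. \<integral>\<^sup>+\<theta>. ennreal (u \<theta> X / \<phi> \<eta> X) * indicator (A \<eta>) \<theta> \<partial>\<pi>)" for X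
  have T_meas [measurable]: "T \<in> borel_measurable ?\<Omega>"
    unfolding T_def[abs_def] by measurable
  have cell: "(\<integral>\<^sup>+X. (\<integral>\<^sup>+\<theta>. ennreal (u \<theta> X / \<phi> \<eta> X) * indicator (A \<eta>) \<theta> \<partial>\<pi>) \<partial>?\<Omega>)
     \<le> ennreal (exp (n * (chi_const b * D - H / 4)))" if "\<eta> \<in> C" for \<eta>
  proof -
    have \<eta>: "\<eta> \<in> coeff_ball b" using that C by auto
    have "(\<integral>\<^sup>+X. ennreal (u \<theta> X / \<phi> \<eta> X) \<partial>?\<Omega>) \<le> ennreal (exp (n * (chi_const b * D - H / 4)))" if "\<theta> \<in> A \<eta>" for \<theta>
      unfolding u_def \<phi>_def prod_dividef[symmetric]
    proof (rule nn_integral_sample_prod_le[OF \<theta>0])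
      have \<theta>: "\<theta> \<in> coeff_ball b" "sqdist \<theta> \<eta> \<le> D" using that by (auto simp: A_def)
      have "chi_const b * sqdist \<theta> \<eta> \<le> chi_const b * D"
        using \<theta>(2) by (intro mult_left_mono) (auto simp: chi_const_def)
      then have "4 * exp (10 * b) * sqdist \<theta> \<eta> - (hellinger \<theta>0 \<eta>)\<^sup>2 / 4 \<le> chi_const b * D - H / 4"
        using C(3)[OF \<open>\<eta> \<in> C\<close>] unfolding chi_const_def by linarith
      then show "(\<integral>\<^sup>+x. ennreal (dens \<theta> x / dens \<theta>0 x / sqrt (dens \<eta> x / dens \<theta>0 x)) \<partial>model_measure \<theta>0)
         \<le> ennreal (exp (chi_const b * D - H / 4))"
        by (intro order_trans[OF neighbour_affinity_le[OF \<theta>0 \<eta> \<theta>(1)]] ennreal_leI) simp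
    qed (auto simp: dens_nonneg)
    then have "(\<integral>\<^sup>+\<theta>. (\<integral>\<^sup>+X. ennreal (u \<theta> X / \<phi> \<eta> X) * indicator (A \<eta>) \<theta> \<partial>?\<Omega>) \<partial>\<pi>)
       \<le> (\<integral>\<^sup>+\<theta>. ennreal (exp (n * (chi_const b * D - H / 4))) \<partial>\<pi>)"
      by (intro nn_integral_mono) (auto simp: indicator_def)
    also have "\<dots> = ennreal (exp (n * (chi_const b * D - H / 4)))"
      by (simp add: \<pi>.emeasure_space_1)
    finally show ?thesis by (subst Fubini') measurable
  qed
  have "(\<integral>\<^sup>+X. T X \<partial>?\<Omega>) = (\<Sum>\<eta>\<in>C. \<integral>\<^sup>+X. (\<integral>\<^sup>+\<theta>. ennreal (u \<theta> X / \<phi> \<eta> X) * indicator (A \<eta>) \<theta> \<partial>\<pi>) \<partial>?\<Omega>)"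
    unfolding T_def by (rule nn_integral_sum) measurable
  also have "\<dots> \<le> (\<Sum>\<eta>\<in>C. ennreal (exp (n * (chi_const b * D - H / 4))))"
    by (intro sum_mono cell)
  also have "\<dots> = ennreal (card C * exp (n * (chi_const b * D - H / 4)))"
    by (subst ennreal_mult) (auto simp: ennreal_of_nat_eq_real_of_nat)
  finally have ET: "(\<integral>\<^sup>+X. T X \<partial>?\<Omega>) \<le> ennreal (card C * exp (n * (chi_const b * D - H / 4)))" .
  define G3 where "G3 = {X \<in> space ?\<Omega>. ennreal (exp (- a)) \<le> T X}"
  have G3: "G3 \<in> sets ?\<Omega>" unfolding G3_def by measurable
  have "measure ?\<Omega> G3 \<le> card C * exp (n * (chi_const b * D - H / 4)) / exp (- a)"
    unfolding G3_def by (rule markov_prob_bound[OF \<Omega> T_meas ET]) auto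
  then have G3_le: "measure ?\<Omega> G3 \<le> card C * exp (n * (chi_const b * D - H / 4) + a)"
    using exp_diff[of "n * (chi_const b * D - H / 4)" "- a"] by simp

  have "(LINT \<theta>:V|\<pi>. likelihood n X \<theta>) / (LINT \<theta>|\<pi>. likelihood n X \<theta>) \<le> exp (t - a) / m"
    if X: "X \<in> space ?\<Omega> - (G1 \<union> G2 \<union> G3)" for X
  proof (cases "integrable \<pi> (\<lambda>\<theta>. likelihood n X \<theta>)")
    \<comment> \<open>The denominator is then \<open>0\<close> by convention, and so is the quotient.\<close>
    case False
    then show ?thesis using m by (simp add: not_integrable_integral_eq)
  next
    case True
    have "X \<in> space ?\<Omega>" using X by simp
    from measurable_compose[OF measurable_Pair2'[OF this] u_meas]
    have [measurable]: "(\<lambda>\<theta>. u \<theta> X) \<in> borel_measurable \<pi>" by simp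
    have "ennreal (LINT \<theta>:V|\<pi>. likelihood n X \<theta>) \<le> (\<integral>\<^sup>+\<theta>. ennreal (indicator V \<theta> *\<^sub>R likelihood n X \<theta>) \<partial>\<pi>)"
      unfolding set_lebesgue_integral_def
      by (rule ennreal_integral_le_nn_integral) (simp add: lik u0 less_imp_le[OF L0])
    also have "\<dots> \<le> (\<integral>\<^sup>+\<theta>. ennreal (L X) * (\<Sum>\<eta>\<in>C. ennreal (u \<theta> X / \<phi> \<eta> X) * indicator (A \<eta>) \<theta>) \<partial>\<pi>)"
    proof (rule nn_integral_mono)
      fix \<theta>
      show "ennreal (indicator V \<theta> *\<^sub>R likelihood n X \<theta>)
        \<le> ennreal (L X) * (\<Sum>\<eta>\<in>C. ennreal (u \<theta> X / \<phi> \<eta> X) * indicator (A \<eta>) \<theta>)"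
      proof (cases "\<theta> \<in> V")
        case True
        then obtain \<eta> where \<eta>: "\<eta> \<in> C" "\<theta> \<in> A \<eta>" using V by (auto simp: A_def)
        have "\<not> ennreal 1 \<le> ennreal (\<phi> \<eta> X)" using X \<eta>(1) by (auto simp: G2_def)
        then have "\<phi> \<eta> X < 1" by (simp add: not_le)
        then have "u \<theta> X \<le> u \<theta> X / \<phi> \<eta> X"
          using \<phi>pos[OF \<eta>(1), of X] u0[of \<theta> X] by (simp add: le_divide_eq mult_left_le)
        then have "ennreal (u \<theta> X) \<le> ennreal (u \<theta> X / \<phi> \<eta> X) * indicator (A \<eta>) \<theta>"
          using \<eta>(2) by (simp add: ennreal_leI)
        also have "\<dots> \<le> (\<Sum>\<eta>\<in>C. ennreal (u \<theta> X / \<phi> \<eta> X) * indicator (A \<eta>) \<theta>)"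
          by (rule member_le_sum[OF \<eta>(1) _ C(1)]) simp
        finally show ?thesis
          using True L0[of X] u0[of \<theta> X] by (simp add: lik ennreal_mult mult_left_mono)
      qed simp
    qed
    also have "\<dots> = ennreal (L X) * (\<integral>\<^sup>+\<theta>. (\<Sum>\<eta>\<in>C. ennreal (u \<theta> X / \<phi> \<eta> X) * indicator (A \<eta>) \<theta>) \<partial>\<pi>)"
      by (rule nn_integral_cmult) measurable
    also have "\<dots> = ennreal (L X) * T X"
      unfolding T_def by (subst nn_integral_sum) measurable
    also have "\<dots> \<le> ennreal (L X) * ennreal (exp (- a))"
      using X by (intro mult_left_mono) (auto simp: G3_def not_le)
    finally have num: "(LINT \<theta>:V|\<pi>. likelihood n X \<theta>) \<le> L X * exp (- a)"
      using L0[of X] by (simp add: ennreal_mult[symmetric])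
    have "ennreal (L X * (measure \<pi> S * exp (- t))) \<le> ennreal (L X) * (\<integral>\<^sup>+\<theta>. ennreal (u \<theta> X) * indicator S \<theta> \<partial>\<pi>)"
      using G1(3) X L0[of X] by (simp add: ennreal_mult mult_left_mono)
    also have "\<dots> = (\<integral>\<^sup>+\<theta>. ennreal (L X) * (ennreal (u \<theta> X) * indicator S \<theta>) \<partial>\<pi>)"
      by (rule nn_integral_cmult[symmetric]) measurable
    also have "\<dots> \<le> (\<integral>\<^sup>+\<theta>. ennreal (likelihood n X \<theta>) \<partial>\<pi>)"
      using L0[of X] u0 by (intro nn_integral_mono) (auto simp: lik ennreal_mult indicator_def)
    also have "\<dots> = ennreal (LINT \<theta>|\<pi>. likelihood n X \<theta>)"
      using True L0[of X] u0 by (intro nn_integral_eq_integral) (auto simp: lik)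
    finally have "ennreal (L X * (measure \<pi> S * exp (- t))) \<le> ennreal (LINT \<theta>|\<pi>. likelihood n X \<theta>)" .
    moreover have "0 \<le> (LINT \<theta>|\<pi>. likelihood n X \<theta>)"
      by (intro Bochner_Integration.integral_nonneg) (simp add: lik u0 less_imp_le[OF L0])
    ultimately have "L X * (measure \<pi> S * exp (- t)) \<le> (LINT \<theta>|\<pi>. likelihood n X \<theta>)"
      by (rule iffD1[OF ennreal_le_iff, rotated])
    then have "L X * (m * exp (- t)) \<le> (LINT \<theta>|\<pi>. likelihood n X \<theta>)"
      using L0[of X] m by (intro order_trans[OF _ \<open>L X * (measure \<pi> S * exp (- t)) \<le> _\<close>]) simp
    then have "(LINT \<theta>:V|\<pi>. likelihood n X \<theta>) / (LINT \<theta>|\<pi>. likelihood n X \<theta>)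
      \<le> (L X * exp (- a)) / (L X * (m * exp (- t)))"
      using num L0[of X] m by (intro frac_le) auto
    also have "\<dots> = exp (t - a) / m"
      using L0[of X] by (simp add: exp_diff exp_minus field_simps)
    finally show ?thesis .
  qed
  moreover have "measure ?\<Omega> (G1 \<union> G2 \<union> G3) \<le> exp (n * (chi_const b * D) - t) + card C * exp (- real n * H / 2)
        + card C * exp (n * (chi_const b * D - H / 4) + a)"
    using measure_Un_le[of "G1 \<union> G2" ?\<Omega> G3] measure_Un_le[of G1 ?\<Omega> G2] G1 G2 G3 G2_le G3_le by auto
  moreover have "G1 \<union> G2 \<union> G3 \<in> sets ?\<Omega>" using G1(1) G2 G3 by auto
  ultimately show ?thesis by blast
qed

section \<open>Counting weighted lattice points\<close>

text \<open>The single term of index \<open>k\<close> is at most the whole exponential series.\<close>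

lemma power_le_exp_fact:
  fixes x :: real
  assumes "0 \<le> x"
  shows "x ^ k \<le> exp x * fact k"
proof -
  have "x ^ k /\<^sub>R fact k = (\<Sum>n\<in>{k}. x ^ n /\<^sub>R fact n)" by simp
  also have "\<dots> \<le> (\<Sum>n. x ^ n /\<^sub>R fact n)"
    using assms by (intro sum_le_suminf summable_exp_generic) auto
  also have "\<dots> = exp x" by (simp add: exp_def)
  finally show ?thesis by (simp add: field_simps)
qed

text \<open>The product equals \<open>(N! / N ^ N) ^ p\<close>.  Both the covering number and the prior mass of a small box
  contain it; it is only exponentially small in \<open>N\<close>, which is why no logarithmic factor appears in the
  rate.\<close>

lemma prod_relative_index_ge:
  "exp (- real N * real p) \<le> (\<Prod>j<N. (real (Suc j) / real N) ^ p)"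
proof -
  have "(\<Prod>j<N. real (Suc j)) = fact N"
    by (simp add: fact_prod_Suc atLeast0LessThan)
  then have "(\<Prod>j<N. (real (Suc j) / real N) ^ p) = (fact N / real N ^ N) ^ p"
    by (simp only: prod_power_distrib[symmetric] prod_dividef prod_constant card_lessThan)
  moreover have "exp (- real N) \<le> fact N / real N ^ N"
  proof (cases "N = 0")
    case False
    then show ?thesis using power_le_exp_fact[of "real N" N] by (simp add: exp_minus field_simps)
  qed simp
  then have "exp (- real N) ^ p \<le> (fact N / real N ^ N) ^ p"
    by (rule power_mono) simp
  ultimately show ?thesis by (simp add: exp_of_nat_mult[symmetric] mult.commute)
qed

lemma sum_exp_abs_le:
  assumes "0 < w" "w \<le> 1"
  shows "(\<Sum>k\<in>{- int R..int R}. exp (- w * \<bar>real_of_int k\<bar>)) \<le> 4 / w"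
proof -
  let ?q = "exp (- w)"
  have q: "0 \<le> ?q" "?q < 1" using assms by auto
  have "?q \<le> 1 / (1 + w)"
    using exp_ge_add_one_self[of w] assms by (simp add: exp_minus field_simps)
  moreover have "w / 2 \<le> 1 - 1 / (1 + w)"
    using assms mult_left_le[of w w] by (simp add: field_simps)
  ultimately have "w / 2 \<le> 1 - ?q" by linarith
  then have geo: "1 / (1 - ?q) \<le> 2 / w"
    using assms by (simp add: field_simps)
  have part: "(\<Sum>k\<in>f ` {..R}. exp (- w * \<bar>real_of_int k\<bar>)) \<le> 2 / w"
    if "inj_on f {..R}" "\<And>i. \<bar>f i\<bar> = int i" for f :: "nat \<Rightarrow> int"
  proof -
    have "\<bar>real_of_int (f i)\<bar> = real i" for i
      using that(2)[of i] by (metis of_int_abs of_int_of_nat_eq)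
    then have "(\<Sum>k\<in>f ` {..R}. exp (- w * \<bar>real_of_int k\<bar>)) = (\<Sum>i\<le>R. ?q ^ i)"
      using that(1) by (simp add: sum.reindex exp_of_nat_mult[symmetric] mult.commute)
    also have "\<dots> \<le> (\<Sum>i. ?q ^ i)"
      using q by (intro sum_le_suminf summable_geometric) auto
    also have "\<dots> = 1 / (1 - ?q)" using q by (intro suminf_geometric) auto
    finally show ?thesis using geo by simp
  qed
  have "{- int R..int R} \<subseteq> int ` {..R} \<union> (\<lambda>i. - int i) ` {..R}"
  proof
    fix k assume "k \<in> {- int R..int R}"
    then show "k \<in> int ` {..R} \<union> (\<lambda>i. - int i) ` {..R}"
      by (cases k rule: int_cases2) auto
  qed
  then have "(\<Sum>k\<in>{- int R..int R}. exp (- w * \<bar>real_of_int k\<bar>))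
    \<le> (\<Sum>k\<in>int ` {..R} \<union> (\<lambda>i. - int i) ` {..R}. exp (- w * \<bar>real_of_int k\<bar>))"
    by (intro sum_mono2) auto
  also have "\<dots> \<le> (\<Sum>k\<in>int ` {..R}. exp (- w * \<bar>real_of_int k\<bar>))
      + (\<Sum>k\<in>(\<lambda>i. - int i) ` {..R}. exp (- w * \<bar>real_of_int k\<bar>))"
    by (subst sum_Un) (auto intro!: sum_nonneg)
  also have "\<dots> \<le> 2 / w + 2 / w"
    by (intro add_mono part) (auto simp: inj_on_def)
  finally show ?thesis by simp
qed

text \<open>Exponential tilting: each point of \<open>S\<close> has weight at least \<open>exp (- R)\<close> under the product weight
  \<open>exp (- (\<Sum>j<N. w j * \<bar>k j\<bar>))\<close>, whose total mass is a product of geometric series.\<close>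

lemma card_weighted_lattice_ball_le:
  fixes w :: "nat \<Rightarrow> real" and S :: "(nat \<Rightarrow> int) set"
  assumes w: "\<And>j. j < N \<Longrightarrow> 0 < w j" "\<And>j. j < N \<Longrightarrow> w j \<le> 1"
    and S: "S \<subseteq> {..<N} \<rightarrow>\<^sub>E UNIV" "\<And>k. k \<in> S \<Longrightarrow> (\<Sum>j<N. w j * \<bar>real_of_int (k j)\<bar>) \<le> R"
  shows "finite S" and "real (card S) \<le> exp R * (\<Prod>j<N. 4 / w j)"
proof -
  define B where "B j = nat \<lceil>R / w j\<rceil>" for j
  have sub: "S \<subseteq> (\<Pi>\<^sub>E j\<in>{..<N}. {- int (B j)..int (B j)})"
  proof
    fix k assume k: "k \<in> S"
    have "k j \<in> {- int (B j)..int (B j)}" if j: "j < N" for j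
    proof -
      have "w j * \<bar>real_of_int (k j)\<bar> \<le> (\<Sum>j<N. w j * \<bar>real_of_int (k j)\<bar>)"
        using w j by (intro member_le_sum) (auto simp: less_imp_le)
      also have "\<dots> \<le> R" by (rule S(2)[OF k])
      finally have "\<bar>real_of_int (k j)\<bar> \<le> R / w j"
        using w(1)[OF j] by (simp add: field_simps)
      then have "\<bar>k j\<bar> \<le> \<lceil>R / w j\<rceil>" by linarith
      moreover from this have "0 \<le> \<lceil>R / w j\<rceil>" using abs_ge_zero[of "k j"] by linarith
      then have "int (B j) = \<lceil>R / w j\<rceil>" by (simp add: B_def)
      ultimately show ?thesis by (simp add: abs_le_iff)
    qed
    then show "k \<in> (\<Pi>\<^sub>E j\<in>{..<N}. {- int (B j)..int (B j)})"
      using k S(1) by (auto simp: PiE_iff)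
  qed
  have fin: "finite (\<Pi>\<^sub>E j\<in>{..<N}. {- int (B j)..int (B j)})"
    by (intro finite_PiE) auto
  show "finite S" by (rule finite_subset[OF sub fin])
  have "real (card S) = (\<Sum>k\<in>S. 1)" by simp
  also have "\<dots> \<le> (\<Sum>k\<in>S. exp R * (\<Prod>j<N. exp (- w j * \<bar>real_of_int (k j)\<bar>)))"
  proof (rule sum_mono)
    fix k assume "k \<in> S"
    then have "1 \<le> exp (R - (\<Sum>j<N. w j * \<bar>real_of_int (k j)\<bar>))" using S(2) by simp
    also have "\<dots> = exp R * (\<Prod>j<N. exp (- w j * \<bar>real_of_int (k j)\<bar>))"
      by (simp add: exp_diff exp_sum exp_minus prod_inversef[symmetric] divide_inverse)
    finally show "1 \<le> exp R * (\<Prod>j<N. exp (- w j * \<bar>real_of_int (k j)\<bar>))" .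
  qed
  also have "\<dots> \<le> (\<Sum>k\<in>(\<Pi>\<^sub>E j\<in>{..<N}. {- int (B j)..int (B j)}). exp R * (\<Prod>j<N. exp (- w j * \<bar>real_of_int (k j)\<bar>)))"
    by (intro sum_mono2 fin sub mult_nonneg_nonneg prod_nonneg) auto
  also have "\<dots> = exp R * (\<Prod>j<N. \<Sum>k\<in>{- int (B j)..int (B j)}. exp (- w j * \<bar>real_of_int k\<bar>))"
    by (simp add: prod_sum_PiE sum_distrib_left)
  also have "\<dots> \<le> exp R * (\<Prod>j<N. 4 / w j)"
    using sum_exp_abs_le w by (intro mult_left_mono prod_mono conjI sum_nonneg) auto
  finally show "real (card S) \<le> exp R * (\<Prod>j<N. 4 / w j)" .
qed

section \<open>The Sobolev ellipsoid and its covering\<close>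

lemma freq_Suc_bounds: "Suc j \<le> freq (Suc j)" "freq (Suc j) \<le> 2 * Suc j"
  by (auto simp: freq_def)

lemma freq_power_le:
  assumes "j < N"
  shows "real (freq (Suc j)) ^ (2 * p) \<le> 4 ^ p * real N ^ (2 * p)"
proof -
  have "freq (Suc j) \<le> 2 * N" using freq_Suc_bounds(2)[of j] assms by simp
  then have "real (freq (Suc j)) ^ (2 * p) \<le> (2 * real N) ^ (2 * p)"
    by (intro power_mono) (auto simp flip: of_nat_mult)
  then show ?thesis by (simp add: power_mult_distrib power_mult)
qed

text \<open>Since \<open>freq 0 = 0\<close>, membership involves only the coordinates of positive index, and square summability
  follows from the weighted one.\<close>

lemma sobolev_ellipsoid_iff:
  assumes "1 \<le> p"
  shows "\<theta> \<in> sobolev_ellipsoid p Q \<longleftrightarrow>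
    summable (\<lambda>j. real (freq (Suc j)) ^ (2 * p) * (\<theta> (Suc j))\<^sup>2) \<and>
    (\<Sum>j. real (freq (Suc j)) ^ (2 * p) * (\<theta> (Suc j))\<^sup>2) < Q"
proof -
  let ?a = "\<lambda>j. real (freq j) ^ (2 * p) * (\<theta> j)\<^sup>2"
  have a0: "?a 0 = 0" using assms by (simp add: freq_def)
  have s: "summable (\<lambda>j. ?a (Suc j)) \<longleftrightarrow> summable ?a" by (rule summable_Suc_iff)
  have "summable (\<lambda>j. (\<theta> j)\<^sup>2)" if "summable (\<lambda>j. ?a (Suc j))"
  proof -
    have "summable (\<lambda>j. (\<theta> (Suc j))\<^sup>2)"
    proof (rule summable_comparison_test'[OF that, of 0])
      fix j
      have "1 * (\<theta> (Suc j))\<^sup>2 \<le> ?a (Suc j)"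
        using freq_Suc_bounds(1)[of j] by (intro mult_right_mono one_le_power) auto
      then show "norm ((\<theta> (Suc j))\<^sup>2) \<le> ?a (Suc j)" by simp
    qed
    then show ?thesis by (subst (asm) summable_Suc_iff)
  qed
  moreover have "(\<Sum>j. ?a (Suc j)) = (\<Sum>j. ?a j)" if "summable ?a"
    using suminf_split_head[OF that] a0 by simp
  ultimately show ?thesis unfolding sobolev_ellipsoid_def using s by auto
qed

lemma summable_const_A:
  assumes "1 \<le> p" shows "summable (\<lambda>j. 1 / real (freq (Suc j)) ^ (2 * p))"
proof (rule summable_comparison_test'[of "\<lambda>j. inverse (real (Suc j) ^ 2)" 0])
  show "summable (\<lambda>j. inverse (real (Suc j) ^ 2))"
    by (subst summable_Suc_iff[of "\<lambda>j. inverse (real j ^ 2)"]) (rule inverse_power_summable, simp)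
  fix j
  have "real (Suc j) ^ 2 \<le> real (freq (Suc j)) ^ 2"
    using freq_Suc_bounds(1)[of j] by (intro power_mono) (simp_all only: of_nat_le_iff of_nat_0_le_iff)
  also have "\<dots> \<le> real (freq (Suc j)) ^ (2 * p)"
    using freq_Suc_bounds(1)[of j] assms by (intro power_increasing) auto
  finally have "inverse (real (freq (Suc j)) ^ (2 * p)) \<le> inverse (real (Suc j) ^ 2)"
    by (rule le_imp_inverse_le) simp
  then show "norm (1 / real (freq (Suc j)) ^ (2 * p)) \<le> inverse (real (Suc j) ^ 2)"
    by (simp add: inverse_eq_divide)
qed

text \<open>The inequality of arithmetic and geometric means,
  \<open>\<bar>\<theta> j\<bar> \<le> (v ^ (2 * p) * (\<theta> j)\<^sup>2 + v ^ (- 2 * p)) / 2\<close> for the frequency \<open>v\<close> of \<open>j\<close>, summed over \<open>j\<close>.\<close>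

lemma sobolev_ellipsoid_subset_coeff_ball:
  assumes p: "1 \<le> p"
  shows "sobolev_ellipsoid p Q \<subseteq> coeff_ball (Q + const_A p)"
proof
  fix \<theta> assume "\<theta> \<in> sobolev_ellipsoid p Q"
  then have s: "summable (\<lambda>j. real (freq (Suc j)) ^ (2 * p) * (\<theta> (Suc j))\<^sup>2)"
    and lt: "(\<Sum>j. real (freq (Suc j)) ^ (2 * p) * (\<theta> (Suc j))\<^sup>2) < Q"
    by (auto simp: sobolev_ellipsoid_iff[OF p])
  have am: "\<bar>\<theta> (Suc j)\<bar> \<le> (real (freq (Suc j)) ^ (2 * p) * (\<theta> (Suc j))\<^sup>2 + 1 / real (freq (Suc j)) ^ (2 * p)) / 2" for j
  proof -
    define f where "f = real (freq (Suc j)) ^ p"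
    have f: "f > 0" using freq_Suc_bounds(1)[of j] by (auto simp: f_def)
    have "0 \<le> (f * \<bar>\<theta> (Suc j)\<bar> - 1 / f)\<^sup>2" by simp
    also have "\<dots> = f\<^sup>2 * (\<theta> (Suc j))\<^sup>2 + 1 / f\<^sup>2 - 2 * \<bar>\<theta> (Suc j)\<bar>"
      using f by (simp add: power2_diff power_mult_distrib power_divide)
    finally show ?thesis by (simp add: f_def power_mult[symmetric] mult.commute)
  qed
  have s2: "summable (\<lambda>j. (real (freq (Suc j)) ^ (2 * p) * (\<theta> (Suc j))\<^sup>2 + 1 / real (freq (Suc j)) ^ (2 * p)) / 2)"
    by (intro summable_divide summable_add s summable_const_A p)
  have sa: "summable (\<lambda>j. \<bar>\<theta> (Suc j)\<bar>)"
    by (rule summable_comparison_test'[OF s2, of 0]) (use am in auto)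
  have "(\<Sum>j. \<bar>\<theta> (Suc j)\<bar>) \<le> (\<Sum>j. (real (freq (Suc j)) ^ (2 * p) * (\<theta> (Suc j))\<^sup>2 + 1 / real (freq (Suc j)) ^ (2 * p)) / 2)"
    by (rule suminf_le[OF am sa s2])
  also have "\<dots> = ((\<Sum>j. real (freq (Suc j)) ^ (2 * p) * (\<theta> (Suc j))\<^sup>2) + const_A p) / 2"
    unfolding const_A_def
    by (subst suminf_divide) (auto intro!: summable_add s summable_const_A p simp: suminf_add[OF s summable_const_A[OF p]])
  also have "\<dots> \<le> (Q + const_A p) / 2" using lt by simp
  finally have le: "(\<Sum>j. \<bar>\<theta> (Suc j)\<bar>) \<le> (Q + const_A p) / 2" .
  have "0 \<le> (\<Sum>j. \<bar>\<theta> (Suc j)\<bar>)" by (intro suminf_nonneg sa) auto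
  then have "sqrt 2 * (\<Sum>j. \<bar>\<theta> (Suc j)\<bar>) \<le> 2 * ((Q + const_A p) / 2)"
    using le sqrt2_less_2 by (intro mult_mono) auto
  then show "\<theta> \<in> coeff_ball (Q + const_A p)" using sa by (simp add: coeff_ball_def)
qed

lemma summable_sqdist:
  assumes "\<theta> \<in> coeff_ball b" "\<eta> \<in> coeff_ball b"
  shows "summable (\<lambda>j. (\<theta> (Suc j) - \<eta> (Suc j))\<^sup>2)"
proof (rule summable_square_of_abs)
  have s: "summable (\<lambda>j. \<bar>\<theta> (Suc j)\<bar>)" "summable (\<lambda>j. \<bar>\<eta> (Suc j)\<bar>)"
    using assms by (auto simp: coeff_ball_def)
  show "summable (\<lambda>j. \<bar>\<theta> (Suc j) - \<eta> (Suc j)\<bar>)"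
    by (rule summable_comparison_test'[OF summable_add[OF s], of 0]) auto
qed

text \<open>The Sobolev weight is at least \<open>N ^ (2 * p)\<close> beyond the first \<open>N\<close> coordinates.\<close>

lemma sqdist_le_initial:
  assumes p: "1 \<le> p" and \<theta>: "\<theta> \<in> sobolev_ellipsoid p Q" and \<eta>: "\<eta> \<in> sobolev_ellipsoid p Q" and N: "1 \<le> N"
  shows "sqdist \<theta> \<eta> \<le> (\<Sum>j<N. (\<theta> (Suc j) - \<eta> (Suc j))\<^sup>2) + 4 * Q / real N ^ (2 * p)"
proof -
  let ?a = "\<lambda>\<theta> j. real (freq (Suc j)) ^ (2 * p) * (\<theta> (Suc j))\<^sup>2"
  have s: "summable (?a \<theta>)" "summable (?a \<eta>)" and q: "(\<Sum>j. ?a \<theta> j) < Q" "(\<Sum>j. ?a \<eta> j) < Q"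
    using \<theta> \<eta> by (auto simp: sobolev_ellipsoid_iff[OF p])
  have sd: "summable (\<lambda>j. (\<theta> (Suc j) - \<eta> (Suc j))\<^sup>2)"
    using \<theta> \<eta> sobolev_ellipsoid_subset_coeff_ball[OF p] by (intro summable_sqdist) auto
  have shift: "(\<Sum>j. ?a \<theta> (j + N)) \<le> Q" if "summable (?a \<theta>)" "(\<Sum>j. ?a \<theta> j) < Q" for \<theta> :: "nat \<Rightarrow> real"
  proof -
    have "0 \<le> (\<Sum>j<N. ?a \<theta> j)" by (intro sum_nonneg) auto
    then show ?thesis
      using suminf_split_initial_segment[OF that(1), of N] that(2) by linarith
  qed
  have tail: "(\<theta> (Suc (j + N)) - \<eta> (Suc (j + N)))\<^sup>2 \<le> 2 / real N ^ (2 * p) * (?a \<theta> (j + N) + ?a \<eta> (j + N))" for j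
  proof -
    let ?t = "\<theta> (Suc (j + N))" and ?e = "\<eta> (Suc (j + N))"
    have "(?t - ?e)\<^sup>2 \<le> 2 * (?t\<^sup>2 + ?e\<^sup>2)"
      using zero_le_power2[of "?t + ?e"] by (simp add: power2_eq_square algebra_simps)
    moreover have "N \<le> freq (Suc (j + N))" using freq_Suc_bounds(1)[of "j + N"] by linarith
    then have "real N ^ (2 * p) \<le> real (freq (Suc (j + N))) ^ (2 * p)"
      by (intro power_mono) auto
    then have "real N ^ (2 * p) * (?t\<^sup>2 + ?e\<^sup>2) \<le> ?a \<theta> (j + N) + ?a \<eta> (j + N)"
      unfolding distrib_left[symmetric] by (intro mult_right_mono) auto
    then have "2 * (?t\<^sup>2 + ?e\<^sup>2) \<le> 2 / real N ^ (2 * p) * (?a \<theta> (j + N) + ?a \<eta> (j + N))"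
      using N by (simp add: field_simps)
    ultimately show ?thesis by linarith
  qed
  have ss: "summable (\<lambda>j. ?a \<theta> (j + N))" "summable (\<lambda>j. ?a \<eta> (j + N))"
    using s by (auto simp: summable_iff_shift[of "?a _" N])
  have "(\<Sum>j. (\<theta> (Suc (j + N)) - \<eta> (Suc (j + N)))\<^sup>2)
      \<le> (\<Sum>j. 2 / real N ^ (2 * p) * (?a \<theta> (j + N) + ?a \<eta> (j + N)))"
    using sd by (intro suminf_le[OF tail] summable_mult summable_add ss)
      (simp add: summable_iff_shift[of "\<lambda>j. (\<theta> (Suc j) - \<eta> (Suc j))\<^sup>2" N])
  also have "\<dots> = 2 / real N ^ (2 * p) * ((\<Sum>j. ?a \<theta> (j + N)) + (\<Sum>j. ?a \<eta> (j + N)))"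
    by (subst suminf_mult) (auto intro!: summable_add ss simp: suminf_add[OF ss])
  also have "\<dots> \<le> 2 / real N ^ (2 * p) * (Q + Q)"
    using shift[OF s(1) q(1)] shift[OF s(2) q(2)] by (intro mult_left_mono add_mono) auto
  finally show ?thesis
    unfolding sqdist_def using suminf_split_initial_segment[OF sd, of N] by simp
qed

text \<open>The first \<open>N\<close> coordinates are rounded to a lattice of mesh \<open>s = 1 / (sqrt N * N ^ p)\<close>, which moves
  them by at most \<open>N ^ (- p)\<close> in Euclidean norm, the size of the neglected tail.  A lattice point
  \<open>k\<close> coming from the ellipsoid satisfies \<open>(\<Sum>j. w j * \<bar>k j\<bar>) \<le> c * N\<close> with \<open>w j = (j / N) ^ p\<close>, by Young's inequality
  for each coordinate, and \<open>card_weighted_lattice_ball_le\<close> counts such points.  The centres are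
  chosen inside \<open>V\<close>, so that they inherit the distance from the truth that defines \<open>V\<close>.\<close>

lemma sobolev_ellipsoid_cover:
  assumes p: "1 \<le> p" and Q: "0 < Q" and N: "1 \<le> N" and V: "V \<subseteq> sobolev_ellipsoid p Q"
  shows "\<exists>C. finite C \<and> C \<subseteq> V \<and> real (card C) \<le> exp ((Q + 4 + real p) * real N) \<and>
    (\<forall>\<theta>\<in>V. \<exists>\<eta>\<in>C. sqdist \<theta> \<eta> \<le> (1 + 4 * Q) / real N ^ (2 * p))"
proof -
  define s where "s = 1 / (sqrt (real N) * real N ^ p)"
  have s: "0 < s" using N by (simp add: s_def)
  have s2: "real N * s\<^sup>2 = 1 / real N ^ (2 * p)"
    using N by (simp add: s_def power_divide power_mult_distrib power_mult[symmetric] mult.commute)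
  define cell where "cell \<theta> = (\<lambda>j\<in>{..<N}. \<lfloor>\<theta> (Suc j) / s\<rfloor>)" for \<theta> :: "nat \<Rightarrow> real"
  define w where "w j = (real (Suc j) / real N) ^ p" for j
  have w: "0 < w j" "w j \<le> 1" if "j < N" for j
    using that by (auto simp: w_def intro!: power_le_one)
  have cells: "cell ` V \<subseteq> {..<N} \<rightarrow>\<^sub>E UNIV" by (auto simp: cell_def PiE_iff split: if_splits)
  have weight: "(\<Sum>j<N. w j * \<bar>real_of_int (k j)\<bar>) \<le> (Q + 3 / 2) * real N" if k: "k \<in> cell ` V" for k
  proof -
    obtain \<theta> where \<theta>: "\<theta> \<in> V" "k = cell \<theta>" using k by auto
    let ?a = "\<lambda>j. real (freq (Suc j)) ^ (2 * p) * (\<theta> (Suc j))\<^sup>2"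
    have sa: "summable ?a" and qa: "(\<Sum>j. ?a j) < Q"
      using \<theta>(1) V by (auto simp: sobolev_ellipsoid_iff[OF p])
    have 1: "w j * \<bar>real_of_int (k j)\<bar> \<le> real N * ?a j + 3 / 2" if j: "j < N" for j
    proof -
      let ?x = "\<theta> (Suc j) / s" and ?k = "real_of_int (k j)"
      have kj: "k j = \<lfloor>?x\<rfloor>" using j by (simp add: \<theta>(2) cell_def)
      have "\<bar>?k\<bar> \<le> \<bar>?x\<bar> + 1" unfolding kj by linarith
      then have "w j * \<bar>?k\<bar> \<le> w j * \<bar>?x\<bar> + 1"
        using w[OF j] mult_left_mono[of "\<bar>?k\<bar>" "\<bar>?x\<bar> + 1" "w j"] by (simp add: distrib_left)
      also have "\<dots> \<le> ((w j)\<^sup>2 * ?x\<^sup>2 + 1) / 2 + 1"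
      proof -
        have "y \<le> (y\<^sup>2 + 1) / 2" for y :: real
          using zero_le_power2[of "y - 1"] by (simp add: power2_diff)
        from this[of "w j * \<bar>?x\<bar>"] show ?thesis by (simp only: power_mult_distrib power2_abs)
      qed
      also have "(w j)\<^sup>2 * ?x\<^sup>2 = real (Suc j) ^ (2 * p) * (real N * (\<theta> (Suc j))\<^sup>2)"
        using N by (simp add: w_def s_def power_divide power_mult_distrib power_mult[symmetric] mult.commute)
      also have "\<dots> \<le> real (freq (Suc j)) ^ (2 * p) * (real N * (\<theta> (Suc j))\<^sup>2)"
        using freq_Suc_bounds(1)[of j] by (intro mult_right_mono power_mono) (auto simp del: of_nat_Suc)
      also have "real (freq (Suc j)) ^ (2 * p) * (real N * (\<theta> (Suc j))\<^sup>2) = real N * ?a j"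
        by (rule mult.left_commute)
      finally have "w j * \<bar>?k\<bar> \<le> (real N * ?a j + 1) / 2 + 1" by simp
      moreover have "0 \<le> real N * ?a j" by simp
      moreover have "x \<le> a + 3 / 2" if "x \<le> (a + 1) / 2 + 1" "0 \<le> a" for x a :: real
        using that by (simp add: field_simps)
      ultimately show ?thesis by blast
    qed
    have "(\<Sum>j<N. ?a j) \<le> (\<Sum>j. ?a j)" by (intro sum_le_suminf sa) auto
    then have "real N * (\<Sum>j<N. ?a j) \<le> real N * Q" using qa by (intro mult_left_mono) auto
    moreover have "(\<Sum>j<N. w j * \<bar>real_of_int (k j)\<bar>) \<le> (\<Sum>j<N. real N * ?a j + 3 / 2)"
      by (intro sum_mono 1) simp
    moreover have "(\<Sum>j<N. real N * ?a j + 3 / 2) = real N * (\<Sum>j<N. ?a j) + 3 / 2 * real N"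
      by (simp add: sum.distrib sum_distrib_left)
    moreover have "(Q + 3 / 2) * real N = real N * Q + 3 / 2 * real N" by (simp add: algebra_simps)
    ultimately show ?thesis by linarith
  qed
  have fin: "finite (cell ` V)"
    by (rule card_weighted_lattice_ball_le(1)[OF w cells weight])
  have "real (card (cell ` V)) \<le> exp ((Q + 3 / 2) * real N) * (\<Prod>j<N. 4 / w j)"
    by (rule card_weighted_lattice_ball_le(2)[OF w cells weight])
  also have "(\<Prod>j<N. 4 / w j) = 4 ^ N / (\<Prod>j<N. w j)"
    by (simp add: prod_dividef)
  also have "\<dots> \<le> exp (2 * real N) / exp (- real N * real p)"
  proof (rule frac_le)
    have "(4 :: real) \<le> exp 1 ^ 2" using exp_ge_add_one_self[of 1] power_mono[of 2 "exp (1 :: real)" 2] by simp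
    then have "(4 :: real) ^ N \<le> (exp 2) ^ N" by (intro power_mono) (simp_all add: exp_of_nat_mult[symmetric])
    then show "(4 :: real) ^ N \<le> exp (2 * real N)" by (simp add: exp_of_nat_mult[symmetric] mult.commute)
    show "exp (- real N * real p) \<le> (\<Prod>j<N. w j)" unfolding w_def by (rule prod_relative_index_ge)
  qed auto
  also have "exp ((Q + 3 / 2) * real N) * (exp (2 * real N) / exp (- real N * real p))
      = exp ((Q + 7 / 2 + real p) * real N)"
    unfolding exp_diff[symmetric] exp_add[symmetric] by (simp add: algebra_simps)
  also have "\<dots> \<le> exp ((Q + 4 + real p) * real N)" by (simp add: mult_right_mono)
  finally have card: "real (card (cell ` V)) \<le> exp ((Q + 4 + real p) * real N)" by simp
  define rep where "rep k = (SOME \<eta>. \<eta> \<in> V \<and> cell \<eta> = k)" for k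
  have rep: "rep (cell \<theta>) \<in> V" "cell (rep (cell \<theta>)) = cell \<theta>" if "\<theta> \<in> V" for \<theta>
    using someI[of "\<lambda>\<eta>. \<eta> \<in> V \<and> cell \<eta> = cell \<theta>" \<theta>] that by (auto simp: rep_def)
  show ?thesis
  proof (intro exI[of _ "rep ` cell ` V"] conjI ballI)
    show "finite (rep ` cell ` V)" using fin by simp
    show "rep ` cell ` V \<subseteq> V" using rep by auto
    show "real (card (rep ` cell ` V)) \<le> exp ((Q + 4 + real p) * real N)"
      using card card_image_le[OF fin, of rep] by linarith
    fix \<theta> assume \<theta>: "\<theta> \<in> V"
    let ?\<eta> = "rep (cell \<theta>)"
    have close: "(\<theta> (Suc j) - ?\<eta> (Suc j))\<^sup>2 \<le> s\<^sup>2" if j: "j < N" for j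
    proof -
      have "\<lfloor>?\<eta> (Suc j) / s\<rfloor> = \<lfloor>\<theta> (Suc j) / s\<rfloor>"
        using fun_cong[OF rep(2)[OF \<theta>], of j] j by (simp add: cell_def)
      then have "\<bar>\<theta> (Suc j) / s - ?\<eta> (Suc j) / s\<bar> \<le> 1" by linarith
      then have "\<bar>\<theta> (Suc j) - ?\<eta> (Suc j)\<bar> \<le> s"
        using s by (simp add: diff_divide_distrib[symmetric] abs_divide)
      then show ?thesis using s by (simp add: abs_le_square_iff[symmetric])
    qed
    have "sqdist \<theta> ?\<eta> \<le> (\<Sum>j<N. (\<theta> (Suc j) - ?\<eta> (Suc j))\<^sup>2) + 4 * Q / real N ^ (2 * p)"
      using \<theta> rep(1)[OF \<theta>] V by (intro sqdist_le_initial p N) auto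
    also have "(\<Sum>j<N. (\<theta> (Suc j) - ?\<eta> (Suc j))\<^sup>2) \<le> (\<Sum>j<N. s\<^sup>2)"
      by (intro sum_mono close) simp
    also have "\<dots> = 1 / real N ^ (2 * p)" using s2 by simp
    finally have "sqdist \<theta> ?\<eta> \<le> (1 + 4 * Q) / real N ^ (2 * p)" by (simp add: add_divide_distrib)
    then show "\<exists>\<eta>\<in>rep ` cell ` V. sqdist \<theta> \<eta> \<le> (1 + 4 * Q) / real N ^ (2 * p)"
      using \<theta> by blast
  qed
qed

lemma summable_less_iff_suminf_ennreal:
  assumes "\<And>i. 0 \<le> f i"
  shows "summable f \<and> (\<Sum>i. f i) < c \<longleftrightarrow> (\<Sum>i. ennreal (f i)) < ennreal c"
proof
  assume *: "summable f \<and> (\<Sum>i. f i) < c"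
  have "0 \<le> (\<Sum>i. f i)" using * assms by (intro suminf_nonneg) auto
  then show "(\<Sum>i. ennreal (f i)) < ennreal c"
    using * assms by (subst suminf_ennreal2) (auto simp: ennreal_less_iff)
next
  assume *: "(\<Sum>i. ennreal (f i)) < ennreal c"
  then have s: "summable f" by (intro summable_suminf_not_top assms) auto
  moreover have "0 \<le> (\<Sum>i. f i)" using s assms by (intro suminf_nonneg) auto
  ultimately show "summable f \<and> (\<Sum>i. f i) < c"
    using * assms by (subst (asm) suminf_ennreal2) (auto simp: ennreal_less_iff)
qed

lemma sobolev_ellipsoid_measurable:
  assumes "1 \<le> p" shows "sobolev_ellipsoid p Q \<in> sets seq_space"
proof -
  have "{\<theta> \<in> space seq_space. (\<Sum>j. ennreal (real (freq (Suc j)) ^ (2 * p) * (\<theta> (Suc j))\<^sup>2)) < ennreal Q} \<in> sets seq_space"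
    by measurable
  also have "{\<theta> \<in> space seq_space. (\<Sum>j. ennreal (real (freq (Suc j)) ^ (2 * p) * (\<theta> (Suc j))\<^sup>2)) < ennreal Q}
      = sobolev_ellipsoid p Q"
    using assms by (auto simp: sobolev_ellipsoid_iff summable_less_iff_suminf_ennreal)
  finally show ?thesis .
qed

section \<open>Prior mass of small neighbourhoods\<close>

lemma sets_centered_gaussian [simp, measurable_cong]: "sets (centered_gaussian v) = sets borel"
  by (simp add: centered_gaussian_def)

lemma prob_space_centered_gaussian: "0 < v \<Longrightarrow> prob_space (centered_gaussian v)"
  unfolding centered_gaussian_def by (rule prob_space_normal_density) simp

lemma centered_gaussian_second_moment:
  assumes "0 < v"
  shows "(\<integral>\<^sup>+x. ennreal (x\<^sup>2) \<partial>centered_gaussian v) = ennreal v"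
proof -
  have "has_bochner_integral lborel (\<lambda>x. normal_density 0 (sqrt v) x * x\<^sup>2) v"
    using normal_moment_even[of "sqrt v" 0 1] assms by simp
  then have "(\<integral>\<^sup>+x. ennreal (normal_density 0 (sqrt v) x * x\<^sup>2) \<partial>lborel) = ennreal v"
    using assms by (subst nn_integral_eq_integral) (auto simp: has_bochner_integral_iff)
  then show ?thesis
    unfolding centered_gaussian_def by (subst nn_integral_density) (auto simp: ennreal_mult)
qed

text \<open>On the interval \<open>x\<^sup>2 \<le> 2 * (c\<^sup>2 + d\<^sup>2)\<close>, which bounds the density from below.\<close>

lemma centered_gaussian_interval_ge:
  assumes v: "0 < v" and d: "0 \<le> d"
  shows "2 * d / sqrt (2 * pi * v) * exp (- ((c\<^sup>2 + d\<^sup>2) / v)) \<le> measure (centered_gaussian v) {c - d..c + d}"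
proof -
  interpret prob_space "centered_gaussian v" by (rule prob_space_centered_gaussian[OF v])
  let ?l = "1 / sqrt (2 * pi * v) * exp (- ((c\<^sup>2 + d\<^sup>2) / v))"
  have l0: "0 \<le> ?l" using v by simp
  have ge: "?l \<le> normal_density 0 (sqrt v) x" if "x \<in> {c - d..c + d}" for x
  proof -
    have "\<bar>x - c\<bar> \<le> \<bar>d\<bar>" using that by auto
    then have "(x - c)\<^sup>2 \<le> d\<^sup>2" by (simp only: abs_le_square_iff)
    moreover have "x\<^sup>2 \<le> 2 * (c\<^sup>2 + (x - c)\<^sup>2)"
      using zero_le_power2[of "x - 2 * c"] by (simp add: power2_eq_square algebra_simps)
    ultimately have "x\<^sup>2 \<le> 2 * (c\<^sup>2 + d\<^sup>2)" by simp
    then have "x\<^sup>2 / (2 * v) \<le> (c\<^sup>2 + d\<^sup>2) / v"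
      using v by (simp add: field_simps)
    then show ?thesis
      unfolding normal_density_def using v by (intro mult_mono) auto
  qed
  have "ennreal (?l * (2 * d)) = (\<integral>\<^sup>+x. ennreal ?l * indicator {c - d..c + d} x \<partial>lborel)"
    using l0 d by (subst nn_integral_cmult_indicator) (auto simp: ennreal_mult[symmetric])
  also have "\<dots> \<le> (\<integral>\<^sup>+x. ennreal (normal_density 0 (sqrt v) x) * indicator {c - d..c + d} x \<partial>lborel)"
    using ge by (intro nn_integral_mono) (auto simp: indicator_def intro!: ennreal_leI)
  also have "\<dots> = emeasure (centered_gaussian v) {c - d..c + d}"
    unfolding centered_gaussian_def by (subst emeasure_density) auto
  finally show ?thesis
    unfolding emeasure_eq_measure by (subst (asm) ennreal_le_iff) (auto simp: mult_ac)
qed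

text \<open>The box and the tail depend on disjoint sets of coordinates.  Instead of the independence of the
  infinite tail, the proof integrates each term of the tail series against the indicator of the box,
  which involves finitely many coordinates, and applies Markov's inequality restricted to the box.\<close>

lemma measure_box_tail_ge:
  fixes M :: "nat \<Rightarrow> real measure" and t :: "nat \<Rightarrow> nat"
  assumes M: "\<And>i. prob_space (M i)" "\<And>i. sets (M i) = sets borel"
    and J: "finite J" "\<And>j. j \<in> J \<Longrightarrow> B j \<in> sets borel" and t: "\<And>i. t i \<notin> J"
    and c: "\<And>i. 0 \<le> c i" and \<eta>: "0 < \<eta>"
    and tail: "(\<Sum>i. ennreal (c i) * (\<integral>\<^sup>+x. ennreal (x\<^sup>2) \<partial>M (t i))) \<le> ennreal (\<eta> / 2)"
  shows "(\<Prod>j\<in>J. measure (M j) (B j)) / 2 \<le> measure (PiM UNIV M)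
    {\<omega>. (\<forall>j\<in>J. \<omega> j \<in> B j) \<and> (\<Sum>i. ennreal (c i * (\<omega> (t i))\<^sup>2)) \<le> ennreal \<eta>}"
proof -
  let ?\<Omega> = "PiM UNIV M"
  interpret prob_space ?\<Omega> by (intro prob_space_PiM M)
  have s\<Omega>: "sets ?\<Omega> = sets seq_space" by (intro sets_PiM_cong refl M)
  note [measurable_cong] = s\<Omega> M(2)
  have sp: "space ?\<Omega> = UNIV" using sets_eq_imp_space_eq[OF s\<Omega>] by simp
  have B [measurable]: "B j \<in> sets borel" if "j \<in> J" for j using J that by simp
  define P where "P = (\<Prod>j\<in>J. measure (M j) (B j))"
  have P0: "0 \<le> P" unfolding P_def by (intro prod_nonneg) auto
  have P_emeasure: "(\<Prod>j\<in>J. emeasure (M j) (B j)) = ennreal P"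
    unfolding P_def
    by (simp add: prod_ennreal[symmetric] finite_measure.emeasure_eq_measure[OF prob_space.finite_measure[OF M(1)]])
  define box where "box = {\<omega>. \<forall>j\<in>J. \<omega> j \<in> B j}"
  define T where "T \<omega> = (\<Sum>i. ennreal (c i * (\<omega> (t i))\<^sup>2))" for \<omega>
  have T [measurable]: "T \<in> borel_measurable ?\<Omega>" unfolding T_def[abs_def] by measurable
  have box_ind: "indicator box \<omega> = (\<Prod>j\<in>J. indicator (B j) (\<omega> j) :: ennreal)" for \<omega>
    using J(1) by (auto simp: box_def indicator_def prod_zero_iff)
  have "(\<lambda>\<omega>. \<forall>j\<in>J. \<omega> j \<in> B j) \<in> measurable ?\<Omega> (count_space UNIV)"
    using J(1) B by (intro pred_intros_finite) measurable
  then have box [measurable]: "box \<in> sets ?\<Omega>"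
    by (simp add: box_def pred_def sp)
  have sq_meas: "(\<lambda>x. ennreal (x\<^sup>2)) \<in> borel_measurable (M k)" for k
    by (simp add: measurable_cong_sets[OF M(2) refl])
  have sq_split: "ennreal (c i * x\<^sup>2) = ennreal (c i) * ennreal (x\<^sup>2)" for i x
    using c by (simp add: ennreal_mult)
  have [measurable]: "(\<lambda>x. ennreal (c i * x\<^sup>2)) \<in> borel_measurable (M k)" for i k
    unfolding sq_split using sq_meas by (intro borel_measurable_times_ennreal) simp_all
  have term_int: "(\<integral>\<^sup>+\<omega>. indicator box \<omega> * ennreal (c i * (\<omega> (t i))\<^sup>2) \<partial>?\<Omega>)
      = ennreal P * (ennreal (c i) * (\<integral>\<^sup>+x. ennreal (x\<^sup>2) \<partial>M (t i)))" for i
  proof -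
    define f where "f j = (if j = t i then (\<lambda>x. ennreal (c i * x\<^sup>2)) else indicator (B j))" for j
    have "(\<integral>\<^sup>+\<omega>. indicator box \<omega> * ennreal (c i * (\<omega> (t i))\<^sup>2) \<partial>?\<Omega>)
      = (\<integral>\<^sup>+\<omega>. (\<Prod>j\<in>insert (t i) J. f j (\<omega> j)) \<partial>?\<Omega>)"
    proof (rule nn_integral_cong)
      fix \<omega>
      have "(\<Prod>j\<in>J. f j (\<omega> j)) = (\<Prod>j\<in>J. indicator (B j) (\<omega> j))"
        using t by (intro prod.cong) (auto simp: f_def)
      then show "indicator box \<omega> * ennreal (c i * (\<omega> (t i))\<^sup>2) = (\<Prod>j\<in>insert (t i) J. f j (\<omega> j))"
        using J(1) t by (simp add: box_ind f_def mult.commute)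
    qed
    also have "\<dots> = (\<Prod>j\<in>insert (t i) J. \<integral>\<^sup>+x. f j x \<partial>M j)"
      using J by (intro nn_integral_PiM_prod M(1)) (auto simp: f_def intro!: borel_measurable_indicator simp del: ennreal_mult)
    also have "\<dots> = (\<integral>\<^sup>+x. ennreal (c i * x\<^sup>2) \<partial>M (t i)) * (\<Prod>j\<in>J. \<integral>\<^sup>+x. f j x \<partial>M j)"
      using J(1) t by (simp add: f_def)
    also have "(\<Prod>j\<in>J. \<integral>\<^sup>+x. f j x \<partial>M j) = (\<Prod>j\<in>J. emeasure (M j) (B j))"
      using t J(2) M(2) by (intro prod.cong) (auto simp: f_def)
    also have "(\<integral>\<^sup>+x. ennreal (c i * x\<^sup>2) \<partial>M (t i)) = ennreal (c i) * (\<integral>\<^sup>+x. ennreal (x\<^sup>2) \<partial>M (t i))"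
      unfolding sq_split by (rule nn_integral_cmult[OF sq_meas])
    finally show ?thesis by (simp add: P_emeasure mult_ac)
  qed
  have "(\<integral>\<^sup>+\<omega>. indicator box \<omega> * T \<omega> \<partial>?\<Omega>) = (\<Sum>i. ennreal P * (ennreal (c i) * (\<integral>\<^sup>+x. ennreal (x\<^sup>2) \<partial>M (t i))))"
    unfolding T_def ennreal_suminf_cmult[symmetric] term_int[symmetric]
    by (rule nn_integral_suminf) measurable
  also have "\<dots> \<le> ennreal P * ennreal (\<eta> / 2)"
    unfolding ennreal_suminf_cmult by (intro mult_left_mono tail) auto
  also have "\<dots> = ennreal (P * (\<eta> / 2))" using P0 \<eta> by (simp add: ennreal_mult[symmetric])
  finally have int: "(\<integral>\<^sup>+\<omega>. indicator box \<omega> * T \<omega> \<partial>?\<Omega>) \<le> ennreal (P * (\<eta> / 2))" .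
  define bad where "bad = {\<omega> \<in> space ?\<Omega>. ennreal \<eta> \<le> indicator box \<omega> * T \<omega>}"
  have bad: "bad \<in> sets ?\<Omega>" "measure ?\<Omega> bad \<le> P * (\<eta> / 2) / \<eta>"
    unfolding bad_def
    by (rule markov_prob_bound[OF prob_space_axioms _ int \<eta>]; use P0 \<eta> in simp)+
  have "emeasure ?\<Omega> box = (\<integral>\<^sup>+\<omega>. (\<Prod>j\<in>J. indicator (B j) (\<omega> j)) \<partial>?\<Omega>)"
    by (simp add: nn_integral_indicator[symmetric] box_ind del: nn_integral_indicator)
  also have "\<dots> = (\<Prod>j\<in>J. \<integral>\<^sup>+x. indicator (B j) x \<partial>M j)"
    using J by (intro nn_integral_PiM_prod M(1)) (auto intro!: borel_measurable_indicator)
  also have "\<dots> = ennreal P"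
    unfolding P_emeasure[symmetric] using J(2) M(2) by (intro prod.cong) auto
  finally have "measure ?\<Omega> box = P" using P0 by (simp add: emeasure_eq_measure)
  moreover have "box \<subseteq> {\<omega>. (\<forall>j\<in>J. \<omega> j \<in> B j) \<and> T \<omega> \<le> ennreal \<eta>} \<union> bad"
    by (auto simp: bad_def box_def sp not_le less_imp_le)
  moreover have "{\<omega>. (\<forall>j\<in>J. \<omega> j \<in> B j) \<and> T \<omega> \<le> ennreal \<eta>} = box \<inter> {\<omega> \<in> space ?\<Omega>. T \<omega> \<le> ennreal \<eta>}"
    by (auto simp: box_def sp)
  moreover have "box \<inter> {\<omega> \<in> space ?\<Omega>. T \<omega> \<le> ennreal \<eta>} \<in> sets ?\<Omega>" by measurable
  ultimately have "P \<le> measure ?\<Omega> {\<omega>. (\<forall>j\<in>J. \<omega> j \<in> B j) \<and> T \<omega> \<le> ennreal \<eta>} + measure ?\<Omega> bad"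
    using bad(1) by (metis (no_types, lifting) finite_measure_mono measure_Un_le order_trans sets.Un)
  then show ?thesis
    using bad(2) \<eta> unfolding P_def[symmetric] T_def[symmetric] by simp
qed

text \<open>The true parameter lies strictly inside the ellipsoid, with slack \<open>\<eta>\<close>.  A quarter of \<open>\<eta>\<close> goes to each
  of three sources: the inflation of the first \<open>N\<close> terms of the truth by the factor \<open>1 + \<eta> / (4 * Q)\<close>,
  the displacement within the box, and the tail.\<close>

lemma box_tail_subset_ellipsoid:
  assumes p: "1 \<le> p" and N: "1 \<le> N"
    and \<theta>0: "\<theta>0 \<in> sobolev_ellipsoid p Q"
    and \<eta>: "0 < \<eta>" "\<eta> \<le> Q" "(\<Sum>j. real (freq (Suc j)) ^ (2 * p) * (\<theta>0 (Suc j))\<^sup>2) + \<eta> \<le> Q"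
    and \<kappa>: "0 < \<kappa>" "\<kappa> \<le> 1" "(1 + 4 * Q / \<eta>) * (4 ^ p * \<kappa>\<^sup>2) \<le> \<eta> / 4"
    and box: "\<And>j. j < N \<Longrightarrow> \<bar>\<theta> (Suc j) - \<theta>0 (Suc j)\<bar> \<le> \<kappa> / (real N ^ p * sqrt (real N))"
    and tail: "(\<Sum>i. ennreal (real (freq (Suc (i + N))) ^ (2 * p) * (\<theta> (Suc (i + N)))\<^sup>2)) \<le> ennreal (\<eta> / 4)"
  shows "\<theta> \<in> sobolev_ellipsoid p Q" and "sqdist \<theta> \<theta>0 \<le> (1 + 4 * Q) / real N ^ (2 * p)"
proof -
  let ?w = "\<lambda>j. real (freq (Suc j)) ^ (2 * p)"
  define d where "d = \<kappa> / (real N ^ p * sqrt (real N))"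
  have d2: "real N * d\<^sup>2 = \<kappa>\<^sup>2 / real N ^ (2 * p)"
    using N by (simp add: d_def power_divide power_mult_distrib power_mult[symmetric] mult.commute)
  have d0: "0 \<le> d" using \<kappa> by (simp add: d_def)
  have diff: "(\<theta> (Suc j) - \<theta>0 (Suc j))\<^sup>2 \<le> d\<^sup>2" if "j < N" for j
    using box[OF that] d0 unfolding d_def[symmetric] by (simp add: abs_le_square_iff[symmetric])
  have w_le: "?w j \<le> 4 ^ p * real N ^ (2 * p)" if "j < N" for j
    using that by (rule freq_power_le)
  have s0: "summable (\<lambda>j. ?w j * (\<theta>0 (Suc j))\<^sup>2)" using \<theta>0 by (simp add: sobolev_ellipsoid_iff[OF p])
  \<comment> \<open>The parameter of the inequality \<open>(x + y)\<^sup>2 \<le> (1 + r) * x\<^sup>2 + (1 + 1 / r) * y\<^sup>2\<close>.\<close>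
  define r where "r = \<eta> / (4 * Q)"
  have Q: "0 < Q" using \<eta> by linarith
  have r: "0 < r" "1 + 1 / r = 1 + 4 * Q / \<eta>" using \<eta> Q by (auto simp: r_def)
  have coord: "?w j * (\<theta> (Suc j))\<^sup>2 \<le> (1 + r) * (?w j * (\<theta>0 (Suc j))\<^sup>2) + (1 + 1 / r) * (4 ^ p * real N ^ (2 * p) * d\<^sup>2)"
    if j: "j < N" for j
  proof -
    let ?x = "\<theta>0 (Suc j)" and ?y = "\<theta> (Suc j) - \<theta>0 (Suc j)"
    have "2 * x * y \<le> r * x\<^sup>2 + 1 / r * y\<^sup>2" for x y
    proof -
      have "0 \<le> (r * x - y)\<^sup>2 / r" using r(1) by simp
      also have "\<dots> = r * x\<^sup>2 + 1 / r * y\<^sup>2 - 2 * x * y"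
        using r(1) by (simp add: field_simps power2_eq_square)
      finally show ?thesis by simp
    qed
    from this[of ?x ?y] have "(?x + ?y)\<^sup>2 \<le> (1 + r) * ?x\<^sup>2 + (1 + 1 / r) * ?y\<^sup>2"
      unfolding power2_sum by (simp add: distrib_right)
    then have "?w j * (\<theta> (Suc j))\<^sup>2 \<le> ?w j * ((1 + r) * ?x\<^sup>2 + (1 + 1 / r) * ?y\<^sup>2)"
      by (intro mult_left_mono) auto
    also have "\<dots> = (1 + r) * (?w j * ?x\<^sup>2) + (1 + 1 / r) * (?w j * ?y\<^sup>2)" by (simp add: algebra_simps)
    also have "\<dots> \<le> (1 + r) * (?w j * ?x\<^sup>2) + (1 + 1 / r) * (4 ^ p * real N ^ (2 * p) * d\<^sup>2)"
    proof -
      have "?w j * ?y\<^sup>2 \<le> 4 ^ p * real N ^ (2 * p) * d\<^sup>2"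
        using w_le[OF j] diff[OF j] by (rule mult_mono) auto
      moreover have "0 \<le> 1 + 1 / r" using r(1) by simp
      ultimately show ?thesis by (intro add_left_mono mult_left_mono)
    qed
    finally show ?thesis .
  qed
  let ?q = "\<Sum>j. ?w j * (\<theta>0 (Suc j))\<^sup>2"
  have q0: "(\<Sum>j<N. ?w j * (\<theta>0 (Suc j))\<^sup>2) \<le> ?q" by (intro sum_le_suminf s0) auto
  have "(\<Sum>j<N. ?w j * (\<theta> (Suc j))\<^sup>2)
      \<le> (\<Sum>j<N. (1 + r) * (?w j * (\<theta>0 (Suc j))\<^sup>2) + (1 + 1 / r) * (4 ^ p * real N ^ (2 * p) * d\<^sup>2))"
    by (intro sum_mono coord) simp
  also have "\<dots> = (1 + r) * (\<Sum>j<N. ?w j * (\<theta>0 (Suc j))\<^sup>2) + (1 + 1 / r) * (4 ^ p * real N ^ (2 * p) * (real N * d\<^sup>2))"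
    by (simp add: sum.distrib sum_distrib_left)
  finally have "(\<Sum>j<N. ?w j * (\<theta> (Suc j))\<^sup>2) \<le> (1 + r) * (\<Sum>j<N. ?w j * (\<theta>0 (Suc j))\<^sup>2)
      + (1 + 1 / r) * (4 ^ p * real N ^ (2 * p) * (real N * d\<^sup>2))" .
  moreover have "(1 + 1 / r) * (4 ^ p * real N ^ (2 * p) * (real N * d\<^sup>2)) \<le> \<eta> / 4"
    unfolding r(2) d2 using N \<kappa>(3) by simp
  moreover have "(1 + r) * (\<Sum>j<N. ?w j * (\<theta>0 (Suc j))\<^sup>2) \<le> (1 + r) * ?q"
    using r(1) q0 by (intro mult_left_mono) auto
  moreover have "(1 + r) * ?q = ?q + r * ?q" by (simp add: distrib_right)
  moreover have "r * ?q \<le> r * Q" using r(1) \<eta> by (intro mult_left_mono) auto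
  moreover have "r * Q = \<eta> / 4" using Q by (simp add: r_def)
  ultimately have head: "(\<Sum>j<N. ?w j * (\<theta> (Suc j))\<^sup>2) \<le> ?q + \<eta> / 4 + \<eta> / 4" by linarith
  let ?t = "\<lambda>i. ?w (i + N) * (\<theta> (Suc (i + N)))\<^sup>2"
  have "ennreal (\<eta> / 4) < ennreal (\<eta> / 2)" using \<eta>(1) by (simp add: ennreal_less_iff)
  with tail have "(\<Sum>i. ennreal (?t i)) < ennreal (\<eta> / 2)" by (rule le_less_trans)
  then have "summable ?t \<and> (\<Sum>i. ?t i) < \<eta> / 2"
    by (rule iffD2[OF summable_less_iff_suminf_ennreal, rotated]) simp
  then have st: "summable ?t" and tl: "(\<Sum>i. ?t i) < \<eta> / 2" by blast+
  from st have s: "summable (\<lambda>j. ?w j * (\<theta> (Suc j))\<^sup>2)"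
    by (rule iffD1[OF summable_iff_shift[of "\<lambda>j. ?w j * (\<theta> (Suc j))\<^sup>2" N]])
  have "(\<Sum>j. ?w j * (\<theta> (Suc j))\<^sup>2) < Q"
    using suminf_split_initial_segment[OF s, of N] head tl \<eta>(3) by linarith
  then show \<theta>: "\<theta> \<in> sobolev_ellipsoid p Q" using s by (simp add: sobolev_ellipsoid_iff[OF p])
  have "(\<Sum>j<N. (\<theta> (Suc j) - \<theta>0 (Suc j))\<^sup>2) \<le> (\<Sum>j<N. d\<^sup>2)" by (intro sum_mono diff) simp
  also have "\<dots> = \<kappa>\<^sup>2 / real N ^ (2 * p)" using d2 by simp
  also have "\<dots> \<le> 1 / real N ^ (2 * p)" using \<kappa> by (intro divide_right_mono power_le_one) auto
  finally show "sqdist \<theta> \<theta>0 \<le> (1 + 4 * Q) / real N ^ (2 * p)"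
    using sqdist_le_initial[OF p \<theta> \<theta>0 N] by (simp add: add_divide_distrib)
qed

text \<open>The side \<open>d\<close> of the box, relative to the standard deviation of the coordinate, is of order
  \<open>(j / N) powr (p + 1 / 2)\<close>; this is bounded below by the integer power \<open>p + 1\<close>.  In the exponent one
  factor of the inverse variance is bounded by \<open>2 * N\<close>, leaving the Sobolev weight.\<close>

lemma coordinate_mass_ge:
  fixes N j p :: nat and \<sigma> \<kappa> c :: real
  assumes j: "j < N" and \<sigma>: "0 < \<sigma>\<^sup>2" and \<kappa>: "0 < \<kappa>"
  defines "d \<equiv> \<kappa> / (real N ^ p * sqrt (real N))"
    and "v \<equiv> \<sigma>\<^sup>2 * real (freq (Suc j)) powr (- (2 * real p + 1))"
  shows "2 * \<kappa> / sqrt (2 * pi * \<sigma>\<^sup>2) * (real (Suc j) / real N) ^ (p + 1)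
      * exp (- (2 * real N / \<sigma>\<^sup>2 * (real (freq (Suc j)) ^ (2 * p) * (c\<^sup>2 + d\<^sup>2))))
    \<le> measure (centered_gaussian v) {c - d..c + d}"
proof -
  define f where "f = real (freq (Suc j))"
  have f0: "0 < f" and fj: "real (Suc j) \<le> f" and fN: "f \<le> 2 * real N"
    using freq_Suc_bounds[of j] j by (auto simp: f_def)
  have "f powr (2 * real p + 1) = f powr real (2 * p + 1)" by (simp add: add.commute)
  also have "\<dots> = f ^ (2 * p + 1)" using f0 by (rule powr_realpow)
  finally have v: "v = \<sigma>\<^sup>2 / f ^ (2 * p + 1)"
    unfolding v_def f_def[symmetric] powr_minus divide_inverse by simp
  have v0: "0 < v" using f0 \<sigma> by (simp add: v)
  have d0: "0 \<le> d" using \<kappa> by (simp add: d_def)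
  define x where "x = real (Suc j) / real N"
  have x: "0 < x" "x \<le> 1" using j by (auto simp: x_def)
  have xf: "x \<le> f / real N" unfolding x_def by (intro divide_right_mono fj) simp
  have sv: "sqrt (2 * pi * v) = sqrt (2 * pi * \<sigma>\<^sup>2) / (f ^ p * sqrt f)"
  proof -
    have "2 * pi * v = (2 * pi * \<sigma>\<^sup>2) / ((f ^ p)\<^sup>2 * f)"
      by (simp add: v power_mult[symmetric] mult.commute)
    then show ?thesis using f0 by (simp add: real_sqrt_divide real_sqrt_mult)
  qed
  have "x ^ (p + 1) \<le> x ^ p * sqrt x"
  proof -
    have "x * x \<le> x" using x by (intro mult_left_le) auto
    then have "x \<le> sqrt x" by (intro real_le_rsqrt) (simp add: power2_eq_square)
    then have "x ^ p * x \<le> x ^ p * sqrt x" using x by (intro mult_left_mono) auto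
    then show ?thesis by (simp add: mult.commute)
  qed
  also have "\<dots> \<le> (f / real N) ^ p * sqrt (f / real N)"
    using x xf by (intro mult_mono power_mono real_sqrt_le_mono) auto
  finally have "2 * \<kappa> / sqrt (2 * pi * \<sigma>\<^sup>2) * x ^ (p + 1)
      \<le> 2 * \<kappa> / sqrt (2 * pi * \<sigma>\<^sup>2) * ((f / real N) ^ p * sqrt (f / real N))"
    using \<kappa> by (intro mult_left_mono) auto
  also have "\<dots> = 2 * d / sqrt (2 * pi * v)"
    unfolding sv d_def by (simp add: real_sqrt_divide power_divide)
  finally have 1: "2 * \<kappa> / sqrt (2 * pi * \<sigma>\<^sup>2) * x ^ (p + 1) \<le> 2 * d / sqrt (2 * pi * v)" .
  have "(c\<^sup>2 + d\<^sup>2) / v = f * (f ^ (2 * p) * (c\<^sup>2 + d\<^sup>2)) / \<sigma>\<^sup>2"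
    using f0 \<sigma> by (simp add: v)
  also have "\<dots> \<le> 2 * real N * (f ^ (2 * p) * (c\<^sup>2 + d\<^sup>2)) / \<sigma>\<^sup>2"
    using fN f0 \<sigma> by (intro divide_right_mono mult_right_mono) auto
  finally have 2: "exp (- (2 * real N / \<sigma>\<^sup>2 * (f ^ (2 * p) * (c\<^sup>2 + d\<^sup>2)))) \<le> exp (- ((c\<^sup>2 + d\<^sup>2) / v))"
    by simp
  have "2 * \<kappa> / sqrt (2 * pi * \<sigma>\<^sup>2) * x ^ (p + 1) * exp (- (2 * real N / \<sigma>\<^sup>2 * (f ^ (2 * p) * (c\<^sup>2 + d\<^sup>2))))
      \<le> 2 * d / sqrt (2 * pi * v) * exp (- ((c\<^sup>2 + d\<^sup>2) / v))"
    using 1 2 d0 v0 by (intro mult_mono) auto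
  also have "\<dots> \<le> measure (centered_gaussian v) {c - d..c + d}"
    by (rule centered_gaussian_interval_ge[OF v0 d0])
  finally show ?thesis unfolding x_def f_def .
qed

text \<open>In the exponent the Sobolev weights of the truth sum to at most \<open>Q\<close> and those of the box sides to at
  most \<open>4 ^ p\<close>; the polynomial factors are handled by \<open>prod_relative_index_ge\<close>.\<close>

lemma box_mass_ge:
  fixes N p :: nat and \<sigma> \<kappa> Q :: real
  assumes N: "1 \<le> N" and \<sigma>: "0 < \<sigma>\<^sup>2" and \<kappa>: "0 < \<kappa>" "\<kappa> \<le> 1"
    and Q: "(\<Sum>j<N. real (freq (Suc j)) ^ (2 * p) * (\<theta>0 (Suc j))\<^sup>2) \<le> Q"
  defines "d \<equiv> \<kappa> / (real N ^ p * sqrt (real N))"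
  shows "exp (- (real p + 1 + 2 * (Q + 4 ^ p) / \<sigma>\<^sup>2 - ln (2 * \<kappa> / sqrt (2 * pi * \<sigma>\<^sup>2))) * real N)
    \<le> (\<Prod>j<N. measure (centered_gaussian (\<sigma>\<^sup>2 * real (freq (Suc j)) powr (- (2 * real p + 1))))
          {\<theta>0 (Suc j) - d..\<theta>0 (Suc j) + d})"
proof -
  define k where "k = 2 * \<kappa> / sqrt (2 * pi * \<sigma>\<^sup>2)"
  have k0: "0 < k" using \<kappa> \<sigma> by (simp add: k_def)
  let ?w = "\<lambda>j. real (freq (Suc j)) ^ (2 * p)"
  have d2: "real N * d\<^sup>2 = \<kappa>\<^sup>2 / real N ^ (2 * p)"
    using N by (simp add: d_def power_divide power_mult_distrib power_mult[symmetric] mult.commute)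
  have "(\<Sum>j<N. ?w j * d\<^sup>2) \<le> (\<Sum>j<N. 4 ^ p * real N ^ (2 * p) * d\<^sup>2)"
    by (intro sum_mono mult_right_mono freq_power_le) auto
  also have "\<dots> = 4 ^ p * real N ^ (2 * p) * (real N * d\<^sup>2)" by simp
  also have "\<dots> = 4 ^ p * \<kappa>\<^sup>2" using N by (simp add: d2)
  also have "\<dots> \<le> 4 ^ p * 1" using \<kappa> by (intro mult_left_mono power_le_one) auto
  finally have "(\<Sum>j<N. ?w j * d\<^sup>2) \<le> 4 ^ p" by simp
  then have "(\<Sum>j<N. ?w j * ((\<theta>0 (Suc j))\<^sup>2 + d\<^sup>2)) \<le> Q + 4 ^ p"
    using Q by (simp add: distrib_left sum.distrib)
  then have "2 * real N / \<sigma>\<^sup>2 * (\<Sum>j<N. ?w j * ((\<theta>0 (Suc j))\<^sup>2 + d\<^sup>2)) \<le> 2 * real N / \<sigma>\<^sup>2 * (Q + 4 ^ p)"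
    using \<sigma> by (intro mult_left_mono) auto
  then have e: "exp (- (2 * real N / \<sigma>\<^sup>2 * (Q + 4 ^ p)))
      \<le> exp (- (2 * real N / \<sigma>\<^sup>2 * (\<Sum>j<N. ?w j * ((\<theta>0 (Suc j))\<^sup>2 + d\<^sup>2))))" by simp
  have "exp (- (real p + 1 + 2 * (Q + 4 ^ p) / \<sigma>\<^sup>2 - ln k) * real N)
      = exp (real N * ln k) * exp (- real N * real (p + 1)) * exp (- (2 * real N / \<sigma>\<^sup>2 * (Q + 4 ^ p)))"
    unfolding exp_add[symmetric] by (simp add: algebra_simps)
  also have "exp (real N * ln k) = k ^ N" using k0 by (simp add: exp_of_nat_mult)
  also have "k ^ N * exp (- real N * real (p + 1)) * exp (- (2 * real N / \<sigma>\<^sup>2 * (Q + 4 ^ p)))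
     \<le> k ^ N * (\<Prod>j<N. (real (Suc j) / real N) ^ (p + 1))
       * exp (- (2 * real N / \<sigma>\<^sup>2 * (\<Sum>j<N. ?w j * ((\<theta>0 (Suc j))\<^sup>2 + d\<^sup>2))))"
    using k0 e prod_relative_index_ge[of N "p + 1"]
    by (intro mult_mono mult_nonneg_nonneg prod_nonneg) auto
  also have "\<dots> = (\<Prod>j<N. k * (real (Suc j) / real N) ^ (p + 1)
      * exp (- (2 * real N / \<sigma>\<^sup>2 * (?w j * ((\<theta>0 (Suc j))\<^sup>2 + d\<^sup>2)))))"
    by (simp only: prod.distrib prod_constant card_lessThan exp_sum[symmetric] finite_lessThan
        sum_distrib_left sum_negf)
  also have "\<dots> \<le> (\<Prod>j<N. measure (centered_gaussian (\<sigma>\<^sup>2 * real (freq (Suc j)) powr (- (2 * real p + 1))))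
          {\<theta>0 (Suc j) - d..\<theta>0 (Suc j) + d})"
    unfolding k_def d_def using k0 coordinate_mass_ge[OF _ \<sigma> \<kappa>(1), of _ N p]
    by (intro prod_mono conjI mult_nonneg_nonneg) (auto simp: k_def)
  finally show ?thesis unfolding k_def .
qed

text \<open>The contribution of a coordinate beyond the cutoff to the expected Sobolev norm.\<close>

lemma tail_variance_le:
  assumes p: "1 \<le> p" and \<alpha>: "1 / 2 < \<alpha>"
  shows "real (freq (Suc j)) ^ (2 * p) * (\<sigma>\<^sup>2 * real (freq (Suc j)) powr (- 2 * (2 * real p + \<alpha>)))
    \<le> \<sigma>\<^sup>2 * inverse (real (Suc j) ^ 2)"
proof -
  define f where "f = real (freq (Suc j))"
  have f1: "1 \<le> f" and fj: "real (Suc j) \<le> f"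
    using freq_Suc_bounds[of j] by (auto simp: f_def)
  have "f ^ (2 * p) * f powr (- 2 * (2 * real p + \<alpha>)) = f powr real (2 * p) * f powr (- 2 * (2 * real p + \<alpha>))"
    using f1 by (simp only: powr_realpow)
  also have "\<dots> = f powr (real (2 * p) + - 2 * (2 * real p + \<alpha>))" by (rule powr_add[symmetric])
  also have "\<dots> \<le> f powr (- real 2)" using f1 p \<alpha> by (intro powr_mono) auto
  also have "\<dots> = inverse (f ^ 2)" using f1 by (simp only: powr_minus powr_realpow)
  also have "\<dots> \<le> inverse (real (Suc j) ^ 2)"
    by (intro le_imp_inverse_le power_mono fj) auto
  finally have "\<sigma>\<^sup>2 * (f ^ (2 * p) * f powr (- 2 * (2 * real p + \<alpha>))) \<le> \<sigma>\<^sup>2 * inverse (real (Suc j) ^ 2)"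
    by (rule mult_left_mono) simp
  then show ?thesis unfolding f_def by (simp only: mult.left_commute)
qed

lemma
  assumes "\<sigma>\<^sup>2 > 0"
  shows prob_space_coord_law: "prob_space (coord_law p Q \<alpha> \<sigma> n j)"
    and sets_coord_law: "sets (coord_law p Q \<alpha> \<sigma> n j) = sets borel"
proof -
  have "0 < freq j" if "j \<noteq> 0" using that by (auto simp: freq_def)
  then show "prob_space (coord_law p Q \<alpha> \<sigma> n j)"
    unfolding coord_law_def using assms
    by (auto intro!: prob_space_centered_gaussian prob_space_return)
  show "sets (coord_law p Q \<alpha> \<sigma> n j) = sets borel" by (simp add: coord_law_def)
qed

text \<open>A box around the truth with side \<open>\<kappa> / (N ^ p * sqrt N)\<close>, intersected with the event that the
  coordinates beyond the cutoff \<open>N\<close> have a small Sobolev norm, lies in the neighbourhood; conditioning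
  on the ellipsoid only increases its mass.  The cutoff has to be large for the tail to be likely small,
  and its positivity absorbs the factor \<open>1 / 2\<close> into the exponential.\<close>

lemma prior_mass_ge:
  assumes p: "1 \<le> p" and Q: "0 < Q" and \<alpha>: "1 / 2 < \<alpha>" and \<sigma>: "0 < \<sigma>\<^sup>2"
    and \<theta>0: "\<theta>0 \<in> sobolev_ellipsoid p Q"
  shows "\<exists>c N0. \<forall>n. N0 \<le> cutoff p Q n \<longrightarrow>
    prob_space (prior p Q \<alpha> \<sigma> n) \<and>
    exp (- c * real (cutoff p Q n)) \<le> measure (prior p Q \<alpha> \<sigma> n)
      {\<theta> \<in> sobolev_ellipsoid p Q. sqdist \<theta> \<theta>0 \<le> (1 + 4 * Q) / real (cutoff p Q n) ^ (2 * p)}"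
proof -
  let ?w = "\<lambda>j. real (freq (Suc j)) ^ (2 * p)"
  let ?q = "\<Sum>j. ?w j * (\<theta>0 (Suc j))\<^sup>2"
  have s0: "summable (\<lambda>j. ?w j * (\<theta>0 (Suc j))\<^sup>2)" and qQ: "?q < Q"
    using \<theta>0 by (auto simp: sobolev_ellipsoid_iff[OF p])
  have q0: "0 \<le> ?q" by (intro suminf_nonneg s0) simp
  define \<eta> where "\<eta> = Q - ?q"
  have \<eta>: "0 < \<eta>" "\<eta> \<le> Q" "?q + \<eta> \<le> Q" using qQ q0 by (auto simp: \<eta>_def)
  \<comment> \<open>The largest value of \<open>\<kappa>\<^sup>2\<close> that \<open>box_tail_subset_ellipsoid\<close> admits.\<close>
  define m where "m = min 1 (\<eta> / 4 / ((1 + 4 * Q / \<eta>) * 4 ^ p))"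
  have D: "0 < (1 + 4 * Q / \<eta>) * 4 ^ p" using \<eta> Q by (intro mult_pos_pos add_pos_pos) auto
  have m: "0 < m" "m \<le> 1" using D \<eta> by (auto simp: m_def)
  have "m \<le> \<eta> / 4 / ((1 + 4 * Q / \<eta>) * 4 ^ p)" by (simp add: m_def)
  then have mD: "(1 + 4 * Q / \<eta>) * (4 ^ p * m) \<le> \<eta> / 4"
    using D by (simp add: pos_le_divide_eq mult_ac)
  define \<kappa> where "\<kappa> = sqrt m"
  have \<kappa>: "0 < \<kappa>" "\<kappa> \<le> 1" "(1 + 4 * Q / \<eta>) * (4 ^ p * \<kappa>\<^sup>2) \<le> \<eta> / 4"
    using m mD by (auto simp: \<kappa>_def)
  let ?v = "\<lambda>k. \<sigma>\<^sup>2 * inverse (real (Suc k) ^ 2)"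
  have sv: "summable ?v"
    by (intro summable_mult, subst summable_Suc_iff[of "\<lambda>j. inverse (real j ^ 2)"])
      (rule inverse_power_summable, simp)
  have "(\<lambda>N. \<Sum>k. ?v (k + N)) \<longlonglongrightarrow> 0" by (rule suminf_exist_split2[OF sv])
  then have "eventually (\<lambda>N. (\<Sum>k. ?v (k + N)) < \<eta> / 4 / 2) sequentially"
    using \<eta> by (intro order_tendstoD) auto
  then obtain N1 where N1: "\<And>N. N1 \<le> N \<Longrightarrow> (\<Sum>k. ?v (k + N)) < \<eta> / 4 / 2"
    by (auto simp: eventually_sequentially)
  define c where "c = real p + 1 + 2 * (Q + 4 ^ p) / \<sigma>\<^sup>2 - ln (2 * \<kappa> / sqrt (2 * pi * \<sigma>\<^sup>2))"
  show ?thesis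
  proof (intro exI[of _ "c + 1"] exI[of _ "max 1 N1"] allI impI)
    fix n assume n: "max 1 N1 \<le> cutoff p Q n"
    define N where "N = cutoff p Q n"
    have N: "1 \<le> N" "N1 \<le> N" using n by (auto simp: N_def)
    define M where "M = coord_law p Q \<alpha> \<sigma> n"
    have M: "prob_space (M j)" "sets (M j) = sets borel" for j
      using prob_space_coord_law[OF \<sigma>] sets_coord_law[OF \<sigma>] by (auto simp: M_def)
    let ?G = "PiM UNIV M"
    interpret prob_space ?G by (intro prob_space_PiM M)
    have sG: "sets ?G = sets seq_space" by (intro sets_PiM_cong refl M)
    have G: "gauss_product p Q \<alpha> \<sigma> n = ?G" by (simp add: gauss_product_def M_def)
    define d where "d = \<kappa> / (real N ^ p * sqrt (real N))"
    define B where "B j = {\<theta>0 j - d..\<theta>0 j + d}" for j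
    define T where "T = {\<omega>. (\<forall>j\<in>Suc ` {..<N}. \<omega> j \<in> B j) \<and>
      (\<Sum>i. ennreal (?w (i + N) * (\<omega> (Suc (i + N)))\<^sup>2)) \<le> ennreal (\<eta> / 4)}"
    define S where "S = {\<theta> \<in> sobolev_ellipsoid p Q. sqdist \<theta> \<theta>0 \<le> (1 + 4 * Q) / real N ^ (2 * p)}"
    have tail: "(\<Sum>i. ennreal (?w (i + N)) * (\<integral>\<^sup>+x. ennreal (x\<^sup>2) \<partial>M (Suc (i + N)))) \<le> ennreal (\<eta> / 4 / 2)"
    proof -
      have "ennreal (?w (i + N)) * (\<integral>\<^sup>+x. ennreal (x\<^sup>2) \<partial>M (Suc (i + N))) \<le> ennreal (?v (i + N))" for i
      proof -
        let ?s = "\<sigma>\<^sup>2 * real (freq (Suc (i + N))) powr (- 2 * (2 * real p + \<alpha>))"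
        have "0 < real (freq (Suc (i + N)))" using freq_Suc_bounds(1)[of "i + N"] by simp
        then have s: "0 < ?s" using \<sigma> by simp
        have "M (Suc (i + N)) = centered_gaussian ?s"
          by (simp add: M_def coord_law_def N_def[symmetric])
        then have "ennreal (?w (i + N)) * (\<integral>\<^sup>+x. ennreal (x\<^sup>2) \<partial>M (Suc (i + N))) = ennreal (?w (i + N) * ?s)"
          using s by (simp only: centered_gaussian_second_moment) (rule ennreal_mult[symmetric], simp, simp)
        also have "\<dots> \<le> ennreal (?v (i + N))" by (intro ennreal_leI tail_variance_le p \<alpha>)
        finally show ?thesis .
      qed
      then have "(\<Sum>i. ennreal (?w (i + N)) * (\<integral>\<^sup>+x. ennreal (x\<^sup>2) \<partial>M (Suc (i + N)))) \<le> (\<Sum>i. ennreal (?v (i + N)))"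
        by (intro suminf_le) auto
      also have "\<dots> = ennreal (\<Sum>i. ?v (i + N))"
        using sv by (intro suminf_ennreal2) (simp_all only: summable_iff_shift[of ?v N], simp)
      also have "\<dots> \<le> ennreal (\<eta> / 4 / 2)" using N1[OF N(2)] by (intro ennreal_leI) simp
      finally show ?thesis .
    qed
    have "(\<Prod>j\<in>Suc ` {..<N}. measure (M j) (B j)) / 2 \<le> measure ?G T"
      unfolding T_def using \<eta>(1)
      by (intro measure_box_tail_ge[where t = "\<lambda>i. Suc (i + N)" and c = "\<lambda>i. ?w (i + N)"] M tail)
        (auto simp: B_def)
    moreover have "(\<Prod>j\<in>Suc ` {..<N}. measure (M j) (B j)) = (\<Prod>j<N. measure (M (Suc j)) (B (Suc j)))"
      by (subst prod.reindex) auto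
    moreover have "\<dots> = (\<Prod>j<N. measure (centered_gaussian (\<sigma>\<^sup>2 * real (freq (Suc j)) powr (- (2 * real p + 1))))
          {\<theta>0 (Suc j) - d..\<theta>0 (Suc j) + d})"
      by (intro prod.cong) (auto simp: M_def coord_law_def N_def[symmetric] B_def)
    moreover have "exp (- c * real N) \<le> \<dots>"
    proof -
      have "(\<Sum>j<N. ?w j * (\<theta>0 (Suc j))\<^sup>2) \<le> ?q" by (intro sum_le_suminf s0) auto
      then have "(\<Sum>j<N. ?w j * (\<theta>0 (Suc j))\<^sup>2) \<le> Q" using qQ by linarith
      then show ?thesis unfolding c_def d_def by (rule box_mass_ge[OF N(1) \<sigma> \<kappa>(1,2)])
    qed
    ultimately have T_ge: "exp (- c * real N) / 2 \<le> measure ?G T" by linarith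
    have E: "sobolev_ellipsoid p Q \<in> sets ?G" using sobolev_ellipsoid_measurable[OF p] sG by simp
    have "{\<theta> \<in> space seq_space. \<theta> \<in> sobolev_ellipsoid p Q \<and> sqdist \<theta> \<theta>0 \<le> (1 + 4 * Q) / real N ^ (2 * p)} \<in> sets seq_space"
      using sobolev_ellipsoid_measurable[OF p, of Q] by measurable
    then have S: "S \<in> sets ?G" by (simp add: S_def sG)
    have "T \<subseteq> S"
    proof
      fix \<theta> assume T: "\<theta> \<in> T"
      have box: "\<bar>\<theta> (Suc j) - \<theta>0 (Suc j)\<bar> \<le> \<kappa> / (real N ^ p * sqrt (real N))" if "j < N" for j
        unfolding d_def[symmetric] using T that by (force simp: T_def B_def)
      have "(\<Sum>i. ennreal (?w (i + N) * (\<theta> (Suc (i + N)))\<^sup>2)) \<le> ennreal (\<eta> / 4)"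
        using T by (simp add: T_def)
      from box_tail_subset_ellipsoid[OF p N(1) \<theta>0 \<eta> \<kappa> box this]
      show "\<theta> \<in> S" by (simp add: S_def)
    qed
    then have "measure ?G T \<le> measure ?G S" using S by (intro finite_measure_mono)
    moreover have "exp (- real N) \<le> 1 / 2"
    proof -
      have "2 \<le> exp (real N)" using exp_ge_add_one_self[of "real N"] N(1) by linarith
      then show ?thesis by (simp add: exp_minus field_simps)
    qed
    then have "exp (- c * real N) * exp (- real N) \<le> exp (- c * real N) * (1 / 2)"
      by (intro mult_left_mono) auto
    moreover have "exp (- c * real N) * exp (- real N) = exp (- (c + 1) * real N)"
      unfolding exp_add[symmetric] by (simp add: algebra_simps)
    ultimately have S_ge: "exp (- (c + 1) * real N) \<le> measure ?G S" using T_ge by linarith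
    have SE: "S \<subseteq> sobolev_ellipsoid p Q" by (auto simp: S_def)
    have "0 < measure ?G S" using S_ge exp_gt_zero[of "- (c + 1) * real N"] by linarith
    moreover have "measure ?G S \<le> measure ?G (sobolev_ellipsoid p Q)" by (rule finite_measure_mono[OF SE E])
    ultimately have E0: "0 < measure ?G (sobolev_ellipsoid p Q)" by linarith
    then have ne: "emeasure ?G (sobolev_ellipsoid p Q) \<noteq> 0" by (simp add: emeasure_eq_measure)
    have pr: "prob_space (prior p Q \<alpha> \<sigma> n)"
      unfolding prior_def G by (rule prob_space_uniform_measure[OF ne]) simp
    have "measure (prior p Q \<alpha> \<sigma> n) S = measure ?G S / measure ?G (sobolev_ellipsoid p Q)"
      unfolding prior_def G using measure_uniform_measure[OF ne _ S] SE by (simp add: Int_absorb1)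
    moreover have "measure ?G S * measure ?G (sobolev_ellipsoid p Q) \<le> measure ?G S"
      by (intro mult_left_le) auto
    then have "measure ?G S \<le> measure ?G S / measure ?G (sobolev_ellipsoid p Q)"
      using E0 by (simp add: pos_le_divide_eq)
    ultimately show "prob_space (prior p Q \<alpha> \<sigma> n) \<and>
      exp (- (c + 1) * real (cutoff p Q n)) \<le> measure (prior p Q \<alpha> \<sigma> n)
      {\<theta> \<in> sobolev_ellipsoid p Q. sqdist \<theta> \<theta>0 \<le> (1 + 4 * Q) / real (cutoff p Q n) ^ (2 * p)}"
      using pr S_ge unfolding S_def N_def by linarith
  qed
qed

section \<open>Sample size, rate and cutoff\<close>

text \<open>The common order of \<open>n\<close> times the squared rate, of the cutoff, of the logarithm of the covering number
  and of the negative logarithm of the prior mass near the truth.\<close>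

definition effective_size :: "nat \<Rightarrow> nat \<Rightarrow> real" where
  "effective_size p n = real n powr (1 / (2 * real p + 1))"

lemma effective_size_ge_1: "1 \<le> n \<Longrightarrow> 1 \<le> effective_size p n"
  unfolding effective_size_def by (intro ge_one_powr_ge_zero) auto

lemma effective_size_power:
  assumes "1 \<le> n" shows "effective_size p n ^ (2 * p + 1) = real n"
proof -
  have "effective_size p n ^ (2 * p + 1) = effective_size p n powr real (2 * p + 1)"
    using effective_size_ge_1[OF assms, of p] by (intro powr_realpow[symmetric]) linarith
  also have "\<dots> = real n powr (1 / (2 * real p + 1) * real (2 * p + 1))"
    unfolding effective_size_def by (rule powr_powr)
  also have "1 / (2 * real p + 1) * real (2 * p + 1) = 1"
    by (simp add: add.commute add_nonneg_eq_0_iff)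
  finally show ?thesis by simp
qed

lemma rate_eq: "1 \<le> n \<Longrightarrow> rate p n = 1 / effective_size p n ^ p"
  unfolding effective_size_def rate_def powr_minus divide_inverse
  by (simp add: powr_powr flip: powr_realpow) (simp add: mult.commute divide_inverse)

lemma rate_sq: "1 \<le> n \<Longrightarrow> (rate p n)\<^sup>2 = 1 / effective_size p n ^ (2 * p)"
  by (simp add: rate_eq power_divide power_mult[symmetric] mult.commute)

lemma rate_sq_mult:
  assumes "1 \<le> n" shows "real n * (rate p n)\<^sup>2 = effective_size p n"
proof -
  have "0 < effective_size p n" using effective_size_ge_1[OF assms, of p] by linarith
  then show ?thesis
    unfolding rate_sq[OF assms] effective_size_power[OF assms, of p, symmetric] by simp
qed

definition cutoff_const :: "nat \<Rightarrow> real \<Rightarrow> real" where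
  "cutoff_const p Q = (8 * Q / const_B1_sq p Q) powr (1 / (2 * real p))"

lemma cutoff_const_pos: "0 < Q \<Longrightarrow> 0 < cutoff_const p Q"
  by (simp add: cutoff_const_def const_B1_sq_def)

lemma cutoff_bounds:
  assumes p: "1 \<le> p" and Q: "0 < Q" and n: "1 \<le> n"
  shows "cutoff_const p Q * effective_size p n \<le> real (cutoff p Q n)"
    and "real (cutoff p Q n) \<le> (cutoff_const p Q + 1) * effective_size p n"
proof -
  let ?e = "effective_size p n"
  have e: "1 \<le> ?e" by (rule effective_size_ge_1[OF n])
  have "(8 * Q / (const_B1_sq p Q * (rate p n)\<^sup>2)) = (8 * Q / const_B1_sq p Q) * ?e powr real (2 * p)"
    using e by (simp only: rate_sq[OF n] powr_realpow) simp
  then have "(8 * Q / (const_B1_sq p Q * (rate p n)\<^sup>2)) powr (1 / (2 * real p))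
      = cutoff_const p Q * (?e powr real (2 * p)) powr (1 / (2 * real p))"
    by (simp only: cutoff_const_def powr_mult[of "8 * Q / const_B1_sq p Q"])
  also have "(?e powr real (2 * p)) powr (1 / (2 * real p)) = ?e"
    using e p by (simp add: powr_powr)
  finally have c: "cutoff p Q n = nat \<lceil>cutoff_const p Q * ?e\<rceil>"
    by (simp add: cutoff_def)
  have "0 \<le> cutoff_const p Q * ?e" using e cutoff_const_pos[OF Q, of p] by simp
  then have "real (cutoff p Q n) = of_int \<lceil>cutoff_const p Q * ?e\<rceil>" unfolding c by simp
  then show "cutoff_const p Q * ?e \<le> real (cutoff p Q n)"
    and "real (cutoff p Q n) \<le> (cutoff_const p Q + 1) * ?e"
    using e by (simp_all add: distrib_right) linarith
qed

text \<open>The power \<open>2 * (2 * p + 1)\<close> of the effective size is \<open>n\<^sup>2\<close>, and the exponential beats it.\<close>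

lemma summable_exp_effective_size: "summable (\<lambda>n. exp (- effective_size p n))"
proof (rule summable_comparison_test'[of "\<lambda>n. fact (2 * (2 * p + 1)) * inverse (real n ^ 2)" 1])
  show "summable (\<lambda>n. fact (2 * (2 * p + 1)) * inverse (real n ^ 2))"
    by (intro summable_mult inverse_power_summable) simp
  fix n :: nat assume n: "1 \<le> n"
  let ?e = "effective_size p n" and ?k = "2 * (2 * p + 1)"
  have "?e ^ ?k = (?e ^ (2 * p + 1)) ^ 2" by (simp only: power_mult[symmetric] mult.commute)
  then have "real n ^ 2 \<le> exp ?e * fact ?k"
    using power_le_exp_fact[of ?e ?k] effective_size_ge_1[OF n, of p] effective_size_power[OF n, of p] by simp
  then have "exp (- ?e) \<le> fact ?k / real n ^ 2"
    using n by (simp add: exp_minus field_simps)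
  then show "norm (exp (- ?e)) \<le> fact ?k * inverse (real n ^ 2)" by (simp add: divide_inverse)
qed

lemma posterior_nonneg: "0 \<le> posterior p Q \<alpha> \<sigma> n X C"
proof -
  have "0 \<le> likelihood n X \<theta>" for \<theta>
    unfolding likelihood_def by (intro prod_nonneg) (simp add: dens_nonneg)
  then show ?thesis
    unfolding posterior_def set_lebesgue_integral_def
    by (intro divide_nonneg_nonneg Bochner_Integration.integral_nonneg) auto
qed

section \<open>Posterior contraction\<close>

text \<open>All exponents are multiples of the effective size \<open>e\<close>.  The denominator costs
  \<open>C1\<close> (prior mass) and \<open>K\<close> (chi-square divergence of the neighbourhood), the union over cells costs \<open>C2\<close>, the radius of the
  cells another \<open>K\<close>, and the separation contributes \<open>- M\<^sup>2 / 4\<close>.  The thresholds \<open>t\<close> and \<open>u\<close> leave one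
  spare unit in each of the three error terms and in the bound of the posterior, which yields the condition
  \<open>M\<^sup>2 \<ge> 4 * (C2 + 2 * K + C1 + 3)\<close>.\<close>

lemma posterior_contraction_step:
  assumes p: "1 \<le> p" and Q: "0 < Q" and \<alpha>: "1 / 2 < \<alpha>" and \<sigma>: "0 < \<sigma>\<^sup>2"
    and \<theta>0: "\<theta>0 \<in> sobolev_ellipsoid p Q"
  shows "\<exists>M0>0. \<exists>n0. \<forall>M\<ge>M0. \<forall>n\<ge>n0. \<exists>G\<in>sets (sample_space \<theta>0).
    measure (sample_space \<theta>0) G \<le> 3 * exp (- effective_size p n) \<and>
    (\<forall>X\<in>space (sample_space \<theta>0) - G.
      posterior p Q \<alpha> \<sigma> n X {model_measure \<theta> | \<theta>. \<theta> \<in> sobolev_ellipsoid p Q \<and> hellinger \<theta>0 \<theta> > M * rate p n}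
        \<le> exp (- effective_size p n))"
proof -
  obtain c N0 where prior: "\<And>n. N0 \<le> cutoff p Q n \<Longrightarrow>
    prob_space (prior p Q \<alpha> \<sigma> n) \<and>
    exp (- c * real (cutoff p Q n)) \<le> measure (prior p Q \<alpha> \<sigma> n)
      {\<theta> \<in> sobolev_ellipsoid p Q. sqdist \<theta> \<theta>0 \<le> (1 + 4 * Q) / real (cutoff p Q n) ^ (2 * p)}"
    using prior_mass_ge[OF p Q \<alpha> \<sigma> \<theta>0] by blast
  let ?E = "sobolev_ellipsoid p Q"
  define b where "b = Q + const_A p"
  have E_ball: "?E \<subseteq> coeff_ball b"
    unfolding b_def by (rule sobolev_ellipsoid_subset_coeff_ball[OF p])
  define a where "a = cutoff_const p Q"
  have a: "0 < a" unfolding a_def by (rule cutoff_const_pos[OF Q])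
  define K where "K = chi_const b * ((1 + 4 * Q) / a ^ (2 * p))"
  have K: "0 \<le> K" using Q a by (simp add: K_def chi_const_def)
  define C1 where "C1 = \<bar>c\<bar> * (a + 1)"
  define C2 where "C2 = (Q + 4 + real p) * (a + 1)"
  have C1: "0 \<le> C1" and C2: "0 \<le> C2" using a Q by (auto simp: C1_def C2_def)
  define M0 where "M0 = 4 * (C2 + 2 * K + C1 + 3)"
  have M0: "1 \<le> M0" using K C1 C2 by (simp add: M0_def)
  \<comment> \<open>From \<open>n0\<close> on, the cutoff is at least \<open>N0\<close> and at least \<open>1\<close>.\<close>
  define n0 where "n0 = max 1 (nat \<lceil>(max 1 (real N0) / a) ^ (2 * p + 1)\<rceil>)"
  show ?thesis
  proof (intro exI[of _ M0] conjI exI[of _ n0] allI impI)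
    show "0 < M0" using M0 by simp
    fix M n assume M: "M0 \<le> M" and nn: "n0 \<le> n"
    define e where "e = effective_size p n"
    define N where "N = cutoff p Q n"
    have n: "1 \<le> n" using nn by (simp add: n0_def)
    have e: "1 \<le> e" unfolding e_def by (rule effective_size_ge_1[OF n])
    have N_ge: "a * e \<le> real N" and N_le: "real N \<le> (a + 1) * e"
      unfolding N_def a_def e_def by (rule cutoff_bounds[OF p Q n])+
    have "max 1 (real N0) \<le> real N"
    proof -
      have "(max 1 (real N0) / a) ^ (2 * p + 1) \<le> real n" using nn unfolding n0_def by linarith
      also have "real n = e ^ (2 * p + 1)" unfolding e_def by (rule effective_size_power[OF n, symmetric])
      finally have "(max 1 (real N0) / a) ^ Suc (2 * p) \<le> e ^ Suc (2 * p)" by (simp only: Suc_eq_plus1)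
      then have "max 1 (real N0) / a \<le> e" by (rule power_le_imp_le_base) (use e in simp)
      then have "max 1 (real N0) \<le> a * e" using a by (simp add: field_simps)
      then show ?thesis using N_ge by linarith
    qed
    then have N: "1 \<le> N" "N0 \<le> N" by auto
    define D where "D = (1 + 4 * Q) / real N ^ (2 * p)"
    have nD: "real n * (chi_const b * D) \<le> K * e"
    proof -
      have "(a * e) ^ (2 * p) \<le> real N ^ (2 * p)" using N_ge a e by (intro power_mono) auto
      then have "D \<le> (1 + 4 * Q) / (a * e) ^ (2 * p)"
        unfolding D_def using a e Q N(1) by (intro divide_left_mono mult_pos_pos) auto
      also have "\<dots> = (1 + 4 * Q) / a ^ (2 * p) * (rate p n)\<^sup>2"
        by (simp add: rate_sq[OF n] e_def power_mult_distrib)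
      finally have "chi_const b * D \<le> K * (rate p n)\<^sup>2"
        unfolding K_def mult.assoc by (intro mult_left_mono) (auto simp: chi_const_def)
      then have "real n * (chi_const b * D) \<le> real n * (K * (rate p n)\<^sup>2)"
        by (rule mult_left_mono) simp
      also have "\<dots> = K * (real n * (rate p n)\<^sup>2)" by (rule mult.left_commute)
      also have "\<dots> = K * e" by (simp only: rate_sq_mult[OF n] e_def)
      finally show ?thesis .
    qed
    let ?V = "{\<theta> \<in> ?E. model_measure \<theta> \<in> {model_measure \<theta> | \<theta>. \<theta> \<in> ?E \<and> hellinger \<theta>0 \<theta> > M * rate p n}}"
    let ?W = "{\<theta> \<in> ?E. hellinger \<theta>0 \<theta> > M * rate p n}"
    have VW: "?V \<subseteq> ?W"
    proof
      fix \<theta> assume \<theta>: "\<theta> \<in> ?V"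
      then obtain \<theta>' where \<theta>': "model_measure \<theta> = model_measure \<theta>'" "hellinger \<theta>0 \<theta>' > M * rate p n"
        by blast
      from hellinger_cong_model_measure[OF \<theta>'(1), of \<theta>0] show "\<theta> \<in> ?W"
        using \<theta> \<theta>'(2) by simp
    qed
    have "?W \<subseteq> ?E" by auto
    from sobolev_ellipsoid_cover[OF p Q N(1) this]
    obtain C where C: "finite C" "C \<subseteq> ?W" "real (card C) \<le> exp ((Q + 4 + real p) * real N)"
      "\<forall>\<theta>\<in>?W. \<exists>\<eta>\<in>C. sqdist \<theta> \<eta> \<le> D"
      unfolding D_def by blast
    have card: "real (card C) \<le> exp (C2 * e)"
    proof -
      have "(Q + 4 + real p) * real N \<le> (Q + 4 + real p) * ((a + 1) * e)"
        using Q N_le by (intro mult_left_mono) auto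
      then have "exp ((Q + 4 + real p) * real N) \<le> exp (C2 * e)" by (simp add: C2_def mult.assoc)
      then show ?thesis using C(3) by linarith
    qed
    let ?S = "{\<theta> \<in> ?E. sqdist \<theta> \<theta>0 \<le> D}"
    define m where "m = exp (- C1 * e)"
    have pr: "prob_space (prior p Q \<alpha> \<sigma> n)"
      and S_ge: "exp (- c * real N) \<le> measure (prior p Q \<alpha> \<sigma> n) ?S"
      using prior[of n] N(2) by (auto simp: N_def D_def)
    have "m \<le> exp (- c * real N)"
    proof -
      have "c * real N \<le> \<bar>c\<bar> * ((a + 1) * e)" using N_le by (intro mult_mono) auto
      then show ?thesis by (simp add: m_def C1_def mult.assoc)
    qed
    then have m: "m \<le> measure (prior p Q \<alpha> \<sigma> n) ?S" by (rule order_trans[OF _ S_ge])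
    have m0: "0 < m" by (simp add: m_def)
    have sets_prior: "sets (prior p Q \<alpha> \<sigma> n) = sets seq_space"
      unfolding prior_def gauss_product_def sets_uniform_measure
      by (intro sets_PiM_cong refl sets_coord_law \<sigma>)
    have S_sets: "?S \<in> sets seq_space"
    proof -
      have "{\<theta> \<in> space seq_space. \<theta> \<in> ?E \<and> sqdist \<theta> \<theta>0 \<le> D} \<in> sets seq_space"
        using sobolev_ellipsoid_measurable[OF p, of Q] by measurable
      then show ?thesis by simp
    qed
    have \<theta>0b: "\<theta>0 \<in> coeff_ball b" using \<theta>0 E_ball by auto
    have rate0: "0 \<le> rate p n" by (simp add: rate_def)
    define H where "H = (M * rate p n)\<^sup>2"
    have H: "H \<le> (hellinger \<theta>0 \<eta>)\<^sup>2" if "\<eta> \<in> C" for \<eta>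
    proof -
      have "M * rate p n \<le> hellinger \<theta>0 \<eta>" using C(2) that by auto
      moreover have "0 \<le> M * rate p n" using M M0 rate0 by simp
      ultimately show ?thesis unfolding H_def by (rule power_mono)
    qed
    have nH: "real n * H = M\<^sup>2 * e"
    proof -
      have "real n * H = M\<^sup>2 * (real n * (rate p n)\<^sup>2)" by (simp add: H_def power_mult_distrib)
      then show ?thesis by (simp only: rate_sq_mult[OF n] e_def)
    qed
    have M2: "4 * (C2 + 2 * K + C1 + 3) \<le> M\<^sup>2"
    proof -
      have "M * 1 \<le> M * M" using M M0 by (intro mult_left_mono) auto
      then show ?thesis using M by (simp add: M0_def power2_eq_square)
    qed
    then have M2e: "4 * (C2 + 2 * K + C1 + 3) * e \<le> M\<^sup>2 * e" using e by (intro mult_right_mono) auto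
    define t u where "t = (K + 1) * e" and "u = (K + C1 + 2) * e"
    have V_cover: "?V \<subseteq> (\<Union>\<eta>\<in>C. {\<theta> \<in> coeff_ball b. sqdist \<theta> \<eta> \<le> D})"
      using VW C(4) E_ball by blast
    have S_ball: "?S \<subseteq> coeff_ball b" and C_ball: "C \<subseteq> coeff_ball b" using E_ball C(2) by auto
    have S_near: "sqdist \<theta> \<theta>0 \<le> D" if "\<theta> \<in> ?S" for \<theta> using that by simp
    have "\<exists>G\<in>sets (sample_space \<theta>0).
      measure (sample_space \<theta>0) G \<le> exp (n * (chi_const b * D) - t) + card C * exp (- real n * H / 2)
          + card C * exp (n * (chi_const b * D - H / 4) + u) \<and>
      (\<forall>X\<in>space (sample_space \<theta>0) - G.
        (LINT \<theta>:?V|prior p Q \<alpha> \<sigma> n. likelihood n X \<theta>) / (LINT \<theta>|prior p Q \<alpha> \<sigma> n. likelihood n X \<theta>)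
          \<le> exp (t - u) / m)"
      by (rule posterior_ratio_bound[OF pr sets_prior \<theta>0b S_sets S_ball S_near m0 m C(1) C_ball H V_cover])
    then obtain G where G: "G \<in> sets (sample_space \<theta>0)"
      "measure (sample_space \<theta>0) G \<le> exp (n * (chi_const b * D) - t) + card C * exp (- real n * H / 2)
          + card C * exp (n * (chi_const b * D - H / 4) + u)"
      "\<forall>X\<in>space (sample_space \<theta>0) - G.
        (LINT \<theta>:?V|prior p Q \<alpha> \<sigma> n. likelihood n X \<theta>) / (LINT \<theta>|prior p Q \<alpha> \<sigma> n. likelihood n X \<theta>)
          \<le> exp (t - u) / m"
      by blast
    have nonneg: "0 \<le> C2 * e" "0 \<le> K * e" "0 \<le> C1 * e" using C1 C2 K e by auto
    have expand: "4 * (C2 + 2 * K + C1 + 3) * e = 4 * (C2 * e) + 8 * (K * e) + 4 * (C1 * e) + 12 * e"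
      "t = K * e + e" "u = K * e + C1 * e + 2 * e"
      by (simp_all add: t_def u_def algebra_simps)
    have 1: "exp (n * (chi_const b * D) - t) \<le> exp (- e)"
      using nD by (simp add: expand)
    have 2: "card C * exp (- real n * H / 2) \<le> exp (- e)"
    proof -
      have "card C * exp (- real n * H / 2) \<le> exp (C2 * e) * exp (- real n * H / 2)"
        using card by (intro mult_right_mono) auto
      also have "\<dots> = exp (C2 * e - (real n * H) / 2)" by (simp flip: exp_add)
      also have "\<dots> \<le> exp (- e)" using M2e nonneg e unfolding nH expand by simp
      finally show ?thesis .
    qed
    have 3: "card C * exp (n * (chi_const b * D - H / 4) + u) \<le> exp (- e)"
    proof -
      have "n * (chi_const b * D - H / 4) + u = n * (chi_const b * D) - (real n * H) / 4 + u"
        by (simp add: right_diff_distrib)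
      also have "\<dots> \<le> - (C2 * e) - e"
        using nD M2e nonneg e unfolding nH expand by simp
      finally have "exp (n * (chi_const b * D - H / 4) + u) \<le> exp (- (C2 * e) - e)" by simp
      then have "card C * exp (n * (chi_const b * D - H / 4) + u) \<le> exp (C2 * e) * exp (- (C2 * e) - e)"
        using card by (intro mult_mono) auto
      also have "\<dots> = exp (- e)" by (simp flip: exp_add)
      finally show ?thesis .
    qed
    have "exp (t - u) / m = exp (- e)"
      unfolding m_def exp_diff[symmetric] by (simp add: expand)
    with G(3) have post: "\<forall>X\<in>space (sample_space \<theta>0) - G.
        posterior p Q \<alpha> \<sigma> n X {model_measure \<theta> | \<theta>. \<theta> \<in> ?E \<and> hellinger \<theta>0 \<theta> > M * rate p n}
          \<le> exp (- e)"
      unfolding posterior_def by simp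
    have "measure (sample_space \<theta>0) G \<le> 3 * exp (- e)" using G(2) 1 2 3 by linarith
    with G(1) post show "\<exists>G\<in>sets (sample_space \<theta>0).
      measure (sample_space \<theta>0) G \<le> 3 * exp (- effective_size p n) \<and>
      (\<forall>X\<in>space (sample_space \<theta>0) - G.
        posterior p Q \<alpha> \<sigma> n X {model_measure \<theta> | \<theta>. \<theta> \<in> ?E \<and> hellinger \<theta>0 \<theta> > M * rate p n}
          \<le> exp (- effective_size p n))"
      unfolding e_def by blast
  qed
qed

theorem theorem2:
  fixes p :: nat and Q \<alpha> \<sigma> :: real and \<theta>0 :: "nat \<Rightarrow> real"
  assumes "p \<ge> 1" and "Q > 0" and "\<alpha> > 1 / 2" and "\<sigma>\<^sup>2 > 0"
    and "\<theta>0 \<in> sobolev_ellipsoid p Q"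
  shows "\<exists>M0>0. \<forall>M\<ge>M0.
    AE X in PiM (UNIV :: nat set) (\<lambda>_. model_measure \<theta>0).
      (\<lambda>n. posterior p Q \<alpha> \<sigma> n X
             {model_measure \<theta> | \<theta>. \<theta> \<in> sobolev_ellipsoid p Q \<and>
                hellinger \<theta>0 \<theta> > M * real n powr (- (real p / (2 * real p + 1)))})
      \<longlonglongrightarrow> 0"
proof -
  define C where "C M n = {model_measure \<theta> | \<theta>. \<theta> \<in> sobolev_ellipsoid p Q \<and> hellinger \<theta>0 \<theta> > M * rate p n}"
    for M n
  define good where "good M n G \<longleftrightarrow> measure (sample_space \<theta>0) G \<le> 3 * exp (- effective_size p n) \<and>
    (\<forall>X\<in>space (sample_space \<theta>0) - G. posterior p Q \<alpha> \<sigma> n X (C M n) \<le> exp (- effective_size p n))"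
    for M n G
  have "\<exists>M0>0. \<exists>n0. \<forall>M\<ge>M0. \<forall>n\<ge>n0. \<exists>G\<in>sets (sample_space \<theta>0). good M n G"
    unfolding good_def C_def by (rule posterior_contraction_step[OF assms])
  then obtain M0 n0 where M0: "M0 > 0"
    and step: "\<And>M n. M0 \<le> M \<Longrightarrow> n0 \<le> n \<Longrightarrow> \<exists>G\<in>sets (sample_space \<theta>0). good M n G"
    by blast
  have "\<theta>0 \<in> coeff_ball (Q + const_A p)"
    using sobolev_ellipsoid_subset_coeff_ball[OF assms(1)] assms(5) by auto
  then interpret S: prob_space "sample_space \<theta>0"
    by (intro prob_space_PiM prob_space_model_measure)
  have "AE X in sample_space \<theta>0. (\<lambda>n. posterior p Q \<alpha> \<sigma> n X (C M n)) \<longlonglongrightarrow> 0" if M: "M0 \<le> M" for M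
  proof -
    have "\<forall>n. \<exists>G. G \<in> sets (sample_space \<theta>0) \<and> (n0 \<le> n \<longrightarrow> good M n G)"
      using step[OF M] by blast
    from choice[OF this] obtain G where G: "\<And>n. G n \<in> sets (sample_space \<theta>0)"
      and good: "\<And>n. n0 \<le> n \<Longrightarrow> good M n (G n)"
      by blast
    have "summable (\<lambda>n. measure (sample_space \<theta>0) (G n))"
    proof (rule summable_comparison_test')
      show "summable (\<lambda>n. 3 * exp (- effective_size p n))"
        by (intro summable_mult summable_exp_effective_size)
      show "norm (measure (sample_space \<theta>0) (G n)) \<le> 3 * exp (- effective_size p n)" if "n0 \<le> n" for n
        using good[OF that] by (simp add: good_def)
    qed
    then have "AE X in sample_space \<theta>0. eventually (\<lambda>n. X \<in> space (sample_space \<theta>0) - G n) sequentially"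
      by (intro borel_cantelli_AE1 G) (simp_all add: S.emeasure_eq_measure)
    then show ?thesis
    proof eventually_elim
      case (elim X)
      have le: "eventually (\<lambda>n. posterior p Q \<alpha> \<sigma> n X (C M n) \<le> exp (- effective_size p n)) sequentially"
        using elim eventually_ge_at_top[of n0]
      proof eventually_elim
        case (elim n)
        then show ?case using good[of n] unfolding good_def by blast
      qed
      have ge: "eventually (\<lambda>n. 0 \<le> posterior p Q \<alpha> \<sigma> n X (C M n)) sequentially"
        by (simp add: posterior_nonneg)
      show ?case
        by (rule tendsto_sandwich[OF ge le tendsto_const summable_LIMSEQ_zero[OF summable_exp_effective_size]])
    qed
  qed
  then have "\<forall>M\<ge>M0. AE X in sample_space \<theta>0. (\<lambda>n. posterior p Q \<alpha> \<sigma> n X (C M n)) \<longlonglongrightarrow> 0" by blast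
  with M0 show ?thesis unfolding C_def rate_def by (intro exI[of _ M0] conjI)
qed

end
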